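(* Let $g_0$ be the round metric of curvature one on $\mathbb S^4$. For any $q\in(1,5)$ and any positive integer $k$, the equation $$-\Delta_{g_0}u+\lambda u=\lambda u^q$$ on $(\mathbb S^4,g_0)$ has at least $k$ different positive $O(3)\times O(2)$-invariant solutions if $\lambda\in\left(\frac{2k(2k+3)}{q-1},\frac{2(k+1)(2k+5)}{q-1}\right]$.
   Context: $\Delta_{g_0}$ is the Laplace–Beltrami operator, with the sign convention that $-\Delta_{g_0}$ is nonnegative. $O(3)\times O(2)$ acts isometrically on $\mathbb S^4\subset\mathbb R^5=\mathbb R^3\oplus\mathbb R^2$ in the standard way, $(A,B)\cdot(x,y)=(Ax,By)$. *)

theory Defs
  imports "HOL-Analysis.Analysis"
begin

text \<open>
  Everything below concerns the unit sphere \<open>sphere 0 1\<close> of a Euclidean space, with the Riemannian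
  metric induced by the ambient inner product (the round metric of curvature one when the sphere
  has dimension at least two). The Laplace--Beltrami operator is the Riemannian divergence of the
  Riemannian gradient.
\<close>

definition sphere_tangent :: "'a::euclidean_space \<Rightarrow> 'a set" where
  "sphere_tangent p = {v. p \<bullet> v = 0}"

definition sphere_tangent_proj :: "'a::euclidean_space \<Rightarrow> 'a \<Rightarrow> 'a" where
  "sphere_tangent_proj p v = v - (p \<bullet> v) *\<^sub>R p"

text \<open>
  The differential at \<open>p\<close> of a map on the sphere. A derivative within the sphere is determined
  on tangent vectors only; the condition \<open>D p = 0\<close> extends it by zero to the normal line and makes it
  unique (lemma \<open>sphere_deriv_eqI\<close> below).
\<close>

definition sphere_deriv ::
  "('a::euclidean_space \<Rightarrow> 'b::real_normed_vector) \<Rightarrow> 'a \<Rightarrow> 'a \<Rightarrow> 'b" where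
  "sphere_deriv f p = (THE D. (f has_derivative D) (at p within sphere 0 1) \<and> D p = 0)"

definition sphere_C1 :: "('a::euclidean_space \<Rightarrow> 'b::real_normed_vector) \<Rightarrow> bool" where
  "sphere_C1 f \<longleftrightarrow>
     (\<forall>p\<in>sphere 0 1. f differentiable (at p within sphere 0 1)) \<and>
     (\<forall>v. continuous_on (sphere 0 1) (\<lambda>p. sphere_deriv f p v))"

definition sphere_grad :: "('a::euclidean_space \<Rightarrow> real) \<Rightarrow> 'a \<Rightarrow> 'a" where
  "sphere_grad u p =
     (THE w. w \<in> sphere_tangent p \<and> (\<forall>v\<in>sphere_tangent p. sphere_deriv u p v = w \<bullet> v))"

definition sphere_C2 :: "('a::euclidean_space \<Rightarrow> real) \<Rightarrow> bool" where
  "sphere_C2 u \<longleftrightarrow> sphere_C1 u \<and> sphere_C1 (sphere_grad u)"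

text \<open>
  The Levi-Civita connection of a submanifold of Euclidean space is the tangential
  part of the ambient derivative.
\<close>

definition sphere_cov_deriv :: "('a::euclidean_space \<Rightarrow> 'a) \<Rightarrow> 'a \<Rightarrow> 'a \<Rightarrow> 'a" where
  "sphere_cov_deriv X p v = sphere_tangent_proj p (sphere_deriv X p v)"

text \<open>
  The divergence is the trace of \<open>v \<mapsto> \<nabla>\<^sub>v X\<close> on the tangent space. As \<open>sphere_cov_deriv X p\<close>
  vanishes on the normal line and takes tangential values, this is its trace on the ambient space.
\<close>

definition sphere_div :: "('a::euclidean_space \<Rightarrow> 'a) \<Rightarrow> 'a \<Rightarrow> real" where
  "sphere_div X p = (\<Sum>b\<in>Basis. sphere_cov_deriv X p b \<bullet> b)"

definition sphere_laplacian :: "('a::euclidean_space \<Rightarrow> real) \<Rightarrow> 'a \<Rightarrow> real" where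
  "sphere_laplacian u p = sphere_div (sphere_grad u) p"

lemma sphere_derivative_unique:
  fixes f :: "'a::euclidean_space \<Rightarrow> 'b::real_normed_vector"
  assumes p: "p \<in> sphere 0 1"
    and D: "(f has_derivative D) (at p within sphere 0 1)" "D p = 0"
    and D': "(f has_derivative D') (at p within sphere 0 1)" "D' p = 0"
  shows "D = D'"
proof -
  have pp: "p \<bullet> p = 1"
    using p by (simp add: norm_eq_1)
  have lin: "linear D" "linear D'"
    using D(1) D'(1) has_derivative_linear by blast+
  have unit: "D v = D' v" if v: "p \<bullet> v = 0" "norm v = 1" for v
  proof -
    define c where "c = (\<lambda>t::real. cos t *\<^sub>R p + sin t *\<^sub>R v)"
    have vv: "v \<bullet> v = 1"
      using v(2) by (simp add: norm_eq_1)
    have "c t \<bullet> c t = 1" for t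
    proof -
      have "c t \<bullet> c t = (cos t)\<^sup>2 + (sin t)\<^sup>2"
        using pp vv v(1) by (simp add: c_def inner_add_left inner_add_right inner_commute[of v p] power2_eq_square)
      then show ?thesis by simp
    qed
    then have cS: "range c \<subseteq> sphere 0 1"
      by (auto simp: norm_eq_1)
    have c0: "c 0 = p"
      by (simp add: c_def)
    have "(c has_vector_derivative v) (at 0)"
      unfolding c_def by (auto intro!: derivative_eq_intros)
    then have cd: "(c has_derivative (\<lambda>t. t *\<^sub>R v)) (at 0)"
      by (simp add: has_vector_derivative_def)
    have chain: "((\<lambda>t. f (c t)) has_derivative (\<lambda>t. E (t *\<^sub>R v))) (at 0)"
      if "(f has_derivative E) (at p within sphere 0 1)" for E
      using has_derivative_in_compose[OF cd, of f E] that has_derivative_subset[OF that cS]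
      by (simp add: c0)
    have "(\<lambda>t. D (t *\<^sub>R v)) = (\<lambda>t. D' (t *\<^sub>R v))"
      using has_derivative_unique[OF chain[OF D(1)] chain[OF D'(1)]] .
    then show ?thesis
      by (metis scaleR_one)
  qed
  show ?thesis
  proof
    fix v
    define w where "w = sphere_tangent_proj p v"
    have w: "p \<bullet> w = 0"
      using pp by (simp add: w_def sphere_tangent_proj_def inner_diff_right)
    have vw: "v = w + (p \<bullet> v) *\<^sub>R p"
      by (simp add: w_def sphere_tangent_proj_def)
    have "D w = D' w"
    proof (cases "w = 0")
      case True
      then show ?thesis
        using lin by (simp add: linear_0)
    next
      case False
      define e where "e = w /\<^sub>R norm w"
      have "D e = D' e"
        using unit[of e] w False by (simp add: e_def)
      moreover have "w = norm w *\<^sub>R e"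
        using False by (simp add: e_def)
      ultimately show ?thesis
        using lin by (metis linear_scale)
    qed
    then show "D v = D' v"
      using lin D(2) D'(2) by (subst (1 2) vw) (simp add: linear_add linear_scale)
  qed
qed

lemma sphere_deriv_eqI:
  assumes "p \<in> sphere 0 1" "(f has_derivative D) (at p within sphere 0 1)" "D p = 0"
  shows "sphere_deriv f p = D"
  unfolding sphere_deriv_def using assms sphere_derivative_unique by (intro the_equality) blast+

text \<open>\<open>\<real>\<^sup>5 = \<real>\<^sup>3 \<oplus> \<real>\<^sup>2\<close>; the norm of the product type is the Euclidean one.\<close>

type_synonym R5 = "(real ^ 3) \<times> (real ^ 2)"

abbreviation S4 :: "R5 set" where
  "S4 \<equiv> sphere 0 1"

definition O3xO2_invariant :: "(R5 \<Rightarrow> real) \<Rightarrow> bool" where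
  "O3xO2_invariant u \<longleftrightarrow>
     (\<forall>(A :: real^3^3) (B :: real^2^2). orthogonal_matrix A \<longrightarrow> orthogonal_matrix B \<longrightarrow>
        (\<forall>x y. (x, y) \<in> S4 \<longrightarrow> u (A *v x, B *v y) = u (x, y)))"

text \<open>
  Positive \<open>O(3) \<times> O(2)\<close>-invariant classical (\<open>C\<^sup>2\<close>) solutions. Functions on the sphere are
  represented extensionally, so that different elements of this set differ at a point of the sphere.
\<close>

definition invariant_solutions :: "real \<Rightarrow> real \<Rightarrow> (R5 \<Rightarrow> real) set" where
  "invariant_solutions q l =
     {u \<in> extensional S4. sphere_C2 u \<and> O3xO2_invariant u \<and>
        (\<forall>p\<in>S4. u p > 0) \<and>
        (\<forall>p\<in>S4. - sphere_laplacian u p + l * u p = l * u p powr q)}"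

end

theory Submission
  imports Defs
begin

text \<open>
  An invariant function is a function \<open>w\<close> of \<open>r = norm x\<close>, where \<open>(x, y)\<close> is a point of the sphere,
  and the equation becomes \<open>(r\<^sup>2 (1 - r\<^sup>2) w')' = - l r\<^sup>2 (w powr q - w)\<close> on \<open>(0, 1)\<close>, singular at both
  ends. Shoot from \<open>r = 0\<close> with initial value \<open>b\<close> in \<open>(0, 1)\<close>; the shot extends to a solution on the
  sphere (\<open>b\<close> is regular) iff its momentum \<open>r\<^sup>2 (1 - r\<^sup>2) w'\<close> tends to zero at \<open>r = 1\<close>. Count the crossings of \<open>w\<close> with the
  constant solution \<open>1\<close>. All crossings are transversal, so the count is lower semicontinuous in \<open>b\<close>, it
  can only change by a crossing moving in through \<open>r = 1\<close>, one at a time, and this happens only at a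
  regular \<open>b\<close>. There is no crossing for \<open>b = 0\<close>. For \<open>b\<close> near \<open>1\<close>, comparison with
  \<open>sin ((2k + 3/2) s)\<close>, \<open>r = sin s\<close>, yields \<open>k\<close> crossings because \<open>l (q - 1) > 2k (2k + 3)\<close>. Hence for
  every \<open>j\<close> with \<open>2 \<le> j \<le> k\<close> the infimum of the \<open>b\<close> with at least \<open>j\<close> crossings is regular, and these
  infima are distinct; the constant solution is the \<open>k\<close>th one. Energy estimates bound the regular shots a
  priori, which allows the nonlinearity to be truncated from the start.
\<close>

section \<open>Calculus on intervals\<close>

text \<open>The numbers \<open>2 * j * (2 * j + 3)\<close> are the eigenvalues of the negative
  Laplacian on invariant functions: the invariant harmonic polynomials have even degree
  \<open>2 * j\<close>. Linearised at the solution 1, the equation has the zeroth order coefficient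
  \<open>l * (q - 1)\<close>; the condition on \<open>l\<close> puts k nonconstant modes below it,
  whose oscillation is inherited by shots starting close to 1. The two ends differ. At r = 0 the
  orbit is a circle with three normal directions, at r = 1 a 2-sphere with two. A start below 1 has
  nonpositive energy, which controls the shot until the orbit volume is maximal. After that the
  momentum stays bounded, so the shot can diverge at r = 1 only logarithmically, and all powers of a
  logarithm are integrable; this is the source of the a priori bound. The bound does not involve the
  truncation, whose level is chosen above it. Thresholds start at two crossings because the limit
  may lose one through r = 1; the crossing that remains shows that the infimum is not 0. At the
  threshold for \<open>j\<close> the count is exactly \<open>j - 1\<close>, which separates the
  infima.\<close>

lemma nonpos_deriv_le:
  fixes h h' :: "real \<Rightarrow> real"
  assumes "a \<le> b" "continuous_on {a..b} h"
    and "\<And>x. a < x \<Longrightarrow> x < b \<Longrightarrow> DERIV h x :> h' x"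
    and "\<And>x. a < x \<Longrightarrow> x < b \<Longrightarrow> h' x \<le> 0"
  shows "h b \<le> h a"
  using DERIV_nonpos_imp_decreasing_open[of a b h] assms by blast

lemma nonneg_deriv_le:
  fixes h h' :: "real \<Rightarrow> real"
  assumes "a \<le> b" "continuous_on {a..b} h"
    and "\<And>x. a < x \<Longrightarrow> x < b \<Longrightarrow> DERIV h x :> h' x"
    and "\<And>x. a < x \<Longrightarrow> x < b \<Longrightarrow> 0 \<le> h' x"
  shows "h a \<le> h b"
  using DERIV_nonneg_imp_increasing_open[of a b h] assms by blast

text \<open>Monotonicity of \<open>k - h\<close> and \<open>k + h\<close>. A majorant
  \<open>k\<close> in closed form takes the place of an integral estimate, and the derivatives enter
  only between the endpoints, where the equation may be singular.\<close>

lemma abs_diff_le_of_deriv: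
  fixes h k h' k' :: "real \<Rightarrow> real"
  assumes ab: "a \<le> b" and c: "continuous_on {a..b} h" "continuous_on {a..b} k"
    and d: "\<And>x. a < x \<Longrightarrow> x < b \<Longrightarrow> DERIV h x :> h' x"
      "\<And>x. a < x \<Longrightarrow> x < b \<Longrightarrow> DERIV k x :> k' x"
    and le: "\<And>x. a < x \<Longrightarrow> x < b \<Longrightarrow> \<bar>h' x\<bar> \<le> k' x"
  shows "\<bar>h b - h a\<bar> \<le> k b - k a"
proof -
  have "k a - h a \<le> k b - h b"
    by (rule nonneg_deriv_le[of a b "\<lambda>x. k x - h x" "\<lambda>x. k' x - h' x", OF ab])
      (use le in \<open>force intro: continuous_intros c DERIV_diff d\<close>)+
  moreover have "k a + h a \<le> k b + h b"
    by (rule nonneg_deriv_le[of a b "\<lambda>x. k x + h x" "\<lambda>x. k' x + h' x", OF ab])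
      (use le in \<open>force intro: continuous_intros c DERIV_add d\<close>)+
  ultimately show ?thesis by auto
qed

lemma abs_diff_le_of_deriv_bound:
  fixes h h' :: "real \<Rightarrow> real"
  assumes ab: "a \<le> b" and c: "continuous_on {a..b} h"
    and d: "\<And>x. a < x \<Longrightarrow> x < b \<Longrightarrow> DERIV h x :> h' x"
    and le: "\<And>x. a < x \<Longrightarrow> x < b \<Longrightarrow> \<bar>h' x\<bar> \<le> C"
  shows "\<bar>h b - h a\<bar> \<le> C * (b - a)"
proof -
  have "\<bar>h b - h a\<bar> \<le> C * b - C * a"
    by (rule abs_diff_le_of_deriv[where k' = "\<lambda>_. C", OF ab c _ d _ le])
      (auto intro!: continuous_intros derivative_eq_intros)
  then show ?thesis by (simp add: right_diff_distrib)
qed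

text \<open>The product \<open>e x * exp (- C * (x - a))\<close> is nonincreasing. The differential
  inequality is required only in the open interval, so the estimate can start at the singular point
  0.\<close>

lemma gronwall_forward:
  fixes e :: "real \<Rightarrow> real"
  assumes "a \<le> b" "continuous_on {a..b} e"
    and d: "\<And>x. a < x \<Longrightarrow> x < b \<Longrightarrow> \<exists>d. DERIV e x :> d \<and> d \<le> C * e x"
  shows "e b \<le> e a * exp (C * (b - a))"
proof -
  obtain e' where e': "\<And>x. a < x \<Longrightarrow> x < b \<Longrightarrow> DERIV e x :> e' x \<and> e' x \<le> C * e x"
    using d by metis
  have "e b * exp (- C * (b - a)) \<le> e a * exp (- C * (a - a))"
  proof (rule nonpos_deriv_le[of a b "\<lambda>x. e x * exp (- C * (x - a))", OF assms(1)])
    fix x assume x: "a < x" "x < b"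
    show "DERIV (\<lambda>x. e x * exp (- C * (x - a))) x :> (e' x - C * e x) * exp (- C * (x - a))"
      by (auto intro!: derivative_eq_intros conjunct1[OF e'[OF x]] simp: algebra_simps)
    show "(e' x - C * e x) * exp (- C * (x - a)) \<le> 0"
      using e'[OF x] by (simp add: mult_nonpos_nonneg)
  qed (intro continuous_intros assms)
  then have "e b * exp (- C * (b - a)) * exp (C * (b - a)) \<le> e a * exp (C * (b - a))"
    by simp
  then show ?thesis by (simp add: mult.assoc flip: exp_add)
qed

lemma gronwall_backward:
  fixes e :: "real \<Rightarrow> real"
  assumes "a \<le> b" "continuous_on {a..b} e"
    and d: "\<And>x. a < x \<Longrightarrow> x < b \<Longrightarrow> \<exists>d. DERIV e x :> d \<and> - C * e x \<le> d"
  shows "e a \<le> e b * exp (C * (b - a))"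
proof -
  have "\<exists>d. DERIV (\<lambda>x. e (- x)) x :> d \<and> d \<le> C * e (- x)" if x: "- b < x" "x < - a" for x
  proof -
    obtain d where "(e has_real_derivative d) (at (- x))" "- C * e (- x) \<le> d"
      using d[of "- x"] x by auto
    then show ?thesis by (intro exI[of _ "- d"]) (auto simp: DERIV_mirror)
  qed
  moreover have "continuous_on {- b..- a} (\<lambda>x. e (- x))"
    by (rule continuous_on_compose2[OF assms(2)]) (auto intro: continuous_intros)
  ultimately show ?thesis using gronwall_forward[of "- b" "- a" "\<lambda>x. e (- x)" C] assms(1) by simp
qed

lemma continuous_on_half_openI:
  fixes h :: "real \<Rightarrow> real"
  assumes "\<And>Y. 0 \<le> Y \<Longrightarrow> Y < 1 \<Longrightarrow> continuous_on {0..Y} h"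
  shows "continuous_on {0..<1} h"
proof (rule continuous_on_eq_continuous_within[THEN iffD2], rule ballI)
  fix x :: real assume x: "x \<in> {0..<1}"
  define Y where "Y = (1 + x) / 2"
  have "continuous (at x within {0..Y}) h"
    using assms[of Y] x by (auto simp: continuous_on_eq_continuous_within Y_def)
  moreover have "at x within {0..<1} = at x within {0..Y}"
    by (rule at_within_nhd[of _ "{..<Y}"]) (use x in \<open>auto simp: Y_def\<close>)
  ultimately show "continuous (at x within {0..<1}) h"
    by (simp add: continuous_within)
qed

lemma FTC_half_open:
  fixes h :: "real \<Rightarrow> real"
  assumes c: "continuous_on {0..<1} h"
  shows "continuous_on {0..<1} (\<lambda>x. integral {0..x} h)"
    and "0 < x \<Longrightarrow> x < 1 \<Longrightarrow> DERIV (\<lambda>x. integral {0..x} h) x :> h x"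
proof -
  have d: "((\<lambda>x. integral {0..x} h) has_real_derivative h x) (at x within {0..Y})"
    if "x \<in> {0..Y}" "Y < 1" for x Y
  proof (rule integral_has_real_derivative)
    show "continuous_on {0..Y} h" by (rule continuous_on_subset[OF c]) (use that in auto)
  qed (use that in auto)
  show "continuous_on {0..<1} (\<lambda>x. integral {0..x} h)"
    by (rule continuous_on_half_openI, rule DERIV_continuous_on, rule d) auto
  show "DERIV (\<lambda>x. integral {0..x} h) x :> h x" if "0 < x" "x < 1"
    using d[of x "(1+x)/2"] that at_within_Icc_at[of 0 x "(1+x)/2"] by simp
qed

lemma eventually_at_left_1I:
  fixes a :: real
  assumes "a < 1" "\<And>y. a < y \<Longrightarrow> y < 1 \<Longrightarrow> P y"
  shows "\<forall>\<^sub>F y in at_left 1. P y"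
  using assms eventually_at_left[of a 1 P] by blast

lemma DERIV_zero_const:
  fixes h :: "real \<Rightarrow> real"
  assumes "a \<le> b" "continuous_on {a..b} h" "\<And>x. a < x \<Longrightarrow> x < b \<Longrightarrow> DERIV h x :> 0"
  shows "h b = h a"
proof (rule antisym)
  show "h b \<le> h a" by (rule nonpos_deriv_le[OF assms]) auto
  show "h a \<le> h b" by (rule nonneg_deriv_le[OF assms]) auto
qed

lemma two_mult_abs_le: "2 * \<bar>a * b\<bar> \<le> a^2 + b^2" for a b :: real
  using sum_squares_bound[of "\<bar>a\<bar>" "\<bar>b\<bar>"] by (simp add: abs_mult)

lemma sq_dist_deriv:
  fixes w w' g g' :: "real \<Rightarrow> real"
  assumes "DERIV w x :> a" "DERIV w' x :> a'"
    "DERIV g x :> c" "DERIV g' x :> c'"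
  shows "DERIV (\<lambda>x. (w x - w' x)^2 + (g x - g' x)^2) x :> 2 * (w x - w' x) * (a - a') + 2 * (g x - g' x) * (c - c')"
  by (rule derivative_eq_intros assms refl)+ (simp add: mult_ac)

lemma one_minus_square_pos: "0 < 1 - x^2" if "0 \<le> x" "x < 1" for x :: real
  using that by (simp add: power_less_one_iff abs_square_less_1)

lemma square_weight_lower:
  fixes c x :: real
  assumes "c \<le> x^2" "0 \<le> x" "x < 1"
  shows "c * (1 - x) \<le> x^2 * (1 - x^2)"
proof (rule mult_mono)
  show "1 - x \<le> 1 - x^2" using assms by (simp add: power2_eq_square mult_left_le)
qed (use assms in auto)

text \<open>\<open>W\<close> is the integral of \<open>d\<close> up to a constant, and this integral
  has one-sided derivatives at the ends. In this way a derivative computed inside the interval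
  reaches the singular ends.\<close>

lemma deriv_extends_to_Icc:
  fixes W d :: "real \<Rightarrow> real"
  assumes c: "continuous_on {a..b} W" "continuous_on {a..b} d"
    and D: "\<And>x. a < x \<Longrightarrow> x < b \<Longrightarrow> DERIV W x :> d x"
    and y: "y \<in> {a..b}"
  shows "(W has_real_derivative d y) (at y within {a..b})"
proof -
  have eq: "W a + integral {a..x} d = W x" if x: "x \<in> {a..b}" for x
  proof -
    have "(d has_integral W x - W a) {a..x}"
    proof (rule fundamental_theorem_of_calculus_interior)
      show "continuous_on {a..x} W" by (rule continuous_on_subset[OF c(1)]) (use x in auto)
    qed (use x D in \<open>auto simp: has_real_derivative_iff_has_vector_derivative\<close>)
    then show ?thesis by (simp add: integral_unique)
  qed
  have "((\<lambda>x. W a + integral {a..x} d) has_real_derivative 0 + d y) (at y within {a..b})"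
    using integral_has_real_derivative[OF c(2) y] by (intro DERIV_add DERIV_const)
  then show ?thesis
    using has_field_derivative_transform_within[of _ "0 + d y" y "{a..b}" 1 W] y eq by auto
qed

lemma continuous_on_Icc_extend:
  fixes u :: "real \<Rightarrow> real"
  assumes "continuous_on {0..<1} u" "(u \<longlongrightarrow> u 1) (at_left 1)"
  shows "continuous_on {0..1} u"
proof (rule continuous_on_eq_continuous_within[THEN iffD2], rule ballI)
  fix x :: real assume x: "x \<in> {0..1}"
  show "continuous (at x within {0..1}) u"
  proof (cases "x = 1")
    case True
    have "at (1::real) within {0..1} = at_left 1" by (rule at_within_Icc_at_left) simp
    then show ?thesis using assms(2) True by (simp add: continuous_within)
  next
    case False
    then have "x \<in> {0..<1}" using x by auto
    then have "continuous (at x within {0..<1}) u"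
      using assms(1) continuous_on_eq_continuous_within by blast
    moreover have "at x within {0..1} = at x within {0..<1}"
      by (rule at_within_nhd[of _ "{..<1}"]) (use x False in auto)
    ultimately show ?thesis by (simp add: continuous_within)
  qed
qed

lemma continuous_on_glue:
  fixes u :: "real \<Rightarrow> real"
  assumes "continuous_on {0..<1} u" "continuous_on {1/2..1} u"
  shows "continuous_on {0..1} u"
proof (rule continuous_on_Icc_extend[OF assms(1)])
  have "at (1::real) within {1/2..1} = at_left 1" by (rule at_within_Icc_at_left) simp
  moreover have "(u \<longlongrightarrow> u 1) (at 1 within {1/2..1})" using assms(2) by (simp add: continuous_on_def)
  ultimately show "(u \<longlongrightarrow> u 1) (at_left 1)" by simp
qed

text \<open>Each of the two formulas for the derivative is good at one end only; on the overlap they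
  agree by uniqueness of derivatives.\<close>

lemma deriv_glue:
  fixes u v1 v2 :: "real \<Rightarrow> real"
  assumes 1: "\<And>y. y \<in> {0..<1} \<Longrightarrow> (u has_real_derivative v1 y) (at y within {0..<1})" "continuous_on {0..<1} v1"
    and 2: "\<And>y. y \<in> {1/2..1} \<Longrightarrow> (u has_real_derivative v2 y) (at y within {1/2..1})" "continuous_on {1/2..1} v2"
  obtains v where "continuous_on {0..1} v"
    "\<And>y. y \<in> {0..1} \<Longrightarrow> (u has_real_derivative v y) (at y within {0..1})"
proof -
  have eq: "v1 y = v2 y" if y: "1/2 < y" "y < 1" for y
  proof (rule DERIV_unique)
    have "at y within {0..<1} = at y" by (rule at_within_interior) (use y in auto)
    then show "DERIV u y :> v1 y" using 1(1)[of y] y by simp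
    have "at y within {1/2..1} = at y" by (rule at_within_Icc_at) (use y in auto)
    then show "DERIV u y :> v2 y" using 2(1)[of y] y by simp
  qed
  define v where "v y = (if y < 1 then v1 y else v2 1)" for y
  show thesis
  proof (rule that[of v])
    show "continuous_on {0..1} v"
    proof (rule continuous_on_Icc_extend)
      show "continuous_on {0..<1} v" by (rule continuous_on_eq[OF 1(2)]) (simp add: v_def)
      have "at (1::real) within {1/2..1} = at_left 1" by (rule at_within_Icc_at_left) simp
      moreover have "(v2 \<longlongrightarrow> v2 1) (at 1 within {1/2..1})" using 2(2) by (simp add: continuous_on_def)
      ultimately have "(v2 \<longlongrightarrow> v2 1) (at_left 1)" by simp
      moreover have "\<forall>\<^sub>F y in at_left 1. v2 y = v y"
        by (rule eventually_at_left_1I[of "1/2"]) (auto simp: v_def eq)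
      ultimately have "(v \<longlongrightarrow> v2 1) (at_left 1)" by (rule Lim_transform_eventually)
      then show "(v \<longlongrightarrow> v 1) (at_left 1)" by (simp add: v_def[of 1])
    qed
    fix y :: real assume y: "y \<in> {0..1}"
    show "(u has_real_derivative v y) (at y within {0..1})"
    proof (cases "y < 1")
      case True
      then have "at y within {0..1} = at y within {0..<1}"
        by (intro at_within_nhd[of _ "{..<1}"]) auto
      then show ?thesis using 1(1)[of y] y True by (simp add: v_def)
    next
      case False
      then have [simp]: "y = 1" using y by simp
      have "at (1::real) within {0..1} = at 1 within {1/2..1}"
        by (intro at_within_nhd[of _ "{1/2<..}"]) auto
      then show ?thesis using 2(1)[of 1] by (simp add: v_def)
    qed
  qed
qed

section \<open>Averages over affine arguments as functions of a parameter\<close>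

lemma param_integral_continuous:
  fixes m \<omega> \<alpha> \<beta> :: "real \<Rightarrow> real"
  assumes m: "continuous_on J m" and c: "continuous_on {0..1} \<omega>" "continuous_on {0..1} \<alpha>" "continuous_on {0..1} \<beta>"
    and J: "\<And>y s. y \<in> U \<Longrightarrow> s \<in> {0..1} \<Longrightarrow> \<alpha> s + \<beta> s * y \<in> J"
  shows "continuous_on U (\<lambda>y. integral {0..1} (\<lambda>s. \<omega> s * m (\<alpha> s + \<beta> s * y)))"
proof -
  have c': "continuous_on (U \<times> {0..1}) (\<lambda>z. \<phi> (snd z))" if "continuous_on {0..1} \<phi>" for \<phi> :: "real \<Rightarrow> real"
    by (rule continuous_on_compose2[OF that]) (auto intro!: continuous_intros)
  have "continuous_on (U \<times> {0..1}) (\<lambda>z. \<omega> (snd z) * m (\<alpha> (snd z) + \<beta> (snd z) * fst z))"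
    by (intro continuous_intros c' c continuous_on_compose2[OF m]) (use J in auto)
  then show ?thesis
    using integral_continuous_on_param[of U 0 1 "\<lambda>y s. \<omega> s * m (\<alpha> s + \<beta> s * y)"]
    by (simp add: case_prod_unfold)
qed

lemma param_integral_deriv:
  fixes m m' \<omega> \<alpha> \<beta> :: "real \<Rightarrow> real"
  assumes U: "convex U" and m: "\<And>t. t \<in> J \<Longrightarrow> (m has_real_derivative m' t) (at t within J)" "continuous_on J m'"
    and c: "continuous_on {0..1} \<omega>" "continuous_on {0..1} \<alpha>" "continuous_on {0..1} \<beta>"
    and J: "\<And>y s. y \<in> U \<Longrightarrow> s \<in> {0..1} \<Longrightarrow> \<alpha> s + \<beta> s * y \<in> J" and y: "y \<in> U"
  shows "((\<lambda>y. integral {0..1} (\<lambda>s. \<omega> s * m (\<alpha> s + \<beta> s * y))) has_real_derivative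
    integral {0..1} (\<lambda>s. (\<omega> s * \<beta> s) * m' (\<alpha> s + \<beta> s * y))) (at y within U)"
proof -
  have mc: "continuous_on J m" using m(1) DERIV_continuous_on by blast
  have c': "continuous_on (U \<times> {0..1}) (\<lambda>z. \<phi> (snd z))" if "continuous_on {0..1} \<phi>" for \<phi> :: "real \<Rightarrow> real"
    by (rule continuous_on_compose2[OF that]) (auto intro!: continuous_intros)
  have "((\<lambda>y. integral (cbox 0 1) (\<lambda>s. \<omega> s * m (\<alpha> s + \<beta> s * y))) has_real_derivative
    integral (cbox 0 1) (\<lambda>s. (\<omega> s * \<beta> s) * m' (\<alpha> s + \<beta> s * y))) (at y within U)"
  proof (rule leibniz_rule_field_derivative[OF _ _ _ y U])
    fix x t :: real assume x: "x \<in> U" and t: "t \<in> cbox 0 1"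
    have "((\<lambda>x. \<alpha> t + \<beta> t * x) has_real_derivative \<beta> t) (at x within U)"
      by (auto intro!: derivative_eq_intros)
    moreover have "(m has_real_derivative m' (\<alpha> t + \<beta> t * x)) (at (\<alpha> t + \<beta> t * x) within (\<lambda>x. \<alpha> t + \<beta> t * x) ` U)"
      by (rule DERIV_subset[OF m(1)]) (use J x t in auto)
    ultimately have "((\<lambda>x. m (\<alpha> t + \<beta> t * x)) has_real_derivative m' (\<alpha> t + \<beta> t * x) * \<beta> t) (at x within U)"
      using DERIV_image_chain[of m _ "\<lambda>x. \<alpha> t + \<beta> t * x" x U "\<beta> t"] by (simp add: o_def)
    from DERIV_cmult[OF this, of "\<omega> t"]
    show "((\<lambda>x. \<omega> t * m (\<alpha> t + \<beta> t * x)) has_real_derivative (\<omega> t * \<beta> t) * m' (\<alpha> t + \<beta> t * x)) (at x within U)"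
      by (simp add: mult_ac)
  next
    fix x assume x: "x \<in> U"
    show "(\<lambda>s. \<omega> s * m (\<alpha> s + \<beta> s * x)) integrable_on cbox 0 1"
    proof (rule integrable_continuous)
      show "continuous_on (cbox 0 1) (\<lambda>s. \<omega> s * m (\<alpha> s + \<beta> s * x))"
        unfolding cbox_interval
        by (intro continuous_intros c continuous_on_compose2[OF mc]) (use J x in auto)
    qed
  next
    show "continuous_on (U \<times> cbox 0 1) (\<lambda>(x, t). (\<omega> t * \<beta> t) * m' (\<alpha> t + \<beta> t * x))"
      unfolding cbox_interval case_prod_unfold
      by (intro continuous_intros c' c continuous_on_compose2[OF m(2)]) (use J in auto)
  qed
  then show ?thesis by simp
qed

lemma continuous_on_sqrt_extend:
  fixes u :: "real \<Rightarrow> real"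
  assumes u: "continuous_on {0..<1} u" and l: "(u \<longlongrightarrow> l) (at_left 1)"
  shows "continuous_on {0..1} (\<lambda>y. if y < 1 then u (sqrt y) else l)" (is "continuous_on _ ?v")
proof (rule continuous_on_Icc_extend)
  have "continuous_on {0..<1} (\<lambda>y. u (sqrt y))"
    by (rule continuous_on_compose2[OF u]) (auto intro: continuous_intros)
  then show "continuous_on {0..<1} ?v" by (rule continuous_on_eq) simp
  have "((\<lambda>y. sqrt y) \<longlongrightarrow> sqrt 1) (at_left 1)" by (intro tendsto_intros)
  then have "filterlim sqrt (at_left 1) (at_left (1::real))"
    by (intro filterlim_at_withinI eventually_at_left_1I[of 0]) auto
  then have "((\<lambda>y. u (sqrt y)) \<longlongrightarrow> l) (at_left 1)" using filterlim_compose[OF l] by blast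
  moreover have "\<forall>\<^sub>F y in at_left 1. u (sqrt y) = ?v y"
    by (rule eventually_at_left_1I[of 0]) auto
  ultimately have "(?v \<longlongrightarrow> l) (at_left 1)" by (rule Lim_transform_eventually)
  then show "(?v \<longlongrightarrow> ?v 1) (at_left 1)" by simp
qed

section \<open>The radial initial value problem\<close>

text \<open>The integral of \<open>(x / 3) / (1 - x^2)\<close> from 0. A source bounded by 1
  produces a flux of at most \<open>lam * x / 3\<close>, so the powers of \<open>pot\<close> are the
  natural majorants of the Picard iterates.\<close>

definition pot :: "real \<Rightarrow> real" where "pot x = - ln (1 - x^2) / 6"

lemma pot_deriv: "0 < x \<Longrightarrow> x < 1 \<Longrightarrow> DERIV pot x :> x / 3 / (1 - x^2)"
  unfolding pot_def using one_minus_square_pos[of x]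
  by (auto intro!: derivative_eq_intros simp: field_simps)

lemma pot_continuous: "continuous_on {0..<1} pot"
  unfolding pot_def using one_minus_square_pos by (intro continuous_intros) force+

lemma pot_0: "pot 0 = 0" by (simp add: pot_def)

lemma pot_mono: "0 \<le> x \<Longrightarrow> x \<le> y \<Longrightarrow> y < 1 \<Longrightarrow> pot x \<le> pot y"
  unfolding pot_def using one_minus_square_pos[of y] one_minus_square_pos[of x] power_mono[of x y 2]
  by (auto simp: field_simps)

lemma pot_nonneg: "0 \<le> x \<Longrightarrow> x < 1 \<Longrightarrow> 0 \<le> pot x"
  using pot_mono[of 0 x] by (simp add: pot_0)

text \<open>
  The equation \<open>(x\<^sup>2 (1 - x\<^sup>2) w')' = - lam x\<^sup>2 f w\<close> is written as a system with the flux
  \<open>g = - (1 - x\<^sup>2) w'\<close>, which is regular at \<open>x = 0\<close>; the momentum \<open>x\<^sup>2 g\<close> is the quantity with a limit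
  at \<open>x = 1\<close>. A bounded \<open>f\<close> makes every shot global.
\<close>

locale shooting =
  fixes lam K L :: real and f :: "real \<Rightarrow> real"
  assumes lam_pos: "0 < lam"
    and f_bound: "\<bar>f x\<bar> \<le> K"
    and f_lipschitz: "\<bar>f x - f y\<bar> \<le> L * \<bar>x - y\<bar>"
    and f_0: "f 0 = 0" and f_1: "f 1 = 0"
begin

text \<open>The homogeneous flux equation is solved by \<open>1 / x^2\<close>. Continuity together
  with \<open>g 0 = 0\<close> discards this singular solution and leaves \<open>b\<close> as the
  only free datum at 0.\<close>

definition sol :: "real \<Rightarrow> (real \<Rightarrow> real) \<Rightarrow> (real \<Rightarrow> real) \<Rightarrow> bool" where
  "sol b w g \<longleftrightarrow> w 0 = b \<and> g 0 = 0 \<and> continuous_on {0..<1} w \<and> continuous_on {0..<1} g \<and>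
     (\<forall>x\<in>{0<..<1}. DERIV w x :> - g x / (1 - x^2) \<and>
        DERIV g x :> lam * f (w x) - 2 * g x / x)"

lemma K_nonneg: "0 \<le> K" using f_bound[of 0] by linarith

lemma L_nonneg: "0 \<le> L" using f_lipschitz[of 0 1] by simp

lemma f_continuous: "continuous_on A f"
proof -
  have "L-lipschitz_on UNIV f"
    using f_lipschitz L_nonneg by (auto intro!: lipschitz_onI simp: dist_real_def)
  then show ?thesis
    using lipschitz_on_continuous_on continuous_on_subset by blast
qed

section \<open>Existence by Picard iteration for the integrated system\<close>

definition flux_op :: "(real \<Rightarrow> real) \<Rightarrow> real \<Rightarrow> real" where
  "flux_op u x = (if x = 0 then 0 else lam / x^2 * integral {0..x} (\<lambda>s. s^2 * f (u s)))"

definition picard_op :: "real \<Rightarrow> (real \<Rightarrow> real) \<Rightarrow> real \<Rightarrow> real" where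
  "picard_op b u x = b - integral {0..x} (\<lambda>s. flux_op u s / (1 - s^2))"

lemma continuous_weighted: 
  assumes "continuous_on {0..<1} u" shows "continuous_on {0..<1} (\<lambda>s. s^2 * f (u s))"
  by (intro continuous_intros continuous_on_compose2[OF f_continuous[of UNIV]] assms) auto

text \<open>Integrating \<open>s^2\<close> gives \<open>x^3 / 3\<close>, which absorbs the weight
  \<open>1 / x^2\<close>; the factor \<open>x / 3\<close> that is left is the one built into
  \<open>pot\<close>.\<close>

lemma flux_op_diff_le:
  assumes u: "continuous_on {0..<1} u" "continuous_on {0..<1} v" and x: "0 \<le> x" "x < 1"
    and S: "\<And>s. 0 \<le> s \<Longrightarrow> s \<le> x \<Longrightarrow> \<bar>f (u s) - f (v s)\<bar> \<le> S"
  shows "\<bar>flux_op u x - flux_op v x\<bar> \<le> lam * S * x / 3"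
proof (cases "x = 0")
  case True then show ?thesis by (simp add: flux_op_def)
next
  case False
  define I where "I u x = integral {0..x} (\<lambda>s. s^2 * f (u s))" for u x
  have "\<bar>I u x - I v x - (I u 0 - I v 0)\<bar> \<le> S * x^3/3 - S * 0^3/3"
  proof (rule abs_diff_le_of_deriv[of 0 x "\<lambda>x. I u x - I v x" "\<lambda>x. S * x^3/3", OF x(1)])
    have "continuous_on {0..x} (I u)" if "continuous_on {0..<1} u" for u
      unfolding I_def
      by (rule continuous_on_subset[OF FTC_half_open(1)]) (use x that continuous_weighted in auto)
    then show "continuous_on {0..x} (\<lambda>x. I u x - I v x)" using u by (intro continuous_intros)
    show "continuous_on {0..x} (\<lambda>x. S * x^3/3)" by (intro continuous_intros) auto
    fix t assume t: "0 < t" "t < x"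
    have d: "DERIV (I u) t :> t^2 * f (u t)" if "continuous_on {0..<1} u" for u
      unfolding I_def
      by (rule FTC_half_open(2)) (use t x that continuous_weighted in auto)
    show "DERIV (\<lambda>x. I u x - I v x) t :> t^2 * f (u t) - t^2 * f (v t)"
      using d u by (auto intro!: derivative_eq_intros)
    show "DERIV (\<lambda>x. S * x^3/3) t :> S * t^2"
      by (auto intro!: derivative_eq_intros)
    show "\<bar>t^2 * f (u t) - t^2 * f (v t)\<bar> \<le> S * t^2"
    proof -
      have "\<bar>t^2 * f (u t) - t^2 * f (v t)\<bar> = t^2 * \<bar>f (u t) - f (v t)\<bar>"
        by (simp add: abs_mult flip: right_diff_distrib)
      also have "\<dots> \<le> t^2 * S" using S[of t] t by (intro mult_left_mono) auto
      finally show ?thesis by (simp add: mult.commute)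
    qed
  qed
  then have "\<bar>I u x - I v x\<bar> \<le> S * x^3/3" by (simp add: I_def)
  then have "lam / x^2 * \<bar>I u x - I v x\<bar> \<le> lam / x^2 * (S * x^3/3)"
    using lam_pos by (intro mult_left_mono) auto
  also have "\<dots> = lam * S * x / 3" using False by (simp add: power2_eq_square power3_eq_cube)
  also have "lam / x^2 * \<bar>I u x - I v x\<bar> = \<bar>flux_op u x - flux_op v x\<bar>"
  proof -
    have "flux_op u x - flux_op v x = lam / x^2 * (I u x - I v x)"
      using False by (simp add: flux_op_def I_def right_diff_distrib)
    then show ?thesis using lam_pos by (simp add: abs_mult)
  qed
  finally show ?thesis .
qed

lemma flux_op_zero: "flux_op (\<lambda>_. 0) = (\<lambda>_. 0)"
  unfolding flux_op_def f_0 by auto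

lemma flux_op_bound:
  assumes "continuous_on {0..<1} u" "0 \<le> x" "x < 1"
  shows "\<bar>flux_op u x\<bar> \<le> lam * K * x / 3"
  using flux_op_diff_le[of u "\<lambda>_. 0" x K] assms f_bound f_0 by (simp add: flux_op_zero)

lemma flux_op_deriv:
  assumes "continuous_on {0..<1} u" "0 < x" "x < 1"
  shows "DERIV (flux_op u) x :> lam * f (u x) - 2 * flux_op u x / x"
proof -
  have "DERIV (\<lambda>x. lam / x^2 * integral {0..x} (\<lambda>s. s^2 * f (u s))) x :> lam * f (u x) - 2 * flux_op u x / x"
    using assms(2)
    by (auto intro!: derivative_eq_intros FTC_half_open(2)[OF continuous_weighted[OF assms(1)]] assms
        simp: flux_op_def divide_simps) (simp add: algebra_simps power2_eq_square power4_eq_xxxx)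
  then show ?thesis
    by (rule has_field_derivative_transform_within_open[of _ _ _ "{0<..}"])
      (use assms in \<open>auto simp: flux_op_def\<close>)
qed

lemma flux_op_continuous:
  assumes "continuous_on {0..<1} u"
  shows "continuous_on {0..<1} (flux_op u)"
proof (rule continuous_on_eq_continuous_within[THEN iffD2], rule ballI)
  fix x :: real assume x: "x \<in> {0..<1}"
  show "continuous (at x within {0..<1}) (flux_op u)"
  proof (cases "x = 0")
    case False
    then show ?thesis
      using flux_op_deriv[OF assms, of x] x DERIV_isCont continuous_at_imp_continuous_at_within by fastforce
  next
    case True
    have "((\<lambda>x. lam * K * x / 3) \<longlongrightarrow> lam * K * 0 / 3) (at 0 within {0..<1})"
      by (intro tendsto_intros) auto
    then have "(flux_op u \<longlongrightarrow> 0) (at 0 within {0..<1})"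
      using flux_op_bound[OF assms]
      by (intro Lim_null_comparison[of "flux_op u" "\<lambda>x. lam * K * x / 3"]) (auto simp: eventually_at_filter)
    then show ?thesis using True by (simp add: continuous_within flux_op_def)
  qed
qed

lemma continuous_quotient:
  assumes "continuous_on {0..<1} g" shows "continuous_on {0..<1} (\<lambda>s::real. g s / (1 - s^2))"
  using assms one_minus_square_pos by (intro continuous_intros) force+

lemma picard_op_continuous:
  assumes "continuous_on {0..<1} u"
  shows "continuous_on {0..<1} (picard_op b u)"
  unfolding picard_op_def
  by (intro continuous_intros FTC_half_open(1) continuous_quotient flux_op_continuous assms)

lemma picard_op_deriv:
  assumes "continuous_on {0..<1} u" "0 < x" "x < 1"
  shows "DERIV (picard_op b u) x :> - flux_op u x / (1 - x^2)"
  unfolding picard_op_def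
  by (rule derivative_eq_intros FTC_half_open(2) continuous_quotient flux_op_continuous assms refl)+ simp

text \<open>One Picard step turns \<open>pot ^ n\<close> into \<open>pot ^ Suc n / Suc n\<close>,
  since the bound on the flux is \<open>3 * (1 - t^2)\<close> times the derivative of
  \<open>pot\<close> up to the same factor 1/3. The hypothesis has two variables because the flux at
  \<open>t\<close> depends on all \<open>s \<le> t\<close>.\<close>

lemma picard_op_diff_le:
  assumes u: "continuous_on {0..<1} u" "continuous_on {0..<1} v" and x: "0 \<le> x" "x < 1"
    and S: "\<And>s t. 0 \<le> s \<Longrightarrow> s \<le> t \<Longrightarrow> t \<le> x \<Longrightarrow> \<bar>f (u s) - f (v s)\<bar> \<le> C * pot t ^ n"
  shows "\<bar>picard_op b u x - picard_op b v x\<bar> \<le> lam * C * pot x ^ Suc n / Suc n"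
proof -
  let ?k = "\<lambda>x. lam * C * pot x ^ Suc n / Suc n"
  have "\<bar>picard_op b u x - picard_op b v x - (picard_op b u 0 - picard_op b v 0)\<bar> \<le> ?k x - ?k 0"
  proof (rule abs_diff_le_of_deriv[of 0 x "\<lambda>x. picard_op b u x - picard_op b v x" ?k, OF x(1)])
    show "continuous_on {0..x} (\<lambda>x. picard_op b u x - picard_op b v x)"
      by (intro continuous_intros continuous_on_subset[OF picard_op_continuous] u) (use x in auto)
    show "continuous_on {0..x} ?k"
      by (intro continuous_intros continuous_on_subset[OF pot_continuous]) (use x in auto)
    fix t assume t: "0 < t" "t < x"
    have p: "0 < 1 - t^2" using one_minus_square_pos[of t] t x by simp
    show "DERIV (\<lambda>x. picard_op b u x - picard_op b v x) t :> - flux_op u t / (1 - t^2) - - flux_op v t / (1 - t^2)"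
      using t x by (intro derivative_intros picard_op_deriv u) auto
    show "DERIV ?k t :> lam * (C * pot t ^ n) * t / 3 / (1 - t^2)"
      using t x by (auto intro!: derivative_eq_intros pot_deriv simp del: power_Suc)
    show "\<bar>- flux_op u t / (1 - t^2) - - flux_op v t / (1 - t^2)\<bar> \<le> lam * (C * pot t ^ n) * t / 3 / (1 - t^2)"
    proof -
      have "\<bar>flux_op u t - flux_op v t\<bar> \<le> lam * (C * pot t ^ n) * t / 3"
        using t x S by (intro flux_op_diff_le u) auto
      then have "\<bar>flux_op u t - flux_op v t\<bar> / (1 - t^2) \<le> lam * (C * pot t ^ n) * t / 3 / (1 - t^2)"
        using p by (intro divide_right_mono) auto
      moreover have "- flux_op u t / (1 - t^2) - - flux_op v t / (1 - t^2) = - ((flux_op u t - flux_op v t) / (1 - t^2))"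
        by (simp add: diff_divide_distrib)
      ultimately show ?thesis using p by (simp only: abs_minus_cancel abs_divide)
    qed
  qed
  then show ?thesis by (simp add: picard_op_def pot_0)
qed

text \<open>Successive differences are dominated by the series of
  \<open>exp (lam * L * pot Y)\<close> on \<open>{0..Y}\<close>. Hence a single iteration converges
  locally uniformly on the whole of \<open>{0..<1}\<close>.\<close>

lemma sol_exists: "\<exists>w g. sol b w g"
proof -
  define u where "u n = (picard_op b ^^ n) (\<lambda>_. b)" for n
  have u_Suc: "u (Suc n) = picard_op b (u n)" for n by (simp add: u_def)
  have uc: "continuous_on {0..<1} (u n)" for n
    by (induction n) (auto simp: u_def picard_op_continuous)
  have est: "\<bar>u (Suc n) x - u n x\<bar> \<le> lam * K * (lam * L) ^ n * pot x ^ Suc n / fact (Suc n)"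
    if "0 \<le> x" "x < 1" for n x using that
  proof (induction n arbitrary: x)
    case 0
    \<comment> \<open>The starting function is itself a Picard image, that of the zero function,
      because \<open>f 0 = 0\<close>. The first difference is therefore covered by
      \<open>picard_op_diff_le\<close> with exponent 0.\<close>
    have *: "picard_op b (\<lambda>_. 0) x = b" for x by (simp add: picard_op_def flux_op_zero)
    have "\<bar>picard_op b (u 0) x - picard_op b (\<lambda>_. 0) x\<bar> \<le> lam * K * pot x ^ Suc 0 / Suc 0"
      using 0 f_bound by (intro picard_op_diff_le uc) (auto simp: f_0)
    then show ?case by (simp add: u_Suc *) (simp add: u_def)
  next
    case (Suc n)
    let ?C = "L * (lam * K * (lam * L) ^ n / fact (Suc n))"
    have "\<bar>picard_op b (u (Suc n)) x - picard_op b (u n) x\<bar> \<le> lam * ?C * pot x ^ Suc (Suc n) / Suc (Suc n)"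
    proof (intro picard_op_diff_le uc Suc.prems)
      fix s t assume st: "0 \<le> s" "s \<le> t" "t \<le> x"
      have "\<bar>f (u (Suc n) s) - f (u n s)\<bar> \<le> L * \<bar>u (Suc n) s - u n s\<bar>" by (rule f_lipschitz)
      also have "\<dots> \<le> L * (lam * K * (lam * L) ^ n * pot s ^ Suc n / fact (Suc n))"
        using st Suc.prems L_nonneg by (intro mult_left_mono Suc.IH) auto
      also have "\<dots> = ?C * pot s ^ Suc n" by simp
      also have "\<dots> \<le> ?C * pot t ^ Suc n"
        using st Suc.prems L_nonneg K_nonneg lam_pos
        by (intro mult_left_mono power_mono pot_mono pot_nonneg mult_nonneg_nonneg divide_nonneg_nonneg) auto
      finally show "\<bar>f (u (Suc n) s) - f (u n s)\<bar> \<le> ?C * pot t ^ Suc n" .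
    qed
    also have "lam * ?C * pot x ^ Suc (Suc n) / Suc (Suc n) =
        lam * K * (lam * L) ^ Suc n * pot x ^ Suc (Suc n) / fact (Suc (Suc n))"
      unfolding fact_Suc[of "Suc n"] by (simp del: fact_Suc add: mult_ac)
    finally show ?case by (simp only: u_Suc)
  qed
  define w where "w x = b + suminf (\<lambda>i. u (Suc i) x - u i x)" for x
  have tel: "u n x = b + (\<Sum>i<n. u (Suc i) x - u i x)" for n x
    by (subst sum_lessThan_telescope) (simp add: u_def)
  have unif: "uniform_limit {0..Y} u w sequentially" if Y: "0 \<le> Y" "Y < 1" for Y
  proof -
    let ?M = "\<lambda>n. lam * K * pot Y * ((lam * L * pot Y) ^ n /\<^sub>R fact n)"
    have "uniform_limit {0..Y} (\<lambda>n x. \<Sum>i<n. u (Suc i) x - u i x) (\<lambda>x. suminf (\<lambda>i. u (Suc i) x - u i x)) sequentially"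
    proof (rule Weierstrass_m_test[of _ _ ?M])
      show "summable ?M" by (intro summable_mult summable_exp_generic)
      fix n x assume "x \<in> {0..Y}"
      then have x: "0 \<le> x" "x \<le> Y" "x < 1" using Y by auto
      have "\<bar>u (Suc n) x - u n x\<bar> \<le> lam * K * (lam * L) ^ n * pot x ^ Suc n / fact (Suc n)"
        using est x by blast
      also have "\<dots> \<le> lam * K * (lam * L) ^ n * pot Y ^ Suc n / fact n"
      proof -
        have c: "0 \<le> lam * K * (lam * L) ^ n" using lam_pos K_nonneg L_nonneg by simp
        have p: "pot x ^ Suc n \<le> pot Y ^ Suc n"
          using x Y by (intro power_mono pot_mono pot_nonneg)
        have "0 \<le> pot Y ^ Suc n" using Y by (intro zero_le_power pot_nonneg)
        then show ?thesis
          using fact_mono[of n "Suc n", where 'a=real] mult_left_mono[OF p c] mult_nonneg_nonneg[OF c]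
          by (intro frac_le) (auto simp del: fact_Suc power_Suc)
      qed
      also have "\<dots> = ?M n" by (simp add: power_mult_distrib field_simps)
      finally show "norm (u (Suc n) x - u n x) \<le> ?M n" by simp
    qed
    then have "uniform_limit {0..Y} (\<lambda>n x. b + (\<Sum>i<n. u (Suc i) x - u i x))
        (\<lambda>x. b + suminf (\<lambda>i. u (Suc i) x - u i x)) sequentially"
      by (intro uniform_limit_intros)
    then show ?thesis
      by (simp only: tel[symmetric] w_def[symmetric])
  qed
  have wc: "continuous_on {0..<1} w"
  proof (rule continuous_on_half_openI)
    fix Y :: real assume Y: "0 \<le> Y" "Y < 1"
    show "continuous_on {0..Y} w"
      by (rule uniform_limit_theorem[OF _ unif[OF Y]])
        (use uc Y in \<open>auto intro!: always_eventually continuous_on_subset[OF uc]\<close>)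
  qed
  have fixp: "picard_op b w x = w x" if x: "0 \<le> x" "x < 1" for x
  proof -
    have "(\<lambda>n. picard_op b (u n) x) \<longlonglongrightarrow> picard_op b w x"
    proof (rule tendstoI)
      fix e :: real assume e: "0 < e"
      define d where "d = e / (lam * L * pot x + 1)"
      have den: "0 < lam * L * pot x + 1"
        using lam_pos L_nonneg pot_nonneg[OF x] by (auto intro!: add_nonneg_pos)
      then have d: "0 < d" using e by (simp add: d_def)
      have "\<forall>\<^sub>F n in sequentially. \<forall>s\<in>{0..x}. dist (u n s) (w s) < d"
        using unif[OF x] d uniform_limitD by blast
      then show "\<forall>\<^sub>F n in sequentially. dist (picard_op b (u n) x) (picard_op b w x) < e"
      proof (rule eventually_mono)
        fix n assume n: "\<forall>s\<in>{0..x}. dist (u n s) (w s) < d"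
        have "\<bar>picard_op b (u n) x - picard_op b w x\<bar> \<le> lam * (L * d) * pot x ^ Suc 0 / Suc 0"
        proof (intro picard_op_diff_le uc wc x)
          fix s t assume "0 \<le> s" "s \<le> t" "t \<le> x"
          then have "\<bar>u n s - w s\<bar> \<le> d" using n by (force simp: dist_real_def)
          then have "L * \<bar>u n s - w s\<bar> \<le> L * d" using L_nonneg by (rule mult_left_mono)
          then show "\<bar>f (u n s) - f (w s)\<bar> \<le> L * d * pot t ^ 0"
            using f_lipschitz[of "u n s" "w s"] by simp
        qed
        also have "\<dots> = (lam * L * pot x) * d" by simp
        also have "\<dots> < (lam * L * pot x + 1) * d" using d by (simp add: algebra_simps)
        also have "\<dots> = e" using den by (simp add: d_def)
        finally show "dist (picard_op b (u n) x) (picard_op b w x) < e" by (simp add: dist_real_def)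
      qed
    qed
    moreover have "(\<lambda>n. u n x) \<longlonglongrightarrow> w x"
      using tendsto_uniform_limitI[OF unif[OF x], of x] x by auto
    then have "(\<lambda>n. picard_op b (u n) x) \<longlonglongrightarrow> w x"
      using LIMSEQ_Suc[of "\<lambda>n. u n x"] by (simp add: u_Suc)
    ultimately show ?thesis using LIMSEQ_unique by blast
  qed
  have "sol b w (flux_op w)"
    unfolding sol_def
  proof (intro conjI ballI)
    show "w 0 = b" using fixp[of 0] by (simp add: picard_op_def)
    show "flux_op w 0 = 0" by (simp add: flux_op_def)
    show "continuous_on {0..<1} w" by (fact wc)
    show "continuous_on {0..<1} (flux_op w)" using wc by (rule flux_op_continuous)
    fix x :: real assume x: "x \<in> {0<..<1}"
    show "DERIV (flux_op w) x :> lam * f (w x) - 2 * flux_op w x / x"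
      using x wc by (intro flux_op_deriv) auto
    have "DERIV (picard_op b w) x :> - flux_op w x / (1 - x^2)"
      using x wc by (intro picard_op_deriv) auto
    then show "DERIV w x :> - flux_op w x / (1 - x^2)"
      by (rule has_field_derivative_transform_within_open[of _ _ _ "{0<..<1}"])
        (use x fixp in auto)
  qed
  then show ?thesis by blast
qed

section \<open>Uniqueness and dependence on the data\<close>

lemma sol_deriv:
  assumes "sol b w g" "0 < x" "x < 1"
  shows "DERIV w x :> - g x / (1 - x^2)"
    and "DERIV g x :> lam * f (w x) - 2 * g x / x"
  using assms by (auto simp: sol_def)

lemma sol_continuous:
  assumes "sol b w g" "A \<subseteq> {0..<1}"
  shows "continuous_on A w" "continuous_on A g"
  using assms continuous_on_subset by (auto simp: sol_def)

lemma sol_zero: "sol 0 (\<lambda>_. 0) (\<lambda>_. 0)"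
  by (auto simp: sol_def f_0)

lemma sol_one: "sol 1 (\<lambda>_. 1) (\<lambda>_. 0)"
  by (auto simp: sol_def f_1)

text \<open>
  The singular term contributes \<open>- 4 (g - g')\<^sup>2 / x\<close>, of favourable sign, so the upper bound is
  uniform down to the singular point.
\<close>

lemma sol_sq_diff_deriv:
  assumes s: "sol b w g" "sol c w' g'" and x: "0 < x" "x \<le> Y" "Y < 1"
  defines "e \<equiv> \<lambda>x. (w x - w' x)^2 + (g x - g' x)^2"
  shows "\<exists>d. DERIV e x :> d \<and> d \<le> (1 / (1 - Y^2) + lam * L) * e x \<and>
    - (1 / (1 - Y^2) + lam * L + 4 / x) * e x \<le> d"
proof -
  define a where "a = w x - w' x"
  define h where "h = g x - g' x"
  define k where "k = f (w x) - f (w' x)"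
  define d where "d = 2 * a * (- h / (1 - x^2)) + 2 * h * (lam * k - 2 * h / x)"
  have p: "0 < 1 - Y^2" using one_minus_square_pos[of Y] x by simp
  have px: "1 - Y^2 \<le> 1 - x^2" using power_mono[of x Y 2] x by simp
  have "DERIV e x :> 2 * (w x - w' x) * (- g x / (1 - x^2) - - g' x / (1 - x^2))
      + 2 * (g x - g' x) * ((lam * f (w x) - 2 * g x / x) - (lam * f (w' x) - 2 * g' x / x))"
    unfolding e_def using x by (intro sq_dist_deriv sol_deriv[OF s(1)] sol_deriv[OF s(2)]) auto
  also have "2 * (w x - w' x) * (- g x / (1 - x^2) - - g' x / (1 - x^2))
      + 2 * (g x - g' x) * ((lam * f (w x) - 2 * g x / x) - (lam * f (w' x) - 2 * g' x / x)) = d"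
    by (simp add: d_def a_def h_def k_def algebra_simps diff_divide_distrib)
  finally have D: "DERIV e x :> d" .
  have k: "\<bar>k\<bar> \<le> L * \<bar>a\<bar>" unfolding k_def a_def by (rule f_lipschitz)
  have e: "e x = a^2 + h^2" by (simp add: e_def a_def h_def)
  have t: "2 * \<bar>a * h\<bar> \<le> e x" unfolding e by (rule two_mult_abs_le)
  have 1: "\<bar>2 * a * (- h / (1 - x^2))\<bar> \<le> 1 / (1 - Y^2) * e x"
  proof -
    have "\<bar>2 * a * (- h / (1 - x^2))\<bar> = (2 * \<bar>a * h\<bar>) / (1 - x^2)" using p px by (simp add: abs_mult)
    also have "\<dots> \<le> e x / (1 - Y^2)" using t p px by (intro frac_le) auto
    finally show ?thesis by simp
  qed
  have 2: "\<bar>2 * h * (lam * k)\<bar> \<le> lam * L * e x"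
  proof -
    have "\<bar>2 * h * (lam * k)\<bar> = lam * (2 * \<bar>h\<bar> * \<bar>k\<bar>)" using lam_pos by (simp add: abs_mult)
    also have "\<dots> \<le> lam * (2 * \<bar>h\<bar> * (L * \<bar>a\<bar>))" using lam_pos k by (intro mult_left_mono) auto
    also have "\<dots> = lam * L * (2 * \<bar>a * h\<bar>)" by (simp add: abs_mult)
    also have "\<dots> \<le> lam * L * e x" using t lam_pos L_nonneg by (intro mult_left_mono) auto
    finally show ?thesis .
  qed
  have 3: "0 \<le> 4 * h^2 / x" using x by simp
  have 4: "4 * h^2 / x \<le> 4 / x * e x" using x by (simp add: e divide_right_mono)
  have "d = 2 * a * (- h / (1 - x^2)) + 2 * h * (lam * k) - 4 * h^2 / x"
    by (simp add: d_def algebra_simps power2_eq_square)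
  moreover have "(1 / (1 - Y^2) + lam * L) * e x = 1 / (1 - Y^2) * e x + lam * L * e x"
    "- (1 / (1 - Y^2) + lam * L + 4 / x) * e x = - (1 / (1 - Y^2) * e x) - lam * L * e x - 4 / x * e x"
    by (simp_all add: algebra_simps)
  moreover have arith: "p1 + p2 - p3 \<le> q1 + q2" "- q1 - q2 - q3 \<le> p1 + p2 - p3"
    if "\<bar>p1\<bar> \<le> q1" "\<bar>p2\<bar> \<le> q2" "0 \<le> p3" "p3 \<le> q3" for p1 p2 p3 q1 q2 q3 :: real
    using that by linarith+
  ultimately have "d \<le> (1 / (1 - Y^2) + lam * L) * e x" "- (1 / (1 - Y^2) + lam * L + 4 / x) * e x \<le> d"
    using arith[OF 1 2 3 4] by simp_all
  with D show ?thesis by blast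
qed

lemma sol_sq_diff_le:
  assumes s: "sol b w g" "sol c w' g'" and x: "0 \<le> x" "x \<le> Y" "Y < 1"
  shows "(w x - w' x)^2 + (g x - g' x)^2 \<le> (b - c)^2 * exp ((1 / (1 - Y^2) + lam * L) * x)"
proof -
  let ?e = "\<lambda>x. (w x - w' x)^2 + (g x - g' x)^2"
  have "?e x \<le> ?e 0 * exp ((1 / (1 - Y^2) + lam * L) * (x - 0))"
  proof (rule gronwall_forward[OF x(1)])
    show "continuous_on {0..x} ?e"
      by (intro continuous_intros sol_continuous[OF s(1)] sol_continuous[OF s(2)]) (use x in auto)
    fix t assume "0 < t" "t < x"
    then show "\<exists>d. DERIV ?e t :> d \<and> d \<le> (1 / (1 - Y^2) + lam * L) * ?e t"
      using sol_sq_diff_deriv[OF s, of t Y] x by auto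
  qed
  then show ?thesis using s by (simp add: sol_def)
qed

lemma sol_unique:
  assumes s: "sol b w g" "sol b w' g'" and x: "0 \<le> x" "x < 1"
  shows "w x = w' x" "g x = g' x"
proof -
  have "(w x - w' x)^2 + (g x - g' x)^2 \<le> 0"
    using sol_sq_diff_le[OF s x(1) order_refl x(2)] by simp
  then have "(w x - w' x)^2 + (g x - g' x)^2 = 0" by (smt (verit) zero_le_power2)
  then show "w x = w' x" "g x = g' x" by (simp_all add: sum_power2_eq_zero_iff)
qed

text \<open>Run backwards, the singular term is unfavourable and the Gronwall constant contains
  \<open>4 / x\<close>. Equal data at \<open>z\<close> make the distance vanish at every positive
  \<open>x\<close> nevertheless, and continuity carries this to 0.\<close>

lemma sol_unique_backward:
  assumes s: "sol b w g" "sol c w' g'" and z: "0 < z" "z < 1"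
    and eq: "w z = w' z" "g z = g' z"
  shows "b = c"
proof -
  let ?e = "\<lambda>x. (w x - w' x)^2 + (g x - g' x)^2"
  have "w x - w' x = 0" if x: "x \<in> {0<..<z}" for x
  proof -
    define C where "C = 1 / (1 - z^2) + lam * L + 4 / x"
    have "?e x \<le> ?e z * exp (C * (z - x))"
    proof (rule gronwall_backward)
      show "x \<le> z" using x by simp
      show "continuous_on {x..z} ?e"
        by (intro continuous_intros sol_continuous[OF s(1)] sol_continuous[OF s(2)]) (use x z in auto)
      fix t assume t: "x < t" "t < z"
      obtain d where d: "DERIV ?e t :> d" "- (1 / (1 - z^2) + lam * L + 4 / t) * ?e t \<le> d"
        using sol_sq_diff_deriv[OF s, of t z] x z t by auto
      have "4 / t * ?e t \<le> 4 / x * ?e t" using x t by (intro mult_right_mono frac_le) auto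
      then have "- C * ?e t \<le> d" using d(2) by (simp add: C_def distrib_right left_diff_distrib)
      with d(1) show "\<exists>d. DERIV ?e t :> d \<and> - C * ?e t \<le> d" by blast
    qed
    also have "?e z = 0" using eq by simp
    finally have "?e x = 0" by (smt (verit) zero_le_power2 mult_zero_left)
    then show ?thesis by (simp add: sum_power2_eq_zero_iff)
  qed
  moreover have "continuous_on (closure {0<..<z}) (\<lambda>x. w x - w' x)"
    by (intro continuous_intros sol_continuous[OF s(1)] sol_continuous[OF s(2)]) (use z in auto)
  ultimately have "w 0 - w' 0 = 0"
    using continuous_constant_on_closure[of "{0<..<z}" "\<lambda>x. w x - w' x" 0 0] z by auto
  then show ?thesis using s by (simp add: sol_def)
qed

section \<open>Shots as functions of their initial value\<close>

definition shot :: "real \<Rightarrow> (real \<Rightarrow> real) \<times> (real \<Rightarrow> real)" where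
  "shot b = (SOME p. sol b (fst p) (snd p))"

definition prof :: "real \<Rightarrow> real \<Rightarrow> real" where "prof b = fst (shot b)"
definition flux :: "real \<Rightarrow> real \<Rightarrow> real" where "flux b = snd (shot b)"
definition mom :: "real \<Rightarrow> real \<Rightarrow> real" where "mom b x = x^2 * flux b x"

lemma sol_prof: "sol b (prof b) (flux b)"
proof -
  have "\<exists>p. sol b (fst p) (snd p)" using sol_exists[of b] by simp
  then show ?thesis unfolding prof_def flux_def shot_def by (rule someI_ex)
qed

lemma prof_start: "prof b 0 = b" and flux_start: "flux b 0 = 0" and mom_start: "mom b 0 = 0"
  using sol_prof[of b] by (auto simp: sol_def mom_def)

lemma prof_zero: "0 \<le> x \<Longrightarrow> x < 1 \<Longrightarrow> prof 0 x = 0"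
  using sol_unique[OF sol_prof sol_zero] by blast

lemma prof_one: "0 \<le> x \<Longrightarrow> x < 1 \<Longrightarrow> prof 1 x = 1"
  using sol_unique[OF sol_prof sol_one] by blast

lemma prof_continuous: "A \<subseteq> {0..<1} \<Longrightarrow> continuous_on A (prof b)"
  and flux_continuous: "A \<subseteq> {0..<1} \<Longrightarrow> continuous_on A (flux b)"
  using sol_continuous[OF sol_prof] by blast+

lemma mom_continuous: "A \<subseteq> {0..<1} \<Longrightarrow> continuous_on A (mom b)"
  unfolding mom_def by (intro continuous_intros flux_continuous)

lemma flux_deriv:
  "0 < x \<Longrightarrow> x < 1 \<Longrightarrow> DERIV (flux b) x :> lam * f (prof b x) - 2 * flux b x / x"
  using sol_deriv[OF sol_prof] by blast

lemma prof_deriv_flux: "0 < x \<Longrightarrow> x < 1 \<Longrightarrow> DERIV (prof b) x :> - flux b x / (1 - x^2)"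
  using sol_deriv[OF sol_prof] by blast

lemma prof_deriv:
  "0 < x \<Longrightarrow> x < 1 \<Longrightarrow> DERIV (prof b) x :> - mom b x / (x^2 * (1 - x^2))"
  using prof_deriv_flux[of x b] by (simp add: mom_def)

lemma mom_deriv:
  assumes "0 < x" "x < 1"
  shows "DERIV (mom b) x :> lam * x^2 * f (prof b x)"
  unfolding mom_def[abs_def]
  using assms by (auto intro!: derivative_eq_intros flux_deriv simp: field_simps power2_eq_square)

lemma mom_diff_le:
  assumes x: "0 \<le> x" "x \<le> y" "y < 1"
    and S: "\<And>t. x < t \<Longrightarrow> t < y \<Longrightarrow> \<bar>f (prof b t)\<bar> \<le> S"
  shows "\<bar>mom b y - mom b x\<bar> \<le> lam * S * (y - x)"
proof (rule abs_diff_le_of_deriv_bound[OF x(2)])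
  show "continuous_on {x..y} (mom b)" by (rule mom_continuous) (use x in auto)
  fix t assume t: "x < t" "t < y"
  show "DERIV (mom b) t :> lam * t^2 * f (prof b t)"
    by (rule mom_deriv) (use t x in auto)
  have "lam * t^2 * \<bar>f (prof b t)\<bar> \<le> lam * 1 * S"
    using lam_pos S[OF t] t x power_le_one[of t 2] by (intro mult_mono) auto
  then show "\<bar>lam * t^2 * f (prof b t)\<bar> \<le> lam * S" using lam_pos by (simp add: abs_mult)
qed

lemma prof_dependence:
  assumes "0 \<le> Y" "Y < 1"
  obtains B where "0 < B"
    "\<And>b c x. 0 \<le> x \<Longrightarrow> x \<le> Y \<Longrightarrow> \<bar>prof b x - prof c x\<bar> \<le> B * \<bar>b - c\<bar>"
    "\<And>b c x. 0 \<le> x \<Longrightarrow> x \<le> Y \<Longrightarrow> \<bar>flux b x - flux c x\<bar> \<le> B * \<bar>b - c\<bar>"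
proof -
  define C where "C = 1 / (1 - Y^2) + lam * L"
  define B where "B = exp (C * Y / 2)"
  have C: "0 \<le> C" using one_minus_square_pos[of Y] assms lam_pos L_nonneg by (simp add: C_def)
  have "(prof b x - prof c x)^2 + (flux b x - flux c x)^2 \<le> (B * (b - c))^2" if "0 \<le> x" "x \<le> Y" for b c x
  proof -
    have "(prof b x - prof c x)^2 + (flux b x - flux c x)^2 \<le> (b - c)^2 * exp (C * x)"
      unfolding C_def using that assms by (intro sol_sq_diff_le sol_prof) auto
    also have "\<dots> \<le> (b - c)^2 * exp (C * Y)"
      using C that by (intro mult_left_mono) (auto intro: mult_left_mono)
    also have "\<dots> = (B * (b - c))^2"
      by (simp add: B_def power_mult_distrib flip: exp_double)
    finally show ?thesis .
  qed
  then have "(prof b x - prof c x)^2 \<le> (B * (b - c))^2 \<and> (flux b x - flux c x)^2 \<le> (B * (b - c))^2"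
    if "0 \<le> x" "x \<le> Y" for b c x using that by (smt (verit) zero_le_power2)
  then have "\<bar>prof b x - prof c x\<bar> \<le> B * \<bar>b - c\<bar> \<and> \<bar>flux b x - flux c x\<bar> \<le> B * \<bar>b - c\<bar>"
    if "0 \<le> x" "x \<le> Y" for b c x using that by (simp add: abs_le_square_iff[symmetric] abs_mult B_def)
  then show thesis using that[of B] by (simp add: B_def)
qed

lemma prof_joint_continuous:
  assumes b: "\<beta> \<longlonglongrightarrow> b" and x: "\<xi> \<longlonglongrightarrow> x" "0 \<le> x" "x < 1" and xn: "\<And>n. 0 \<le> \<xi> n \<and> \<xi> n < 1"
  shows "(\<lambda>n. prof (\<beta> n) (\<xi> n)) \<longlonglongrightarrow> prof b x" "(\<lambda>n. flux (\<beta> n) (\<xi> n)) \<longlonglongrightarrow> flux b x"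
proof -
  define Y where "Y = (1 + x) / 2"
  have Y: "0 \<le> Y" "Y < 1" "x < Y" using x by (auto simp: Y_def)
  obtain B where B: "0 < B"
    "\<And>b c x. 0 \<le> x \<Longrightarrow> x \<le> Y \<Longrightarrow> \<bar>prof b x - prof c x\<bar> \<le> B * \<bar>b - c\<bar>"
    "\<And>b c x. 0 \<le> x \<Longrightarrow> x \<le> Y \<Longrightarrow> \<bar>flux b x - flux c x\<bar> \<le> B * \<bar>b - c\<bar>"
    using prof_dependence[OF Y(1,2)] by metis
  have ev: "eventually (\<lambda>n. \<xi> n \<le> Y) sequentially"
    using order_tendstoD(2)[OF x(1) Y(3)] by (rule eventually_mono) simp
  have z: "(\<lambda>n. B * \<bar>\<beta> n - b\<bar>) \<longlonglongrightarrow> 0"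
    using tendsto_mult_right_zero[OF tendsto_rabs_zero[OF LIM_zero[OF b]], of B] .
  have conv: "(\<lambda>n. u (\<beta> n) (\<xi> n)) \<longlonglongrightarrow> u b x"
    if u: "\<And>b c x. 0 \<le> x \<Longrightarrow> x \<le> Y \<Longrightarrow> \<bar>u b x - u c x\<bar> \<le> B * \<bar>b - c\<bar>" and c: "continuous_on {0..<1} (u b)"
    for u :: "real \<Rightarrow> real \<Rightarrow> real"
  proof -
    have "(\<lambda>n. u (\<beta> n) (\<xi> n) - u b (\<xi> n)) \<longlonglongrightarrow> 0"
      by (rule Lim_null_comparison[OF _ z]) (use ev in eventually_elim, use u xn in auto)
    moreover have "(\<lambda>n. u b (\<xi> n)) \<longlonglongrightarrow> u b x"
      using continuous_on_tendsto_compose[OF c x(1)] x xn by auto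
    ultimately show ?thesis using tendsto_add by fastforce
  qed
  show "(\<lambda>n. prof (\<beta> n) (\<xi> n)) \<longlonglongrightarrow> prof b x" by (rule conv) (use B(2) prof_continuous in auto)
  show "(\<lambda>n. flux (\<beta> n) (\<xi> n)) \<longlonglongrightarrow> flux b x" by (rule conv) (use B(3) flux_continuous in auto)
qed

text \<open>With vanishing momentum the shot would have the data of the constant solution 1 at
  \<open>z\<close>, and backward uniqueness would give \<open>b = 1\<close>.\<close>

lemma simple_zero:
  assumes "b \<noteq> 1" "0 < z" "z < 1" "prof b z = 1"
  shows "mom b z \<noteq> 0"
  using sol_unique_backward[OF sol_prof sol_one, of z b] assms by (auto simp: mom_def)

text \<open>
  Between two zeros of \<open>w - 1\<close> the momentum vanishes somewhere. Integrating the system twice bounds it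
  by itself times a factor that is small near \<open>1\<close>, because the singularity of \<open>w\<close> is integrable.
\<close>

lemma last_zone:
  obtains Y where "0 < Y" "Y < 1"
    "\<And>b y1 y2. b \<noteq> 1 \<Longrightarrow> Y \<le> y1 \<Longrightarrow> y1 < y2 \<Longrightarrow> y2 < 1 \<Longrightarrow> prof b y1 = 1 \<Longrightarrow> prof b y2 \<noteq> 1"
proof -
  \<comment> \<open>The factor 16 is 8 from the bound \<open>vb\<close> on the profile, times 2 from
    integrating \<open>1 / sqrt (1 - x)\<close>. The choice of \<open>Y\<close> then makes
    \<open>c * sqrt (1 - Y)\<close> less than 1.\<close>
  define c where "c = 16 * lam * L"
  have c: "0 \<le> c" using lam_pos L_nonneg by (simp add: c_def)
  define Y where "Y = max (1/2) (1 - 1 / (2 * (c + 1))^2)"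
  have Y: "1/2 \<le> Y" "Y < 1" using c by (auto simp: Y_def)
  have "1 - 1 / (2 * (c + 1))^2 \<le> Y" unfolding Y_def by (rule max.cobounded2)
  then have "sqrt (1 - Y) \<le> sqrt (1 / (2 * (c + 1))^2)"
    by (intro real_sqrt_le_mono) linarith
  also have "\<dots> = 1 / (2 * (c + 1))" using c by (simp add: real_sqrt_divide)
  finally have "c * sqrt (1 - Y) \<le> c * (1 / (2 * (c + 1)))" using c by (rule mult_left_mono)
  also have "\<dots> < 1" using c by (simp add: field_simps)
  finally have small: "c * sqrt (1 - Y) < 1" .
  have "prof b y2 \<noteq> 1" if b: "b \<noteq> 1" and y: "Y \<le> y1" "y1 < y2" "y2 < 1" and z1: "prof b y1 = 1" for b y1 y2
  proof
    assume z2: "prof b y2 = 1"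
    have y0: "0 < y1" using y Y by simp
    have sub: "{y1..y2} \<subseteq> {0..<1}" using y y0 by auto
    have "\<exists>z>y1. z < y2 \<and> DERIV (prof b) z :> 0"
      by (rule Rolle) (use y y0 z1 z2 prof_continuous[OF sub] prof_deriv real_differentiable_def in auto, meson less_trans prof_deriv)
    then obtain y3 where y3: "y1 < y3" "y3 < y2" "DERIV (prof b) y3 :> 0" by blast
    have "- mom b y3 / (y3^2 * (1 - y3^2)) = 0"
      using DERIV_unique[OF prof_deriv y3(3)] y y0 y3 by simp
    then have m3: "mom b y3 = 0"
      using one_minus_square_pos[of y3] y y0 y3 by auto
    have "continuous_on {y1..y2} (\<lambda>x. \<bar>mom b x\<bar>)" by (intro continuous_intros mom_continuous sub)
    then obtain y4 where y4: "y1 \<le> y4" "y4 \<le> y2" "\<And>x. y1 \<le> x \<Longrightarrow> x \<le> y2 \<Longrightarrow> \<bar>mom b x\<bar> \<le> \<bar>mom b y4\<bar>"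
      using continuous_attains_sup[of "{y1..y2}" "\<lambda>x. \<bar>mom b x\<bar>"] y by auto
    define M where "M = \<bar>mom b y4\<bar>"
    have M: "0 \<le> M" by (simp add: M_def)
    \<comment> \<open>The true growth is logarithmic. Weakening \<open>1 - s^2\<close> to
      \<open>(1 - s) * sqrt (1 - s)\<close> gives a primitive in closed form that is still
      integrable at 1.\<close>
    have vb: "\<bar>prof b t - 1\<bar> \<le> 8 * M / sqrt (1 - t)" if t: "y1 \<le> t" "t \<le> y2" for t
    proof -
      let ?k = "\<lambda>t. 8 * M / sqrt (1 - t)"
      have "\<bar>prof b t - prof b y1\<bar> \<le> ?k t - ?k y1"
      proof (rule abs_diff_le_of_deriv[of y1 t "prof b" ?k, OF t(1)])
        show "continuous_on {y1..t} (prof b)" by (rule prof_continuous) (use sub t in auto)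
        show "continuous_on {y1..t} ?k" by (intro continuous_intros) (use t y in auto)
        fix s assume s: "y1 < s" "s < t"
        have s': "1/2 \<le> s" "s < 1" using s t y Y by auto
        show "DERIV (prof b) s :> - mom b s / (s^2 * (1 - s^2))"
          by (rule prof_deriv) (use s' in auto)
        show "DERIV ?k s :> 4 * M / ((1 - s) * sqrt (1 - s))"
          using s' by (auto intro!: derivative_eq_intros simp: field_simps)
        show "\<bar>- mom b s / (s^2 * (1 - s^2))\<bar> \<le> 4 * M / ((1 - s) * sqrt (1 - s))"
        proof -
          have "0 < 1 - s^2" using one_minus_square_pos[of s] s' by simp
          then have "\<bar>- mom b s / (s^2 * (1 - s^2))\<bar> = \<bar>mom b s\<bar> / (s^2 * (1 - s^2))"
            by (simp add: abs_mult)
          also have "\<dots> \<le> M / (1 / 4 * ((1 - s) * sqrt (1 - s)))"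
          proof (rule frac_le)
            show "\<bar>mom b s\<bar> \<le> M" unfolding M_def by (rule y4(3)) (use s t in auto)
            show "0 < 1 / 4 * ((1 - s) * sqrt (1 - s))" using s' by simp
            have "(1 - s) * sqrt (1 - s) \<le> (1 - s) * (1 + s)"
            proof (intro mult_left_mono)
              have "sqrt (1 - s) \<le> 1" using s' by simp
              then show "sqrt (1 - s) \<le> 1 + s" using s' by linarith
            qed (use s' in auto)
            also have "\<dots> = 1 - s^2" by (simp add: algebra_simps power2_eq_square)
            finally have "(1 - s) * sqrt (1 - s) \<le> 1 - s^2" .
            moreover have "1 / 4 \<le> s^2" using power_mono[of "1/2" s 2] s' by (simp add: power2_eq_square)
            ultimately show "1 / 4 * ((1 - s) * sqrt (1 - s)) \<le> s^2 * (1 - s^2)"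
              using s' by (intro mult_mono) auto
          qed (use M in auto)
          finally show ?thesis by (simp add: mult.commute)
        qed
      qed
      moreover have "0 \<le> ?k y1" using M y by simp
      ultimately show ?thesis using z1 by simp
    qed
    have md: "\<bar>mom b t - mom b s\<bar> \<le> c * sqrt (1 - Y) * M" if st: "y1 \<le> s" "s \<le> t" "t \<le> y2" for s t
    proof -
      let ?k = "\<lambda>t. - c * M * sqrt (1 - t)"
      have "\<bar>mom b t - mom b s\<bar> \<le> ?k t - ?k s"
      proof (rule abs_diff_le_of_deriv[of s t "mom b" ?k, OF st(2)])
        show "continuous_on {s..t} (mom b)" by (rule mom_continuous) (use sub st in auto)
        show "continuous_on {s..t} ?k" by (intro continuous_intros)
        fix x assume x: "s < x" "x < t"
        have x': "1/2 \<le> x" "x < 1" using x st y Y by auto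
        show "DERIV (mom b) x :> lam * x^2 * f (prof b x)"
          by (rule mom_deriv) (use x' in auto)
        show "DERIV ?k x :> lam * 1 * (L * (8 * M / sqrt (1 - x)))"
          using x' by (auto intro!: derivative_eq_intros simp: field_simps c_def)
        show "\<bar>lam * x^2 * f (prof b x)\<bar> \<le> lam * 1 * (L * (8 * M / sqrt (1 - x)))"
        proof -
          have "\<bar>f (prof b x)\<bar> \<le> L * \<bar>prof b x - 1\<bar>" using f_lipschitz[of "prof b x" 1] by (simp add: f_1)
          also have "\<dots> \<le> L * (8 * M / sqrt (1 - x))"
            using vb[of x] x st L_nonneg by (intro mult_left_mono) auto
          finally have "\<bar>f (prof b x)\<bar> \<le> L * (8 * M / sqrt (1 - x))" .
          then have "lam * x^2 * \<bar>f (prof b x)\<bar> \<le> lam * 1 * (L * (8 * M / sqrt (1 - x)))"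
            using lam_pos x' power_le_one[of x 2] by (intro mult_mono) auto
          then show ?thesis using lam_pos by (simp add: abs_mult)
        qed
      qed
      also have "\<dots> \<le> c * M * sqrt (1 - s)" using c M st y by simp
      also have "\<dots> \<le> c * M * sqrt (1 - Y)"
        using c M st y by (intro mult_left_mono real_sqrt_le_mono) auto
      finally show ?thesis by (simp add: mult_ac)
    qed
    have "M \<le> c * sqrt (1 - Y) * M"
      using md[of y3 y4] md[of y4 y3] y3 y4 m3 by (cases "y3 \<le> y4") (auto simp: M_def)
    then have "M = 0" using small M by (smt (verit) mult_less_cancel_right2)
    then have "mom b y1 = 0" using y4(3)[of y1] y by (simp add: M_def)
    then show False using simple_zero[OF b _ _ z1] y y0 by simp
  qed
  then show thesis using that[of Y] Y by auto
qed

end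

section \<open>Alternations around the constant solution\<close>

lemma neg_one_power_cancel: "((-1) ^ i * p) * ((-1) ^ i * q) = p * (q::real)"
  by (cases "even i") auto

text \<open>
  \<open>alternates v j y\<close>: on \<open>[0, y]\<close> the function changes sign at least \<open>j\<close> times, starting with a
  negative value, and \<open>v y\<close> has the sign reached after \<open>j\<close> changes.
\<close>

primrec alternates :: "(real \<Rightarrow> real) \<Rightarrow> nat \<Rightarrow> real \<Rightarrow> bool" where
  "alternates v 0 y \<longleftrightarrow> 0 \<le> y \<and> v y < 0"
| "alternates v (Suc j) y \<longleftrightarrow> (\<exists>x<y. alternates v j x) \<and> 0 < (-1) ^ j * v y"

lemma alternates_SucI: "alternates v j x \<Longrightarrow> x < y \<Longrightarrow> 0 < (-1) ^ j * v y \<Longrightarrow> alternates v (Suc j) y"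
  by auto

lemma alternates_nonneg: "alternates v j y \<Longrightarrow> 0 \<le> y"
  by (induction j arbitrary: y) force+

lemma alternates_sign: "alternates v j y \<Longrightarrow> (-1) ^ j * v y < 0"
  by (cases j) auto

lemma alternates_less: "alternates v j y \<Longrightarrow> i \<le> j \<Longrightarrow> \<exists>x\<le>y. alternates v i x"
proof (induction j arbitrary: y)
  case (Suc j)
  show ?case
  proof (cases "i = Suc j")
    case False
    then have "i \<le> j" using Suc.prems by simp
    moreover obtain x where "x < y" "alternates v j x" using Suc.prems by auto
    ultimately show ?thesis using Suc.IH by (meson less_imp_le order_trans)
  qed (use Suc.prems in blast)
qed auto

lemma zero_between:
  fixes v :: "real \<Rightarrow> real"
  assumes c: "continuous_on {s..t} v" and "s < t" "v s * v t < 0"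
  obtains z where "s < z" "z < t" "v z = 0"
proof -
  obtain z where z: "s \<le> z" "z \<le> t" "v z = 0"
    using IVT'[of v s 0 t] IVT2'[of v t 0 s] assms by (auto simp: mult_less_0_iff)
  then have "z \<noteq> s" "z \<noteq> t" using assms(3) by auto
  with z show thesis by (intro that[of z]) auto
qed

text \<open>The witness is the last point with \<open>v \<le> 0\<close>: to its right
  \<open>v\<close> is positive, which determines the sign of the derivative. This sign is the
  information that survives when crossings pass to a limit.\<close>

lemma upward_crossing:
  fixes v :: "real \<Rightarrow> real"
  assumes "x < y" "v x < 0" "0 < v y" and c: "continuous_on {x..y} v"
  obtains z where "x < z" "z < y" "v z = 0" "\<And>d. DERIV v z :> d \<Longrightarrow> 0 \<le> d"
proof -
  let ?S = "{x..y} \<inter> v -` {..0}"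
  have "closed ?S" by (intro continuous_closed_preimage c) auto
  then have "compact ?S" by (auto simp: compact_eq_bounded_closed intro: bounded_subset[OF bounded_closed_interval[of x y]])
  moreover have "x \<in> ?S" using assms by auto
  ultimately obtain z where z: "z \<in> ?S" "\<And>t. t \<in> ?S \<Longrightarrow> t \<le> z"
    using compact_attains_sup[of ?S] by blast
  have zy: "x \<le> z" "z < y" "v z \<le> 0" using z(1) assms(3) by (auto simp: order_less_le)
  have pos: "0 < v t" if "z < t" "t \<le> y" for t using z(2)[of t] that zy by force
  have v0: "v z = 0"
  proof (rule ccontr)
    assume "v z \<noteq> 0"
    then obtain t where "z \<le> t" "t \<le> y" "v t = 0"
      using IVT'[of v z 0 y] continuous_on_subset[OF c, of "{z..y}"] zy assms(3) by auto
    then show False using pos[of t] \<open>v z \<noteq> 0\<close> by (cases "t = z") auto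
  qed
  show thesis
  proof (rule that[of z])
    show "x < z" using v0 assms(2) zy(1) by (cases "x = z") auto
    fix d assume d: "DERIV v z :> d"
    show "0 \<le> d"
    proof (rule ccontr)
      assume "\<not> 0 \<le> d"
      then obtain e where e: "0 < e" "\<And>h. 0 < h \<Longrightarrow> h < e \<Longrightarrow> v (z + h) < v z"
        using DERIV_neg_dec_right[OF d] by auto
      define h where "h = min (e / 2) (y - z)"
      have "0 < h" "h < e" "z + h \<le> y" using e zy by (auto simp: h_def)
      then show False using e(2)[of h] pos[of "z + h"] v0 by auto
    qed
  qed (use zy v0 in auto)
qed

text \<open>A simple zero forces opposite signs at \<open>z - h\<close> and \<open>z + h\<close>.
  The given zeros need not be all zeros, so the sign before \<open>z\<close> may be either one;
  exactly one of the two points carries the sign wanted next. If it is \<open>z - h\<close>, a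
  further change has occurred earlier.\<close>

lemma alternates_of_zeros:
  assumes v0: "v 0 < 0"
    and simple: "\<And>z. 0 < z \<Longrightarrow> z < 1 \<Longrightarrow> v z = 0 \<Longrightarrow> \<exists>d. d \<noteq> 0 \<and> DERIV v z :> d"
    and mono: "\<And>i j. i < j \<Longrightarrow> j < k \<Longrightarrow> \<zeta> i < \<zeta> j"
    and zeros: "\<And>i. i < k \<Longrightarrow> 0 < \<zeta> i \<and> \<zeta> i < y \<and> v (\<zeta> i) = 0"
    and y: "0 \<le> y" "y < 1" "v y \<noteq> 0"
  shows "\<exists>x\<le>y. alternates v k x"
  using mono zeros y
proof (induction k arbitrary: y)
  case 0
  then show ?case using v0 by (intro exI[of _ 0]) auto
next
  case (Suc k)
  define z where "z = \<zeta> k"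
  have z: "0 < z" "z < y" "v z = 0" using Suc.prems(2)[of k] by (auto simp: z_def)
  then obtain d where d: "d \<noteq> 0" "DERIV v z :> d" using simple[of z] Suc.prems by auto
  define m where "m = Max (insert 0 (\<zeta> ` {..<k}))"
  have m: "m < z" "0 \<le> m" using z Suc.prems(1)[of _ k] by (auto simp: m_def z_def)
  have mz: "\<zeta> i \<le> m" if "i < k" for i using that by (auto simp: m_def)
  obtain e where e: "0 < e" "\<And>h. 0 < h \<Longrightarrow> h < e \<Longrightarrow> v (z - h) * v (z + h) < 0"
  proof -
    have D: "DERIV (\<lambda>x. d * v x) z :> d * d" by (rule DERIV_cmult[OF d(2)])
    have dd: "0 < d * d" using d(1) by (auto simp: zero_less_mult_iff)
    obtain e1 where e1: "0 < e1" "\<And>h. 0 < h \<Longrightarrow> h < e1 \<Longrightarrow> d * v z < d * v (z + h)"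
      using DERIV_pos_inc_right[OF D dd] by blast
    obtain e2 where e2: "0 < e2" "\<And>h. 0 < h \<Longrightarrow> h < e2 \<Longrightarrow> d * v (z - h) < d * v z"
      using DERIV_pos_inc_left[OF D dd] by blast
    show ?thesis
    proof (rule that[of "min e1 e2"])
      fix h assume "0 < h" "h < min e1 e2"
      then show "v (z - h) * v (z + h) < 0"
        using e1(2)[of h] e2(2)[of h] z(3) by (auto simp: zero_less_mult_iff mult_less_0_iff)
    qed (use e1 e2 in auto)
  qed
  define h where "h = min (e / 2) (min ((z - m) / 2) ((y - z) / 2))"
  have h: "0 < h" "h < e" "h < z - m" "h < y - z" using e(1) m z by (auto simp: h_def min_def)
  have neg: "v (z - h) * v (z + h) < 0" using e h by blast
  have "\<exists>x\<le>z - h. alternates v k x"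
  proof (rule Suc.IH)
    show "\<zeta> i < \<zeta> j" if "i < j" "j < k" for i j using Suc.prems(1) that by simp
    show "0 < \<zeta> i \<and> \<zeta> i < z - h \<and> v (\<zeta> i) = 0" if "i < k" for i
      using Suc.prems(2)[of i] mz[of i] h that by auto
    show "0 \<le> z - h" "z - h < 1" using h m z Suc.prems by auto
    show "v (z - h) \<noteq> 0" using neg by auto
  qed
  then obtain x where x: "x \<le> z - h" "alternates v k x" by blast
  show ?case
  proof (cases "0 < (-1) ^ k * v (z + h)")
    case True
    moreover have "x < z + h" using x(1) h(1) by linarith
    ultimately have "alternates v (Suc k) (z + h)" using x(2) by auto
    then show ?thesis using h by (intro exI[of _ "z + h"]) auto
  next
    case False
    have "((-1) ^ k * v (z - h)) * ((-1) ^ k * v (z + h)) < 0"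
      using neg by (simp only: neg_one_power_cancel)
    then have p: "0 < (-1) ^ k * v (z - h)" using False by (simp add: mult_less_0_iff)
    then have "x < z - h" using alternates_sign[OF x(2)] x(1) by (cases "x = z - h") auto
    then have "alternates v (Suc k) (z - h)" using x(2) p by auto
    then show ?thesis using h z by (intro exI[of _ "z - h"]) auto
  qed
qed

section \<open>Crossings of shots: stability and passage to the limit\<close>

context shooting begin

abbreviation osc :: "real \<Rightarrow> nat \<Rightarrow> real \<Rightarrow> bool" where
  "osc b \<equiv> alternates (\<lambda>x. prof b x - 1)"

definition regular :: "real \<Rightarrow> bool" where
  "regular b \<longleftrightarrow> (mom b \<longlongrightarrow> 0) (at_left 1)"

text \<open>Finitely many strict inequalities at fixed points below 1 persist under perturbation;
  this is the lower semicontinuity of the count.\<close>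

lemma osc_open:
  assumes "osc b j y" "y < 1" "\<beta> \<longlonglongrightarrow> b"
  shows "\<forall>\<^sub>F n in sequentially. osc (\<beta> n) j y"
  using assms(1,2)
proof (induction j arbitrary: y)
  case 0
  have "(\<lambda>n. prof (\<beta> n) y - 1) \<longlonglongrightarrow> prof b y - 1"
    using prof_joint_continuous(1)[OF assms(3), of "\<lambda>_. y" y] 0 by (auto intro!: tendsto_intros)
  then show ?case using 0 by (auto dest!: order_tendstoD(2)[of _ _ _ 0])
next
  case (Suc j)
  then obtain x where x: "x < y" "osc b j x" by auto
  have y: "0 \<le> y" using Suc.prems alternates_nonneg by blast
  have "(\<lambda>n. (-1) ^ j * (prof (\<beta> n) y - 1)) \<longlonglongrightarrow> (-1) ^ j * (prof b y - 1)"
    using prof_joint_continuous(1)[OF assms(3), of "\<lambda>_. y" y] y Suc.prems by (auto intro!: tendsto_intros)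
  then have "\<forall>\<^sub>F n in sequentially. 0 < (-1) ^ j * (prof (\<beta> n) y - 1)"
    using Suc.prems by (intro order_tendstoD(1)) auto
  moreover have "\<forall>\<^sub>F n in sequentially. osc (\<beta> n) j x" using Suc.IH[OF x(2)] x Suc.prems by simp
  ultimately show ?case by eventually_elim (use x in auto)
qed

text \<open>
  Neighbouring crossings have derivatives of opposite sign, and limits of crossings are transversal;
  hence they cannot merge.
\<close>

lemma osc_limit:
  assumes "b < 1" "\<beta> \<longlonglongrightarrow> b" "\<eta> \<longlonglongrightarrow> y" "y < 1" "\<And>n. \<eta> n < 1" "\<And>n. osc (\<beta> n) j (\<eta> n)" "0 < e"
  shows "\<exists>z\<le>y + e. osc b j z"
  using assms(2-)
proof (induction j arbitrary: \<beta> \<eta> y e)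
  case 0
  have "0 \<le> y" using 0 by (intro LIMSEQ_le_const[OF 0(2)]) (auto intro: alternates_nonneg)
  then show ?case using 0 assms(1) by (intro exI[of _ 0]) (auto simp: prof_start)
next
  case (Suc j)
  have "\<forall>n. \<exists>x<\<eta> n. osc (\<beta> n) j x" using Suc.prems(5) by simp
  then obtain \<xi> where \<xi>: "\<And>n. \<xi> n < \<eta> n" "\<And>n. osc (\<beta> n) j (\<xi> n)" by metis
  have \<xi>0: "0 \<le> \<xi> n" for n using \<xi>(2) alternates_nonneg by blast
  have "\<exists>z. \<xi> n < z \<and> z < \<eta> n \<and> prof (\<beta> n) z = 1 \<and> (-1) ^ j * flux (\<beta> n) z \<le> 0" for n
  proof -
    let ?v = "\<lambda>x. (-1) ^ j * (prof (\<beta> n) x - 1)"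
    have sub: "{\<xi> n..\<eta> n} \<subseteq> {0..<1}" using \<xi>0[of n] Suc.prems(4)[of n] by auto
    have "?v (\<xi> n) < 0" using alternates_sign[OF \<xi>(2)] .
    moreover have "0 < ?v (\<eta> n)" using Suc.prems(5)[of n] by simp
    moreover have "continuous_on {\<xi> n..\<eta> n} ?v" by (intro continuous_intros prof_continuous sub)
    ultimately obtain z where z: "\<xi> n < z" "z < \<eta> n" "?v z = 0"
      and d: "\<And>d. DERIV ?v z :> d \<Longrightarrow> 0 \<le> d"
      using upward_crossing[of "\<xi> n" "\<eta> n" ?v] \<xi>(1) by blast
    have z01: "0 < z" "z < 1" using z \<xi>0[of n] Suc.prems(4)[of n] by auto
    have "DERIV ?v z :> (-1) ^ j * (- flux (\<beta> n) z / (1 - z^2))"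
      using prof_deriv_flux[OF z01] by (auto intro!: derivative_eq_intros)
    then have "0 \<le> (-1) ^ j * (- flux (\<beta> n) z / (1 - z^2))" by (rule d)
    then have "0 \<le> (-((-1) ^ j * flux (\<beta> n) z)) / (1 - z^2)" by simp
    then have "(-1) ^ j * flux (\<beta> n) z \<le> 0"
      using one_minus_square_pos[of z] z01 by (simp only: zero_le_divide_iff) auto
    then show ?thesis using z by auto
  qed
  then obtain \<zeta> where \<zeta>: "\<And>n. \<xi> n < \<zeta> n" "\<And>n. \<zeta> n < \<eta> n" "\<And>n. prof (\<beta> n) (\<zeta> n) = 1"
    "\<And>n. (-1) ^ j * flux (\<beta> n) (\<zeta> n) \<le> 0" by metis
  have mem: "\<forall>n. (\<xi> n, \<zeta> n) \<in> {0..1} \<times> {0..1}"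
  proof
    fix n show "(\<xi> n, \<zeta> n) \<in> {0..1} \<times> {0..1}"
      using \<xi>0[of n] \<zeta>(1,2)[of n] Suc.prems(4)[of n] by auto
  qed
  have "seq_compact ({0..1::real} \<times> {0..1::real})"
    by (intro compact_imp_seq_compact compact_Times compact_Icc)
  then obtain l r where r: "strict_mono r" "((\<lambda>n. (\<xi> n, \<zeta> n)) \<circ> r) \<longlonglongrightarrow> l"
    using mem by (rule seq_compactE)
  define x where "x = fst l"
  define z where "z = snd l"
  have xl: "(\<lambda>n. \<xi> (r n)) \<longlonglongrightarrow> x" using tendsto_fst[OF r(2)] by (simp add: x_def o_def)
  have zl: "(\<lambda>n. \<zeta> (r n)) \<longlonglongrightarrow> z" using tendsto_snd[OF r(2)] by (simp add: z_def o_def)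
  have bl: "(\<lambda>n. \<beta> (r n)) \<longlonglongrightarrow> b" using LIMSEQ_subseq_LIMSEQ[OF Suc.prems(1) r(1)] by (simp add: o_def)
  have yl: "(\<lambda>n. \<eta> (r n)) \<longlonglongrightarrow> y" using LIMSEQ_subseq_LIMSEQ[OF Suc.prems(2) r(1)] by (simp add: o_def)
  have xz: "x \<le> z" by (rule LIMSEQ_le[OF xl zl]) (use \<zeta>(1) in \<open>auto intro: less_imp_le\<close>)
  have zy: "z \<le> y" by (rule LIMSEQ_le[OF zl yl]) (use \<zeta>(2) in \<open>auto intro: less_imp_le\<close>)
  have x0: "0 \<le> x" by (rule LIMSEQ_le_const[OF xl]) (use \<xi>0 in auto)
  have zn: "0 \<le> \<zeta> (r n) \<and> \<zeta> (r n) < 1" for n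
    using \<xi>0[of "r n"] \<zeta>(1,2)[of "r n"] Suc.prems(4)[of "r n"] by auto
  have z1: "z < 1" using zy Suc.prems by simp
  note J = prof_joint_continuous[OF bl zl _ z1 zn]
  have pz: "prof b z = 1" using LIMSEQ_unique[OF J(1)] \<zeta>(3) x0 xz by simp
  have fz: "(-1) ^ j * flux b z \<le> 0"
    using x0 xz \<zeta>(4) by (intro LIMSEQ_le_const2[OF tendsto_mult[OF tendsto_const J(2)]]) auto
  have "z \<noteq> 0" using pz prof_start[of b] assms(1) by auto
  then have z0: "0 < z" using x0 xz by simp
  \<comment> \<open>In the limit the sign of the derivative is known only as a weak inequality;
    simplicity of the zero makes it strict.\<close>
  have "mom b z \<noteq> 0" using simple_zero[OF _ z0 z1 pz] assms(1) by simp
  then have "(-1) ^ j * flux b z < 0" using fz by (cases "even j") (auto simp: mom_def)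
  then have "0 < (- ((-1) ^ j * flux b z)) / (1 - z^2)"
    using one_minus_square_pos[of z] z0 z1 by (intro divide_pos_pos) auto
  then have D: "0 < (-1) ^ j * (- flux b z / (1 - z^2))" by simp
  have "DERIV (\<lambda>x. (-1) ^ j * (prof b x - 1)) z :> (-1) ^ j * (- flux b z / (1 - z^2))"
    using prof_deriv_flux[OF z0 z1] by (auto intro!: derivative_eq_intros)
  from DERIV_pos_inc_right[OF this D]
  obtain d where d: "0 < d" "\<And>h. 0 < h \<Longrightarrow> h < d \<Longrightarrow> 0 < (-1) ^ j * (prof b (z + h) - 1)"
    by (auto simp: pz)
  define h where "h = min (d / 2) e"
  have h: "0 < h" "h < d" "h \<le> e" using d Suc.prems by (auto simp: h_def)
  \<comment> \<open>The limits \<open>x\<close> and \<open>z\<close> may coincide. The slack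
    \<open>h / 2\<close> still places the point found by induction before \<open>z + h\<close>,
    where the next sign is attained.\<close>
  have "\<exists>z\<le>x + h / 2. osc b j z"
  proof (rule Suc.IH[OF bl xl])
    show "x < 1" using xz z1 by simp
    show "\<xi> (r n) < 1" for n using \<xi>(1)[of "r n"] Suc.prems(4)[of "r n"] by simp
  qed (use \<xi>(2) h in auto)
  then obtain u where u: "u \<le> x + h / 2" "osc b j u" by blast
  have "u < z + h" using u h xz by auto
  then have "osc b (Suc j) (z + h)" using u(2) d(2)[OF h(1,2)] by auto
  then show ?case using zy h by (intro exI[of _ "z + h"]) auto
qed

text \<open>Beyond \<open>Y\<close> there is at most one zero, so cutting at \<open>Y'\<close> costs
  at most one sign change. Points \<open>s < x < y\<close> beyond \<open>Y\<close> with alternating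
  signs would enclose two zeros.\<close>

lemma osc_truncate:
  assumes Y: "\<And>y1 y2. Y \<le> y1 \<Longrightarrow> y1 < y2 \<Longrightarrow> y2 < 1 \<Longrightarrow> prof b y1 = 1 \<Longrightarrow> prof b y2 \<noteq> 1"
    and Y': "0 \<le> Y" "Y \<le> Y'" "Y' < 1" "prof b Y' \<noteq> 1" and b: "b < 1"
    and o: "osc b (Suc j) y" "y < 1"
  shows "\<exists>z\<le>Y'. osc b j z"
proof -
  obtain x where x: "x < y" "osc b j x" using o by auto
  show ?thesis
  proof (cases "x \<le> Y'")
    case False
    show ?thesis
    proof (cases j)
      case 0
      then show ?thesis using b Y' by (intro exI[of _ 0]) (auto simp: prof_start)
    next
      case (Suc i)
      obtain t where t: "t < x" "osc b i t" using x(2) Suc by auto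
      have sx: "0 < (-1) ^ i * (prof b x - 1)" using x(2) Suc by simp
      have sy: "(-1) ^ i * (prof b y - 1) < 0" using alternates_sign[OF o(1)] Suc by simp
      have st: "(-1) ^ i * (prof b t - 1) < 0" using alternates_sign[OF t(2)] .
      have three: False if s: "Y \<le> s" "s < x" "(-1) ^ i * (prof b s - 1) < 0" for s
      proof -
        have zero: "\<exists>z>s. z < t \<and> prof b z = 1"
          if "Y \<le> s" "s < t" "t < 1" and sg: "(prof b s - 1) * (prof b t - 1) < 0" for s t
        proof -
          have "continuous_on {s..t} (\<lambda>x. prof b x - 1)"
            by (intro continuous_intros prof_continuous) (use Y' that in auto)
          from zero_between[OF this \<open>s < t\<close> sg] show ?thesis by auto
        qed
        obtain z1 where z1: "s < z1" "z1 < x" "prof b z1 = 1"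
          using zero[of s x] s x o mult_neg_pos[OF s(3) sx] unfolding neg_one_power_cancel by auto
        obtain z2 where z2: "x < z2" "z2 < y" "prof b z2 = 1"
          using zero[of x y] s x o mult_pos_neg[OF sx sy] unfolding neg_one_power_cancel by auto
        show False using Y[of z1 z2] s z1 z2 o by auto
      qed
      have "t < Y" using three[of t] t st by force
      moreover have "0 < (-1) ^ i * (prof b Y' - 1)"
      proof (rule ccontr)
        assume "\<not> ?thesis"
        moreover have "(-1) ^ i * (prof b Y' - 1) \<noteq> 0" using Y' by simp
        ultimately have "(-1) ^ i * (prof b Y' - 1) < 0" by linarith
        then show False using three[of Y'] Y' False by auto
      qed
      ultimately have "osc b j Y'" unfolding Suc using t(2) Y' by (intro alternates_SucI[of _ _ t]) auto
      then show ?thesis by blast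
    qed
  qed (use x in blast)
qed

text \<open>No sign change takes place beyond \<open>Y\<close>, so the point \<open>Y\<close> can
  replace a final point to its right and the count is preserved.\<close>

lemma osc_truncate_constant_sign:
  assumes Y: "\<And>x y. Y \<le> x \<Longrightarrow> x < 1 \<Longrightarrow> Y \<le> y \<Longrightarrow> y < 1 \<Longrightarrow> 0 < (prof b x - 1) * (prof b y - 1)"
    and Y0: "0 \<le> Y" "Y < 1" and b: "b < 1" and o: "osc b j y" "y < 1"
  shows "\<exists>z\<le>Y. osc b j z"
proof (cases "y \<le> Y")
  case False
  show ?thesis
  proof (cases j)
    case 0
    then show ?thesis using b Y0 by (intro exI[of _ 0]) (auto simp: prof_start)
  next
    case (Suc i)
    obtain t where t: "t < y" "osc b i t" using o Suc by auto
    have st: "(-1) ^ i * (prof b t - 1) < 0" using alternates_sign[OF t(2)] .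
    have sy: "0 < (-1) ^ i * (prof b y - 1)" using o Suc by simp
    have "\<not> Y \<le> t" using mult_neg_pos[OF st sy] Y[of t y] t o False unfolding neg_one_power_cancel by auto
    moreover have "0 < ((-1) ^ i * (prof b Y - 1)) * ((-1) ^ i * (prof b y - 1))"
      unfolding neg_one_power_cancel using Y[of Y y] Y0 o False by auto
    then have "0 < (-1) ^ i * (prof b Y - 1)" using sy by (simp add: zero_less_mult_iff)
    ultimately have "osc b j Y" unfolding Suc using t(2) by (intro alternates_SucI[of _ _ t]) auto
    then show ?thesis by blast
  qed
qed (use o in blast)

text \<open>A momentum that does not tend to 0 stays away from 0 near 1, because its variation there
  is at most \<open>lam * K * (1 - x)\<close>. The slope is then at least of order
  \<open>1 / (1 - x)\<close>, and the profile leaves the level 1 logarithmically. Only the momentum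
  at \<open>x0\<close> and the value at \<open>Y\<close> are used, which makes the conclusion
  uniform in nearby initial values.\<close>

lemma not_regular_constant_sign:
  assumes "\<not> regular b"
  obtains Y d where "0 \<le> Y" "Y < 1" "0 < d"
    "\<And>c x y. \<bar>c - b\<bar> < d \<Longrightarrow> Y \<le> x \<Longrightarrow> x < 1 \<Longrightarrow> Y \<le> y \<Longrightarrow> y < 1 \<Longrightarrow> 0 < (prof c x - 1) * (prof c y - 1)"
proof -
  obtain e where e: "0 < e" "\<not> (\<forall>\<^sub>F x in at_left 1. \<bar>mom b x\<bar> < e)"
    using assms unfolding regular_def tendsto_iff by (auto simp: dist_real_def)
  \<comment> \<open>Beyond \<open>X\<close> no shot changes its momentum by more than
    \<open>e / 4\<close>.\<close>
  define X where "X = max (1/2) (1 - e / (4 * (lam * K + 1)))"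
  have lK: "0 \<le> lam * K" using lam_pos K_nonneg by simp
  have "X < 1" using e lK by (auto simp: X_def)
  then have "\<forall>\<^sub>F x in at_left (1::real). X < x \<and> x < 1"
    by (auto simp: eventually_at_left[of X])
  then obtain x0 where x0: "X < x0" "x0 < 1" "e \<le> \<bar>mom b x0\<bar>"
    using e(2) by (smt (verit, best) eventually_mono)
  have x0': "1/2 < x0" using x0 by (auto simp: X_def)
  have small: "lam * K * (1 - x0) \<le> e / 4"
  proof -
    have "1 - x0 \<le> e / (4 * (lam * K + 1))" using x0 unfolding X_def by linarith
    then have "(lam * K + 1) * (1 - x0) \<le> (lam * K + 1) * (e / (4 * (lam * K + 1)))"
      using lK by (intro mult_left_mono) auto
    also have "\<dots> = e / 4" using lK by (simp add: field_simps)
    finally show ?thesis using x0 by (simp add: distrib_right)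
  qed
  define s where "s = sgn (mom b x0)"
  have s: "s * mom b x0 = \<bar>mom b x0\<bar>" "\<bar>s\<bar> = 1" "s * s = 1"
    using x0 e by (auto simp: s_def abs_sgn mult.commute sgn_real_def)
  have sabs: "s * t \<le> \<bar>t\<bar>" for t using s(2) by (metis abs_ge_self abs_mult mult_1)
  have mom_lower: "\<bar>mom c x0 - mom b x0\<bar> \<le> e / 4 \<Longrightarrow> e / 2 \<le> s * mom c x" if "x0 \<le> x" "x < 1" for c x
  proof -
    assume a: "\<bar>mom c x0 - mom b x0\<bar> \<le> e / 4"
    have "\<bar>mom c x - mom c x0\<bar> \<le> lam * K * (x - x0)" using that x0' f_bound by (intro mom_diff_le) auto
    also have "\<dots> \<le> lam * K * (1 - x0)" using that lK by (intro mult_left_mono) auto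
    finally have "\<bar>mom c x - mom c x0\<bar> \<le> e / 4" using small by simp
    moreover have "s * (mom b x0 - mom c x0) \<le> \<bar>mom b x0 - mom c x0\<bar>" "s * (mom c x0 - mom c x) \<le> \<bar>mom c x0 - mom c x\<bar>"
      by (rule sabs)+
    moreover have "s * mom c x = s * mom b x0 - s * (mom b x0 - mom c x0) - s * (mom c x0 - mom c x)"
      by (simp add: algebra_simps)
    ultimately show ?thesis using a s x0 by linarith
  qed
  have decr: "s * prof c y \<le> s * prof c x + e / 4 * (ln (1 - y) - ln (1 - x))"
    if a: "\<bar>mom c x0 - mom b x0\<bar> \<le> e / 4" and xy: "x0 \<le> x" "x \<le> y" "y < 1" for c x y
  proof -
    have "s * prof c y - e / 4 * ln (1 - y) \<le> s * prof c x - e / 4 * ln (1 - x)"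
    proof (rule nonpos_deriv_le[of x y "\<lambda>x. s * prof c x - e / 4 * ln (1 - x)", OF xy(2)])
      show "continuous_on {x..y} (\<lambda>x. s * prof c x - e / 4 * ln (1 - x))"
        by (intro continuous_intros prof_continuous) (use xy x0' in auto)
      fix t assume t: "x < t" "t < y"
      have t': "0 < t" "t < 1" "x0 \<le> t" using t xy x0' by auto
      have p: "0 < 1 - t^2" using one_minus_square_pos[of t] t' by simp
      have "t^2 * (1 - t^2) \<le> 1 * (2 * (1 - t))"
      proof (rule mult_mono)
        show "t^2 \<le> 1" using t' by (simp add: power_le_one)
        have "1 - t^2 = (1 + t) * (1 - t)" by (simp add: algebra_simps power2_eq_square)
        also have "\<dots> \<le> 2 * (1 - t)" using t' by (intro mult_right_mono) auto
        finally show "1 - t^2 \<le> 2 * (1 - t)" .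
      qed (use t' p in auto)
      then have "e / 2 / (1 * (2 * (1 - t))) \<le> s * mom c t / (t^2 * (1 - t^2))"
        using mom_lower[OF t'(3,2) a] e t' p by (intro frac_le) auto
      then show "- (s * mom c t / (t^2 * (1 - t^2))) + e / 4 / (1 - t) \<le> 0" by simp
      show "DERIV (\<lambda>x. s * prof c x - e / 4 * ln (1 - x)) t :> - (s * mom c t / (t^2 * (1 - t^2))) + e / 4 / (1 - t)"
        using t' by (auto intro!: derivative_eq_intros prof_deriv simp: field_simps)
    qed
    then show ?thesis by (simp add: algebra_simps)
  qed
  \<comment> \<open>From \<open>x0\<close> to \<open>Y\<close> the logarithm of \<open>1 - x\<close>
    drops by \<open>r\<close>. At the rate \<open>e / 4\<close> this moves the signed profile past
    the level 1 with a margin of 1, whatever its value at \<open>x0\<close>.\<close>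
  define r where "r = 4 / e * (\<bar>prof b x0 - 1\<bar> + 1)"
  define Y where "Y = 1 - (1 - x0) * exp (- r)"
  have r: "0 \<le> r" using e by (simp add: r_def)
  have "(1 - x0) * exp (- r) \<le> (1 - x0) * 1" using r x0 by (intro mult_left_mono) auto
  moreover have "0 < (1 - x0) * exp (- r)" using x0 by simp
  ultimately have Y: "x0 \<le> Y" "Y < 1" by (simp_all add: Y_def)
  have "ln (1 - Y) = ln (1 - x0) - r" using x0 by (simp add: Y_def ln_mult)
  then have "s * prof b Y \<le> s * prof b x0 + e / 4 * (- r)"
    using decr[of b x0 Y] Y e by simp
  also have "e / 4 * (- r) = - (\<bar>prof b x0 - 1\<bar> + 1)" using e(1) by (simp add: r_def field_simps)
  finally have "s * (prof b Y - 1) \<le> s * (prof b x0 - 1) - (\<bar>prof b x0 - 1\<bar> + 1)" by (simp add: algebra_simps)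
  then have vY: "s * (prof b Y - 1) \<le> - 1" using sabs[of "prof b x0 - 1"] by linarith
  have Y0: "0 \<le> Y" using Y x0' by simp
  obtain B where B: "0 < B"
    "\<And>b c x. 0 \<le> x \<Longrightarrow> x \<le> Y \<Longrightarrow> \<bar>prof b x - prof c x\<bar> \<le> B * \<bar>b - c\<bar>"
    "\<And>b c x. 0 \<le> x \<Longrightarrow> x \<le> Y \<Longrightarrow> \<bar>flux b x - flux c x\<bar> \<le> B * \<bar>b - c\<bar>"
    using prof_dependence[OF Y0 Y(2)] by metis
  \<comment> \<open>The bound \<open>e / 4\<close> serves the momentum at \<open>x0\<close>; the
    bound 1/2 consumes half of the margin 1 at \<open>Y\<close>.\<close>
  define d where "d = min (1 / 2) (e / 4) / B"
  have d: "0 < d" using e B by (simp add: d_def)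
  have neg: "s * (prof c x - 1) < 0" if c: "\<bar>c - b\<bar> < d" and x: "Y \<le> x" "x < 1" for c x
  proof -
    have Bd: "B * \<bar>c - b\<bar> \<le> min (1 / 2) (e / 4)" using c B by (simp add: d_def field_simps)
    have "\<bar>mom c x0 - mom b x0\<bar> = x0^2 * \<bar>flux c x0 - flux b x0\<bar>"
      by (simp add: mom_def abs_mult flip: right_diff_distrib)
    also have "\<dots> \<le> 1 * (B * \<bar>c - b\<bar>)"
      using B(3)[of x0 c b] x0 x0' Y by (intro mult_mono) (auto simp: power_le_one)
    finally have a: "\<bar>mom c x0 - mom b x0\<bar> \<le> e / 4" using Bd by simp
    have "s * prof c x \<le> s * prof c Y + e / 4 * (ln (1 - x) - ln (1 - Y))" by (rule decr[OF a Y(1) x])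
    also have "\<dots> \<le> s * prof c Y" using e x Y by (simp add: mult_le_0_iff)
    finally have 1: "s * (prof c x - 1) \<le> s * (prof c Y - 1)" by (simp add: algebra_simps)
    have "s * (prof c Y - prof b Y) \<le> 1 / 2" using sabs[of "prof c Y - prof b Y"] B(2)[of Y c b] Bd Y0 by simp
    then have "s * (prof c Y - 1) \<le> s * (prof b Y - 1) + 1 / 2" by (simp add: algebra_simps)
    then show ?thesis using 1 vY by linarith
  qed
  show thesis
  proof (rule that[OF Y0 Y(2) d])
    fix c x y assume "\<bar>c - b\<bar> < d" "Y \<le> x" "x < 1" "Y \<le> y" "y < 1"
    then have "0 < (s * (prof c x - 1)) * (s * (prof c y - 1))" by (intro mult_neg_neg neg)
    also have "\<dots> = (s * s) * ((prof c x - 1) * (prof c y - 1))" by (simp only: mult_ac)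
    finally show "0 < (prof c x - 1) * (prof c y - 1)" using s by simp
  qed
qed

text \<open>Crossings can disappear in the limit only through 1. With a common bound
  \<open>Y < 1\<close> compactness gives a limit point below 1, and half of its distance to 1 is
  available as slack for \<open>osc_limit\<close>.\<close>

lemma osc_limit_bounded:
  assumes b: "b < 1" "\<beta> \<longlonglongrightarrow> b" and Y: "Y < 1" "\<And>n. \<exists>z\<le>Y. osc (\<beta> n) j z"
  shows "\<exists>y<1. osc b j y"
proof -
  obtain \<eta> where \<eta>: "\<And>n. \<eta> n \<le> Y" "\<And>n. osc (\<beta> n) j (\<eta> n)" using Y(2) by metis
  have mem: "\<forall>n. \<eta> n \<in> {0..Y}" using \<eta>(1) alternates_nonneg[OF \<eta>(2)] by auto
  have "seq_compact {0..Y}" by (intro compact_imp_seq_compact compact_Icc)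
  then obtain y r where r: "y \<in> {0..Y}" "strict_mono r" "(\<eta> \<circ> r) \<longlonglongrightarrow> y"
    using mem by (rule seq_compactE)
  have "\<exists>z\<le>y + (1 - y) / 2. osc b j z"
  proof (rule osc_limit[OF b(1)])
    show "(\<beta> \<circ> r) \<longlonglongrightarrow> b" using LIMSEQ_subseq_LIMSEQ[OF b(2) r(2)] .
    show "(\<eta> \<circ> r) \<longlonglongrightarrow> y" by (fact r(3))
    show "(\<eta> \<circ> r) n < 1" "osc ((\<beta> \<circ> r) n) j ((\<eta> \<circ> r) n)" for n
      using \<eta>[of "r n"] Y by auto
  qed (use r Y in auto)
  then obtain z where "z \<le> y + (1 - y) / 2" "osc b j z" by blast
  moreover have "y + (1 - y) / 2 < 1" using r Y by (simp add: field_simps)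
  ultimately show ?thesis by (intro exI[of _ z]) linarith
qed

text \<open>The zone of \<open>last_zone\<close> does not depend on the initial value, so at most
  one crossing escapes through 1 along the whole sequence.\<close>

lemma osc_limit_Suc:
  assumes b: "b < 1" "\<beta> \<longlonglongrightarrow> b" and bn: "\<And>n. \<beta> n < 1" and o: "\<And>n. \<exists>y<1. osc (\<beta> n) (Suc j) y"
  shows "\<exists>y<1. osc b j y"
proof -
  obtain Y where Y: "0 < Y" "Y < 1"
    "\<And>b y1 y2. b \<noteq> 1 \<Longrightarrow> Y \<le> y1 \<Longrightarrow> y1 < y2 \<Longrightarrow> y2 < 1 \<Longrightarrow> prof b y1 = 1 \<Longrightarrow> prof b y2 \<noteq> 1"
    using last_zone by metis
  \<comment> \<open>At most one zero lies beyond \<open>Y\<close>, so one of the points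
    \<open>Y\<close> and \<open>(1 + Y) / 2\<close> is not a zero; by continuity this remains true
    for the shots close to \<open>b\<close>.\<close>
  obtain Y' where Y': "Y \<le> Y'" "Y' < 1" "prof b Y' \<noteq> 1"
    using Y(1,2) Y(3)[of b Y "(1 + Y) / 2"] b that[of Y] that[of "(1 + Y) / 2"]
    by (cases "prof b Y = 1") auto
  have "(\<lambda>n. prof (\<beta> n) Y') \<longlonglongrightarrow> prof b Y'"
    using prof_joint_continuous(1)[OF b(2), of "\<lambda>_. Y'" Y'] Y Y' by auto
  then have "\<forall>\<^sub>F n in sequentially. prof (\<beta> n) Y' \<noteq> 1" using Y'(3) by (rule tendsto_imp_eventually_ne)
  then obtain N where N: "\<And>n. n \<ge> N \<Longrightarrow> prof (\<beta> n) Y' \<noteq> 1" by (auto simp: eventually_sequentially)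
  show ?thesis
  proof (rule osc_limit_bounded[OF b(1) LIMSEQ_ignore_initial_segment[OF b(2), of N] Y'(2)])
    fix n
    obtain y where y: "y < 1" "osc (\<beta> (n + N)) (Suc j) y" using o by blast
    show "\<exists>z\<le>Y'. osc (\<beta> (n + N)) j z"
      by (rule osc_truncate[OF _ _ Y'(1,2) N _ y(2,1)]) (use Y bn[of "n + N"] in auto)
  qed
qed

text \<open>Near a nonregular initial value all shots have one common last zone without crossings,
  so none can escape.\<close>

lemma osc_limit_not_regular:
  assumes b: "b < 1" "\<beta> \<longlonglongrightarrow> b" and bn: "\<And>n. \<beta> n < 1" and o: "\<And>n. \<exists>y<1. osc (\<beta> n) j y"
    and nr: "\<not> regular b"
  shows "\<exists>y<1. osc b j y"
proof -
  obtain Y d where Y: "0 \<le> Y" "Y < 1" "0 < d"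
    "\<And>c x y. \<bar>c - b\<bar> < d \<Longrightarrow> Y \<le> x \<Longrightarrow> x < 1 \<Longrightarrow> Y \<le> y \<Longrightarrow> y < 1 \<Longrightarrow> 0 < (prof c x - 1) * (prof c y - 1)"
    using not_regular_constant_sign[OF nr] by metis
  obtain N where N: "\<And>n. n \<ge> N \<Longrightarrow> \<bar>\<beta> n - b\<bar> < d" using LIMSEQ_D[OF b(2) Y(3)] by auto
  show ?thesis
  proof (rule osc_limit_bounded[OF b(1) LIMSEQ_ignore_initial_segment[OF b(2), of N] Y(2)])
    fix n
    obtain y where y: "y < 1" "osc (\<beta> (n + N)) j y" using o by blast
    show "\<exists>z\<le>Y. osc (\<beta> (n + N)) j z"
      by (rule osc_truncate_constant_sign[OF Y(4)[OF N] Y(1,2) _ y(2,1)]) (use bn[of "n + N"] in auto)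
  qed
qed

section \<open>Thresholds of the crossing count\<close>

lemma not_osc_zero: "y < 1 \<Longrightarrow> \<not> osc 0 (Suc j) y"
proof (induction j arbitrary: y)
  case 0
  have "0 \<le> y" if "osc 0 (Suc 0) y" using alternates_nonneg[OF that] .
  then show ?case using 0 by (auto simp: prof_zero)
next
  case (Suc j)
  show ?case
  proof
    assume "osc 0 (Suc (Suc j)) y"
    then obtain x where "x < y" "osc 0 (Suc j) x" unfolding alternates.simps(2)[of _ "Suc j"] by blast
    then show False using Suc.IH[of x] Suc.prems by simp
  qed
qed

text \<open>Let \<open>b\<close> be the infimum of the initial values with at least
  \<open>j + 2\<close> crossings. Openness denies \<open>b\<close> this many, the limit leaves it at
  least \<open>j + 1\<close>, and only a regular \<open>b\<close> permits such a loss. Since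
  \<open>j + 1\<close> is positive, the limit differs from the zero solution.\<close>

lemma regular_at_threshold:
  assumes b1: "0 \<le> b1" "b1 < 1" "y1 < 1" "osc b1 (Suc (Suc j)) y1"
  obtains b where "0 < b" "b < 1" "regular b" "\<exists>y<1. osc b (Suc j) y" "\<not> (\<exists>y<1. osc b (Suc (Suc j)) y)"
proof -
  define T where "T = {b \<in> {0..<1}. \<exists>y<1. osc b (Suc (Suc j)) y}"
  have T: "b1 \<in> T" "bdd_below T"
    using b1 by (auto simp: T_def simp del: alternates.simps intro!: bdd_belowI[of _ 0])
  define b where "b = Inf T"
  have "0 \<le> t" if "t \<in> T" for t using that by (simp add: T_def)
  then have "0 \<le> b" unfolding b_def using T(1) by (intro cInf_greatest) auto
  moreover have "b \<le> b1" unfolding b_def by (rule cInf_lower[OF T])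
  ultimately have b: "0 \<le> b" "b < 1" using b1(2) by auto
  have "b \<in> closure T" unfolding b_def using T by (intro closure_contains_Inf) auto
  then obtain \<beta> where \<beta>: "\<And>n. \<beta> n \<in> T" "\<beta> \<longlonglongrightarrow> b" unfolding closure_sequential by blast
  have bn: "\<And>n. \<beta> n < 1" "\<And>n. \<exists>y<1. osc (\<beta> n) (Suc (Suc j)) y"
    using \<beta>(1) unfolding T_def by (simp_all del: alternates.simps)
  have P: "\<exists>y<1. osc b (Suc j) y" using osc_limit_Suc[OF b(2) \<beta>(2) bn] .
  then have "b \<noteq> 0" using not_osc_zero by metis
  then have b0: "0 < b" using b by simp
  have nP: "\<not> (\<exists>y<1. osc b (Suc (Suc j)) y)"
  proof
    assume "\<exists>y<1. osc b (Suc (Suc j)) y"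
    then obtain y where y: "y < 1" "osc b (Suc (Suc j)) y" by blast
    \<comment> \<open>A sequence in \<open>[0, b)\<close> tending to \<open>b\<close> from below; if
      \<open>b\<close> had the crossings, some member would have them too and undercut the
      infimum.\<close>
    define \<gamma> where "\<gamma> n = b - b / Suc (Suc n)" for n
    have "(\<lambda>n. b / Suc n) \<longlonglongrightarrow> 0" by (intro lim_const_over_n[THEN LIMSEQ_Suc])
    then have "(\<lambda>n. b - b / Suc (Suc n)) \<longlonglongrightarrow> b - 0"
      using tendsto_diff[OF tendsto_const LIMSEQ_Suc] by blast
    then have "\<gamma> \<longlonglongrightarrow> b - 0" unfolding \<gamma>_def .
    then have "\<forall>\<^sub>F n in sequentially. osc (\<gamma> n) (Suc (Suc j)) y"
      by (intro osc_open[OF y(2,1)]) simp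
    then obtain n where n: "osc (\<gamma> n) (Suc (Suc j)) y" using eventually_happens' sequentially_bot by blast
    have "0 \<le> \<gamma> n" "\<gamma> n < b" using b0 by (auto simp: \<gamma>_def field_simps)
    then have "\<gamma> n \<in> T" using n y b by (auto simp: T_def simp del: alternates.simps)
    then have "b \<le> \<gamma> n" unfolding b_def using T by (intro cInf_lower)
    then show False using \<open>\<gamma> n < b\<close> by simp
  qed
  have "regular b" using osc_limit_not_regular[OF b(2) \<beta>(2) bn] nP by blast
  then show thesis using that[OF b0 b(2) _ P nP] by blast
qed

text \<open>The threshold with index \<open>j\<close> has \<open>j + 1\<close> crossings but not
  \<open>j + 2\<close>. Counts therefore tell the thresholds apart, and \<open>k + 1\<close>
  crossings yield \<open>k\<close> of them.\<close>

lemma regular_family: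
  assumes b1: "0 \<le> b1" "b1 < 1" "y1 < 1" "osc b1 (Suc k) y1"
  obtains B where "finite B" "card B = k" "B \<subseteq> {0<..<1}" "\<And>b. b \<in> B \<Longrightarrow> regular b"
proof -
  define Q where "Q j b \<longleftrightarrow> 0 < b \<and> b < 1 \<and> regular b \<and> (\<exists>y<1. osc b (Suc j) y) \<and>
    \<not> (\<exists>y<1. osc b (Suc (Suc j)) y)" for j b
  have "\<exists>b. Q j b" if "j < k" for j
  proof -
    have "Suc (Suc j) \<le> Suc k" using that by simp
    from alternates_less[OF b1(4) this] obtain y where "y \<le> y1" "osc b1 (Suc (Suc j)) y" by blast
    then show ?thesis
      using regular_at_threshold[OF b1(1,2), of y j] b1(3) unfolding Q_def by (metis order_le_less_trans)
  qed
  then obtain c where Q: "\<And>j. j < k \<Longrightarrow> Q j (c j)" by metis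
  then have c: "0 < c j" "c j < 1" "regular (c j)" "\<exists>y<1. osc (c j) (Suc j) y"
    "\<not> (\<exists>y<1. osc (c j) (Suc (Suc j)) y)" if "j < k" for j
    using that unfolding Q_def by blast+
  have ne: "c i \<noteq> c j" if "i < j" "j < k" for i j
  proof
    assume eq: "c i = c j"
    obtain y where y: "y < 1" "osc (c j) (Suc j) y" using c(4)[OF \<open>j < k\<close>] by blast
    have "Suc (Suc i) \<le> Suc j" using that by simp
    from alternates_less[OF y(2) this] obtain x where "x \<le> y" "osc (c j) (Suc (Suc i)) x" by blast
    then show False using c(5)[of i] eq that y by (metis less_trans order_le_less_trans)
  qed
  have "inj_on c {..<k}" using ne by (intro inj_onI) (metis lessThan_iff linorder_neqE_nat)
  then have "card (c ` {..<k}) = k" by (simp add: card_image)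
  then show thesis using c by (intro that[of "c ` {..<k}"]) auto
qed

end

section \<open>Sturm comparison near the constant solution\<close>

lemma sin_add_npi: "sin (real n * pi + t) = (-1) ^ n * sin t"
  and cos_add_npi: "cos (real n * pi + t) = (-1) ^ n * cos t"
  by (simp_all add: sin_add cos_add sin_npi cos_npi mult.commute)

context shooting begin

text \<open>
  With \<open>x = sin s\<close>, the factor \<open>sin s * sqrt (cos s)\<close> removes the first order term of the equation;
  \<open>D\<close> is the Wronskian of \<open>sin s * sqrt (cos s) * v\<close> and \<open>sin (\<omega> * s)\<close>.
\<close>

lemma sturm_wronskian_deriv:
  fixes b \<mu> \<omega> :: real
  assumes om: "\<omega>\<^sup>2 = \<mu> + 9/4" and s: "0 < s" "s < pi / 2"
  defines "v \<equiv> \<lambda>s. prof b (sin s) - 1" and "\<gamma> \<equiv> \<lambda>s. flux b (sin s)" and "r \<equiv> \<lambda>s. sqrt (cos s)"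
  defines "D \<equiv> \<lambda>s. ((r s ^ 3 - (sin s)^2 / (2 * r s)) * v s - sin s / r s * \<gamma> s) * sin (\<omega> * s)
      - sin s * r s * v s * (\<omega> * cos (\<omega> * s))"
  shows "DERIV D s :> - (lam * f (prof b (sin s)) - \<mu> * v s + v s / (4 * (cos s)^2)) * (sin s * r s) * sin (\<omega> * s)"
proof -
  have c: "0 < cos s" using s by (intro cos_gt_zero_pi) auto
  have S: "0 < sin s" "sin s < 1"
    using s sin_monotone_2pi[of s "pi/2"] by (auto intro: sin_gt_zero)
  \<comment> \<open>In \<open>R = sqrt (cos s)\<close> and \<open>T = sin s\<close> all coefficients
    are rational, subject to \<open>T^2 = 1 - R ^ 4\<close>. The final identity is checked
    separately for the terms in \<open>cs\<close>, \<open>G\<close> and \<open>V\<close>.\<close>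
  define R where "R = r s"
  define T where "T = sin s"
  have R: "0 < R" "cos s = R^2" using c by (auto simp: R_def r_def)
  have T: "0 < T" using S by (simp add: T_def)
  have TR: "T^2 = 1 - R ^ 4" using sin_squared_eq[of s] unfolding R(2) by (simp add: T_def power_mult[symmetric])
  have dS: "DERIV sin s :> R^2" unfolding R(2)[symmetric] by (rule DERIV_sin)
  have dr: "DERIV r s :> - T / (2 * R)"
    unfolding r_def R_def T_def using c by (auto intro!: derivative_eq_intros simp: field_simps)
  have q: "1 - (sin s)^2 = R^2 * R^2" using cos_squared_eq[of s] R(2) by (simp add: power2_eq_square)
  have "DERIV (\<lambda>s. prof b (sin s)) s :> - \<gamma> s / (1 - (sin s)^2) * R^2"
    unfolding \<gamma>_def by (rule DERIV_chain2[OF prof_deriv_flux[OF S] dS])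
  then have dv: "DERIV v s :> - \<gamma> s / R^2"
    unfolding v_def q using R by (auto intro!: derivative_eq_intros simp: field_simps)
  have dg: "DERIV \<gamma> s :> (lam * f (prof b (sin s)) - 2 * \<gamma> s / T) * R^2"
    unfolding \<gamma>_def T_def by (rule DERIV_chain2[OF flux_deriv[OF S] dS])
  have d1: "DERIV (\<lambda>s. r s ^ 3 - (sin s)^2 / (2 * r s)) s :> - 5/2 * T * R - T ^ 3 / (4 * R ^ 3)"
  proof -
    have "DERIV (\<lambda>s. r s ^ 3 - (sin s)^2 / (2 * r s)) s :> 3 * R^2 * (- T / (2 * R)) - (2 * T * R^2 * (2 * R) - T^2 * (2 * (- T / (2 * R)))) / (2 * R)^2"
      using DERIV_diff[OF DERIV_power[OF dr, of 3] DERIV_divide[OF DERIV_power[OF dS, of 2] DERIV_cmult[OF dr, of 2]]] R(1)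
      by (simp add: R_def T_def power2_eq_square mult_ac)
    also have "3 * R^2 * (- T / (2 * R)) - (2 * T * R^2 * (2 * R) - T^2 * (2 * (- T / (2 * R)))) / (2 * R)^2
       = - 5/2 * T * R - T ^ 3 / (4 * R ^ 3)"
      using R by (simp add: field_simps power2_eq_square power3_eq_cube)
    finally show ?thesis .
  qed
  have d2: "DERIV (\<lambda>s. sin s / r s) s :> R + T^2 / (2 * R ^ 3)"
  proof -
    have "DERIV (\<lambda>s. sin s / r s) s :> (R^2 * R - T * (- T / (2 * R))) / (R * R)"
      using DERIV_divide[OF dS dr] R by (simp add: R_def T_def)
    also have "(R^2 * R - T * (- T / (2 * R))) / (R * R) = R + T^2 / (2 * R ^ 3)"
      using R by (simp add: field_simps power2_eq_square power3_eq_cube)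
    finally show ?thesis .
  qed
  have d3: "DERIV (\<lambda>s. sin s * r s) s :> R ^ 3 - T^2 / (2 * R)"
  proof -
    have "DERIV (\<lambda>s. sin s * r s) s :> R^2 * R + (- T / (2 * R)) * T"
      using DERIV_mult[OF dS dr] by (simp add: R_def T_def)
    also have "R^2 * R + (- T / (2 * R)) * T = R ^ 3 - T^2 / (2 * R)"
      using R by (simp add: power2_eq_square power3_eq_cube)
    finally show ?thesis .
  qed
  define A where "A = r s ^ 3 - (sin s)^2 / (2 * r s)"
  define F where "F = lam * f (prof b (sin s))"
  define V where "V = v s"
  define G where "G = \<gamma> s"
  define sn where "sn = sin (\<omega> * s)"
  define cs where "cs = cos (\<omega> * s)"
  have A: "A = R ^ 3 - T^2 / (2 * R)" by (simp add: A_def R_def T_def)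
  have e1: "DERIV (\<lambda>s. sin (\<omega> * s)) s :> \<omega> * cs"
    unfolding cs_def by (auto intro!: derivative_eq_intros)
  have e2: "DERIV (\<lambda>s. \<omega> * cos (\<omega> * s)) s :> - \<omega>\<^sup>2 * sn"
    unfolding sn_def by (auto intro!: derivative_eq_intros simp: power2_eq_square)
  let ?a = "- 5/2 * T * R - T ^ 3 / (4 * R ^ 3)" and ?s = "- G / R^2"
    and ?g = "(R + T^2 / (2 * R ^ 3)) * G + ((F - 2 * G / T) * R^2) * (T / R)"
    and ?d = "R ^ 3 - T^2 / (2 * R)"
  have "DERIV D s :> ((?a * V + ?s * A) - ?g) * sn + \<omega> * cs * (A * V - T / R * G)
      - ((?d * V + ?s * (T * R)) * (\<omega> * cs) + - \<omega>\<^sup>2 * sn * (T * R * V))"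
    using DERIV_diff[OF DERIV_mult[OF DERIV_diff[OF DERIV_mult[OF d1 dv] DERIV_mult[OF d2 dg]] e1]
        DERIV_mult[OF DERIV_mult[OF d3 dv] e2]]
    by (simp add: D_def V_def G_def F_def A_def sn_def cs_def T_def R_def)
  also have "((?a * V + ?s * A) - ?g) * sn + \<omega> * cs * (A * V - T / R * G)
      - ((?d * V + ?s * (T * R)) * (\<omega> * cs) + - \<omega>\<^sup>2 * sn * (T * R * V))
     = - (F - \<mu> * V + V / (4 * (R^2)^2)) * (T * R) * sn"
  proof -
    have cs_terms: "\<omega> * cs * (A * V - T / R * G) - (?d * V + ?s * (T * R)) * (\<omega> * cs) = 0"
      using R unfolding A by (simp add: field_simps power2_eq_square)
    have G_terms: "?s * A - ?g = - F * (T * R)"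
      using R T unfolding A by (simp add: field_simps power2_eq_square power3_eq_cube)
    \<comment> \<open>Here \<open>?a\<close> is the second derivative of
      \<open>sin s * sqrt (cos s)\<close>, which equals \<open>- (9/4 + 1 / (4 * (cos s)^2))\<close>
      times this function. This is the origin of the shift 9/4.\<close>
    have "?a + \<omega>\<^sup>2 * (T * R) = T * (- 5/2 * R - T^2 / (4 * R ^ 3) + (\<mu> + 9/4) * R)"
      unfolding om by (simp add: algebra_simps power2_eq_square power3_eq_cube)
    also have "- 5/2 * R - T^2 / (4 * R ^ 3) + (\<mu> + 9/4) * R = (\<mu> - 1 / (4 * (R^2)^2)) * R"
      unfolding TR using R by (simp add: field_simps power2_eq_square power3_eq_cube power4_eq_xxxx)
    finally have V_terms: "?a + \<omega>\<^sup>2 * (T * R) = (\<mu> - 1 / (4 * (R^2)^2)) * (T * R)"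
      by (simp add: mult_ac)
    have regroup: "(a * V + g1 - g2) * sn + c1 - (c2 + - \<omega>\<^sup>2 * sn * (T * R * V))
        = ((a + \<omega>\<^sup>2 * (T * R)) * V + (g1 - g2)) * sn + (c1 - c2)" for a g1 g2 c1 c2
      by (simp add: algebra_simps)
    show ?thesis unfolding regroup cs_terms G_terms V_terms by (simp add: algebra_simps)
  qed
  finally show ?thesis unfolding F_def V_def sn_def T_def R(2) R_def .
qed

text \<open>Without a zero between two consecutive zeros of \<open>sin (\<omega> * s)\<close> the
  signed Wronskian would strictly decrease, although it is nonpositive at the left end and
  nonnegative at the right end. Strictness comes from the term with
  \<open>1 / (4 * (cos s)^2)\<close>, so a weak comparison of the coefficients is enough.\<close>

lemma sturm_zero:
  fixes \<mu> \<omega> :: real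
  assumes om: "0 < \<omega>" "\<omega>\<^sup>2 = \<mu> + 9/4" and i: "real (Suc i) * pi / \<omega> < pi / 2"
    and comp: "\<And>x. 0 \<le> x \<Longrightarrow> x \<le> sin (real (Suc i) * pi / \<omega>) \<Longrightarrow> \<mu> * (prof b x - 1)^2 \<le> lam * f (prof b x) * (prof b x - 1)"
  shows "\<exists>z. real i * pi / \<omega> < z \<and> z < real (Suc i) * pi / \<omega> \<and> prof b (sin z) = 1"
proof (rule ccontr)
  define s1 where "s1 = real i * pi / \<omega>"
  define s2 where "s2 = real (Suc i) * pi / \<omega>"
  define v where "v s = prof b (sin s) - 1" for s
  assume "\<not> ?thesis"
  then have nz: "v s \<noteq> 0" if "s1 < s" "s < s2" for s using that by (auto simp: v_def s1_def s2_def)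
  have s: "0 \<le> s1" "s1 < s2" "s2 < pi / 2" using i om by (auto simp: s1_def s2_def field_simps)
  have sin01: "0 \<le> sin t \<and> sin t < 1" if "s1 \<le> t" "t \<le> s2" for t
    using that s sin_monotone_2pi[of t "pi/2"] by (auto intro!: sin_ge_zero)
  have cpos: "0 < cos t" if "s1 \<le> t" "t \<le> s2" for t using that s by (intro cos_gt_zero_pi) auto
  have sub: "sin ` {s1..s2} \<subseteq> {0..<1}" using sin01 by auto
  have cont: "continuous_on {s1..s2} (\<lambda>s. prof b (sin s))" "continuous_on {s1..s2} (\<lambda>s. flux b (sin s))"
    by (rule continuous_on_compose2[OF prof_continuous[OF order_refl] _ sub], intro continuous_intros,
        rule continuous_on_compose2[OF flux_continuous[OF order_refl] _ sub], intro continuous_intros)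
  then have vc: "continuous_on {s1..s2} v" unfolding v_def by (intro continuous_intros)
  define m where "m = (s1 + s2) / 2"
  have m: "s1 < m" "m < s2" using s by (auto simp: m_def)
  define \<tau> where "\<tau> = sgn (v m)"
  have \<tau>: "\<tau> = 1 \<or> \<tau> = -1" using nz[OF m] by (auto simp: \<tau>_def sgn_real_def)
  have pos: "0 < \<tau> * v t" if t: "s1 < t" "t < s2" for t
  proof (rule ccontr)
    assume n: "\<not> 0 < \<tau> * v t"
    have pm: "0 < \<tau> * v m" using nz[OF m] by (auto simp: \<tau>_def sgn_real_def)
    have sg: "v m * v t < 0"
      using n pm nz[OF t] \<tau> by (auto simp: mult_less_0_iff zero_less_mult_iff)
    then have "t \<noteq> m" by auto
    moreover have "continuous_on A v" if "A \<subseteq> {s1..s2}" for A by (rule continuous_on_subset[OF vc that])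
    ultimately obtain x where "s1 < x" "x < s2" "v x = 0"
      using zero_between[of m t v] zero_between[of t m v] sg t m
      by (cases "m < t") (force simp: mult.commute)+
    then show False using nz by auto
  qed
  have nonneg: "0 \<le> \<tau> * v t" if t: "t \<in> {s1..s2}" for t
  proof -
    have "continuous_on (closure {s1<..<s2}) (\<lambda>x. \<tau> * v x)" using s by (auto intro!: continuous_intros vc)
    moreover have "t \<in> closure {s1<..<s2}" using t s by auto
    ultimately show ?thesis
      using continuous_ge_on_closure[of "{s1<..<s2}" "\<lambda>x. \<tau> * v x" t 0] pos by (auto intro: less_imp_le)
  qed
  define D where "D = (\<lambda>s. ((sqrt (cos s) ^ 3 - (sin s)^2 / (2 * sqrt (cos s))) * (prof b (sin s) - 1)
      - sin s / sqrt (cos s) * flux b (sin s)) * sin (\<omega> * s)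
      - sin s * sqrt (cos s) * (prof b (sin s) - 1) * (\<omega> * cos (\<omega> * s)))"
  define \<sigma> where "\<sigma> = (-1 :: real) ^ i"
  have \<sigma>: "\<sigma> * \<sigma> = 1" by (simp add: \<sigma>_def flip: power_add mult_2)
  have os: "\<omega> * s1 = real i * pi + 0" "\<omega> * s2 = real i * pi + pi"
    using om(1) by (simp_all add: s1_def s2_def distrib_right add.commute)
  have ends: "sin (\<omega> * s1) = 0" "sin (\<omega> * s2) = 0" "cos (\<omega> * s1) = \<sigma>" "cos (\<omega> * s2) = - \<sigma>"
    unfolding os sin_add_npi cos_add_npi by (simp_all add: \<sigma>_def)
  have sin_sign: "0 < \<sigma> * sin (\<omega> * t)" if t: "s1 < t" "t < s2" for t
  proof -
    define u where "u = \<omega> * t - real i * pi"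
    have "\<omega> * s1 < \<omega> * t" "\<omega> * t < \<omega> * s2" using t om by auto
    then have u: "0 < u" "u < pi" unfolding os by (auto simp: u_def)
    have "\<omega> * t = real i * pi + u" by (simp add: u_def)
    then have "\<sigma> * sin (\<omega> * t) = (\<sigma> * \<sigma>) * sin u" by (simp add: sin_add_npi \<sigma>_def)
    then show ?thesis using \<sigma> u by (simp add: sin_gt_zero)
  qed
  have Dc: "continuous_on {s1..s2} D"
  proof -
    have "sqrt (cos t) \<noteq> 0" if "t \<in> {s1..s2}" for t using cpos[of t] that by auto
    then show ?thesis unfolding D_def by (intro continuous_intros cont) auto
  qed
  have "\<tau> * \<sigma> * D s2 < \<tau> * \<sigma> * D s1"
  proof (rule DERIV_neg_imp_decreasing_open[OF s(2)])
    show "continuous_on {s1..s2} (\<lambda>x. \<tau> * \<sigma> * D x)" by (intro continuous_intros Dc)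
    fix t assume t: "s1 < t" "t < s2"
    have t': "0 < t" "t < pi / 2" using t s by auto
    define P where "P = lam * f (prof b (sin t)) - \<mu> * v t + v t / (4 * (cos t)^2)"
    have "DERIV D t :> - P * (sin t * sqrt (cos t)) * sin (\<omega> * t)"
      unfolding D_def P_def v_def using sturm_wronskian_deriv[OF om(2) t', of b] .
    then have "DERIV (\<lambda>x. \<tau> * \<sigma> * D x) t :> \<tau> * \<sigma> * (- P * (sin t * sqrt (cos t)) * sin (\<omega> * t))"
      by (rule DERIV_cmult)
    moreover have "\<tau> * \<sigma> * (- P * (sin t * sqrt (cos t)) * sin (\<omega> * t)) < 0"
    proof -
      have ct: "0 < cos t" using cpos t by simp
      have "sin t \<le> sin s2" using t s by (intro sin_monotone_2pi_le) auto
      then have "\<mu> * (v t)^2 \<le> lam * f (prof b (sin t)) * v t"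
        unfolding v_def s2_def using sin01[of t] t by (intro comp) auto
      then have "0 \<le> v t * (lam * f (prof b (sin t)) - \<mu> * v t)" by (simp add: algebra_simps power2_eq_square)
      moreover have "0 < (v t)^2 / (4 * (cos t)^2)" using nz[OF t] ct by simp
      ultimately have "0 < v t * P" by (simp add: P_def algebra_simps power2_eq_square)
      then have "0 < \<tau> * P" using pos[OF t] \<tau> by (auto simp: zero_less_mult_iff mult_less_0_iff)
      moreover have "0 < sin t * sqrt (cos t)" using t' ct by (intro mult_pos_pos sin_gt_zero) auto
      ultimately have "0 < (\<tau> * P) * (sin t * sqrt (cos t)) * (\<sigma> * sin (\<omega> * t))"
        using mult_pos_pos[OF mult_pos_pos] sin_sign[OF t] by blast
      then show ?thesis by (simp add: mult_ac)
    qed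
    ultimately show "\<exists>y. DERIV (\<lambda>x. \<tau> * \<sigma> * D x) t :> y \<and> y < 0" by blast
  qed
  moreover have "0 \<le> sin t * sqrt (cos t) * \<omega> * (\<tau> * v t)" if "t \<in> {s1..s2}" for t
    using sin01[of t] cpos[of t] om mult_nonneg_nonneg[OF _ nonneg[OF that]] that by (simp add: less_imp_le)
  moreover have "\<tau> * \<sigma> * D s1 = - (sin s1 * sqrt (cos s1) * \<omega> * (\<tau> * v s1)) * (\<sigma> * \<sigma>)"
    "\<tau> * \<sigma> * D s2 = (sin s2 * sqrt (cos s2) * \<omega> * (\<tau> * v s2)) * (\<sigma> * \<sigma>)"
    by (simp_all add: D_def ends v_def mult_ac)
  ultimately have "sin s2 * sqrt (cos s2) * \<omega> * (\<tau> * v s2) < - (sin s1 * sqrt (cos s1) * \<omega> * (\<tau> * v s1))"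
    "0 \<le> sin s1 * sqrt (cos s1) * \<omega> * (\<tau> * v s1)" "0 \<le> sin s2 * sqrt (cos s2) * \<omega> * (\<tau> * v s2)"
    using s unfolding \<sigma> by auto
  then show False by linarith
qed

text \<open>By continuous dependence a shot from \<open>b\<close> close to 1 stays within
  \<open>d\<close> of 1 on \<open>{0..X}\<close>, where the difference quotient of \<open>f\<close>
  at 1 exceeds the eigenvalue divided by \<open>lam\<close>. Comparison then gives one crossing in
  each of \<open>k\<close> disjoint intervals.\<close>

lemma oscillation_near_one:
  assumes fd: "DERIV f 1 :> p" and p: "2 * real k * (2 * real k + 3) < lam * p"
  obtains b y where "0 \<le> b" "b < 1" "y < 1" "osc b k y"
proof -
  define \<mu> where "\<mu> = 2 * real k * (2 * real k + 3)"
  define \<omega> where "\<omega> = 2 * real k + 3 / 2"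
  have om: "0 < \<omega>" "\<omega>\<^sup>2 = \<mu> + 9/4" by (auto simp: \<omega>_def \<mu>_def power2_eq_square algebra_simps)
  define s where "s i = real i * pi / \<omega>" for i
  have s_mono: "s i \<le> s j" if "i \<le> j" for i j using that om by (simp add: s_def divide_right_mono)
  \<comment> \<open>All \<open>k\<close> intervals fit before \<open>pi / 2\<close> because
    \<open>\<omega>\<close> exceeds \<open>2 * k\<close>; the excess 3/2 is the square root of the
    shift 9/4.\<close>
  have sk: "s k < pi / 2"
    unfolding s_def using om by (simp add: \<omega>_def pos_divide_less_eq algebra_simps)
  have s0: "0 \<le> s i" for i using om by (simp add: s_def)
  define X where "X = sin (s k)"
  have X: "0 \<le> X" "X < 1"
    using s0[of k] sk sin_monotone_2pi[of "s k" "pi/2"] by (auto simp: X_def intro!: sin_ge_zero)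
  have "((\<lambda>h. (f (1 + h) - f 1) / h) \<longlongrightarrow> p) (at 0)" using fd by (simp add: DERIV_def)
  moreover have "\<mu> / lam < p" using p lam_pos by (simp add: \<mu>_def pos_divide_less_eq mult.commute)
  ultimately have "\<forall>\<^sub>F h in at 0. \<mu> / lam < (f (1 + h) - f 1) / h" by (rule order_tendstoD(1))
  then obtain d where d: "0 < d" "\<And>h. h \<noteq> 0 \<Longrightarrow> \<bar>h\<bar> < d \<Longrightarrow> \<mu> / lam < f (1 + h) / h"
    by (auto simp: eventually_at dist_real_def f_1)
  have comp: "\<mu> * (t - 1)^2 \<le> lam * f t * (t - 1)" if "\<bar>t - 1\<bar> < d" for t
  proof (cases "t = 1")
    case False
    have "\<mu> / lam < f t / (t - 1)" using d(2)[of "t - 1"] that False by simp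
    then have "lam * (\<mu> / lam) * (t - 1)^2 \<le> lam * (f t / (t - 1)) * (t - 1)^2"
      using lam_pos by (intro mult_right_mono mult_left_mono) auto
    then show ?thesis using lam_pos False by (simp add: power2_eq_square)
  qed simp
  obtain B where B: "0 < B"
    "\<And>b c x. 0 \<le> x \<Longrightarrow> x \<le> X \<Longrightarrow> \<bar>prof b x - prof c x\<bar> \<le> B * \<bar>b - c\<bar>"
    using prof_dependence[OF X] by metis
  define b where "b = 1 - min (1/2) (d / (2 * B))"
  have b: "0 \<le> b" "b < 1" using d B by (auto simp: b_def)
  have "B * \<bar>b - 1\<bar> \<le> B * (d / (2 * B))" using B d by (intro mult_left_mono) (auto simp: b_def)
  also have "\<dots> < d" using B d by simp
  finally have Bd: "B * \<bar>b - 1\<bar> < d" .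
  have close: "\<bar>prof b x - 1\<bar> < d" if "0 \<le> x" "x \<le> X" for x
    using B(2)[OF that, of b 1] prof_one[of x] that X Bd by simp
  have ex: "\<exists>z. s i < z \<and> z < s (Suc i) \<and> prof b (sin z) = 1" if "i < k" for i
    unfolding s_def
  proof (rule sturm_zero[OF om])
    have le: "s (Suc i) \<le> s k" using that by (intro s_mono) simp
    then show "real (Suc i) * pi / \<omega> < pi / 2" using sk unfolding s_def by linarith
    fix x assume x: "0 \<le> x" "x \<le> sin (real (Suc i) * pi / \<omega>)"
    have "sin (s (Suc i)) \<le> X" unfolding X_def using le s0[of "Suc i"] sk by (intro sin_monotone_2pi_le) auto
    then show "\<mu> * (prof b x - 1)^2 \<le> lam * f (prof b x) * (prof b x - 1)"
      using x by (intro comp close) (auto simp: s_def)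
  qed
  define z where "z i = (SOME z. s i < z \<and> z < s (Suc i) \<and> prof b (sin z) = 1)" for i
  have z: "s i < z i" "z i < s (Suc i)" "prof b (sin (z i)) = 1" if "i < k" for i
    using someI_ex[OF ex[OF that]] by (auto simp: z_def)
  have zr: "0 < z i" "z i < s k" if "i < k" for i
    using z[OF that] s0[of i] s_mono[of "Suc i" k] that by auto
  obtain Y where Y: "0 < Y" "Y < 1"
    "\<And>b y1 y2. b \<noteq> 1 \<Longrightarrow> Y \<le> y1 \<Longrightarrow> y1 < y2 \<Longrightarrow> y2 < 1 \<Longrightarrow> prof b y1 = 1 \<Longrightarrow> prof b y2 \<noteq> 1"
    using last_zone by metis
  define y1 where "y1 = max X Y"
  have y1: "X \<le> y1" "Y \<le> y1" "y1 < 1" using X Y by (auto simp: y1_def)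
  \<comment> \<open>Counting has to end at a point that is not a zero; past \<open>Y\<close> at most
    one of two candidates is a zero.\<close>
  obtain y where y: "y1 \<le> y" "y < 1" "prof b y \<noteq> 1"
    using Y(3)[of b y1 "(1 + y1) / 2"] y1 b that[of y1] that[of "(1 + y1) / 2"]
    by (cases "prof b y1 = 1") (auto simp: field_simps)
  have "\<exists>x\<le>y. osc b k x"
  proof (rule alternates_of_zeros[of _ k "\<lambda>i. sin (z i)"])
    show "prof b 0 - 1 < 0" using b by (simp add: prof_start)
    show "0 \<le> y" "y < 1" "prof b y - 1 \<noteq> 0" using y y1 X by auto
    show "sin (z i) < sin (z j)" if "i < j" "j < k" for i j
    proof (rule sin_monotone_2pi)
      have "z i < s (Suc i)" "s (Suc i) \<le> s j" "s j < z j" using that z[of i] z[of j] s_mono by auto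
      then show "z i < z j" by linarith
      have "0 < z i" using zr(1)[of i] that by simp
      then show "- (pi / 2) \<le> z i" using pi_gt_zero by linarith
      have "z j < s k" using zr(2)[of j] that by simp
      then show "z j \<le> pi / 2" using sk by linarith
    qed
    show "0 < sin (z i) \<and> sin (z i) < y \<and> prof b (sin (z i)) - 1 = 0" if "i < k" for i
    proof -
      have "0 < sin (z i)" using zr[OF that] sk by (intro sin_gt_zero) auto
      moreover have "sin (z i) < X" unfolding X_def using zr[OF that] sk by (intro sin_monotone_2pi) auto
      ultimately show ?thesis using z(3)[OF that] y y1 by auto
    qed
    fix t :: real assume t: "0 < t" "t < 1" "prof b t - 1 = 0"
    have "mom b t \<noteq> 0" using simple_zero[of b t] t b by simp
    then have "- mom b t / (t^2 * (1 - t^2)) \<noteq> 0" using one_minus_square_pos[of t] t by simp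
    moreover have "DERIV (\<lambda>x. prof b x - 1) t :> - mom b t / (t^2 * (1 - t^2))"
      using prof_deriv[OF t(1,2)] by (auto intro!: derivative_eq_intros)
    ultimately show "\<exists>d. d \<noteq> 0 \<and> DERIV (\<lambda>x. prof b x - 1) t :> d" by blast
  qed
  then obtain x where "x \<le> y" "osc b k x" by blast
  then show thesis using b y by (intro that[of b x]) auto
qed

end

section \<open>A priori bounds for regular solutions\<close>

context shooting begin

text \<open>
  Nonpositive constants are solutions, and a shot touching one tangentially would coincide with it.
\<close>

lemma no_nonpos_critical_point:
  assumes f_nonpos: "\<And>x. x \<le> 0 \<Longrightarrow> f x = 0"
    and b: "0 < b" and z: "0 < z" "z < 1" "prof b z \<le> 0"
  shows "mom b z \<noteq> 0"
proof
  assume "mom b z = 0"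
  then have "flux b z = 0" using z by (simp add: mom_def)
  moreover have "sol (prof b z) (\<lambda>_. prof b z) (\<lambda>_. 0)" using f_nonpos z by (auto simp: sol_def)
  ultimately have "b = prof b z" using sol_unique_backward[OF sol_prof, of _ _ _ z b] z by auto
  then show False using b z by simp
qed

text \<open>After reaching a value at most 0 the shot must stay below it, since otherwise it would
  have a nonpositive minimum with zero momentum. There \<open>f\<close> vanishes, so the momentum is
  constant, and regularity makes it zero: again a forbidden critical point.\<close>

lemma regular_pos:
  assumes f_nonpos: "\<And>x. x \<le> 0 \<Longrightarrow> f x = 0"
    and b: "0 < b" and r: "regular b" and x: "0 \<le> x" "x < 1"
  shows "0 < prof b x"
proof (rule ccontr)
  assume n: "\<not> 0 < prof b x"
  then have x0: "0 < x" using b x prof_start[of b] by (cases "x = 0") auto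
  have below: "prof b y < prof b x" if y: "x < y" "y < 1" for y
  proof (rule ccontr)
    assume ny: "\<not> prof b y < prof b x"
    have "continuous_on {0..y} (prof b)" by (rule prof_continuous) (use y in auto)
    moreover have "{0..y} \<noteq> {}" using y x by auto
    ultimately obtain m where m: "m \<in> {0..y}" "\<And>t. t \<in> {0..y} \<Longrightarrow> prof b m \<le> prof b t"
      using continuous_attains_inf[OF compact_Icc] by blast
    \<comment> \<open>If the minimum sits at the right end \<open>y\<close>, then \<open>x\<close>
      has the same value and is an interior minimum.\<close>
    define t where "t = (if m = y then x else m)"
    have tm: "prof b t = prof b m"
      using m(2)[of x] ny y x by (auto simp: t_def)
    have "prof b m \<le> prof b x" using m(2)[of x] y x by simp
    then have le: "prof b t \<le> 0" using tm n by simp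
    have "m \<noteq> 0" using le tm b prof_start[of b] by auto
    then have t: "0 < t" "t < y" using m(1) x0 y by (auto simp: t_def)
    have D: "DERIV (prof b) t :> - mom b t / (t^2 * (1 - t^2))" by (rule prof_deriv) (use t y in auto)
    have "\<forall>s. \<bar>t - s\<bar> < min t (y - t) \<longrightarrow> prof b t \<le> prof b s"
    proof (intro allI impI)
      fix s assume "\<bar>t - s\<bar> < min t (y - t)"
      then have "s \<in> {0..y}" by auto
      then show "prof b t \<le> prof b s" unfolding tm by (rule m(2))
    qed
    then have "- mom b t / (t^2 * (1 - t^2)) = 0"
      using DERIV_local_min[OF D, of "min t (y - t)"] t by simp
    then have "mom b t = 0" using one_minus_square_pos[of t] t y by auto
    then show False using no_nonpos_critical_point[OF f_nonpos b, of t] le t y by simp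
  qed
  have const: "mom b y = mom b x" if y: "x < y" "y < 1" for y
  proof (rule DERIV_zero_const[of x y "mom b"])
    show "continuous_on {x..y} (mom b)" by (rule mom_continuous) (use x y in auto)
    fix t assume t: "x < t" "t < y"
    have "f (prof b t) = 0" using below[of t] t y n by (intro f_nonpos) auto
    then show "DERIV (mom b) t :> 0" using mom_deriv[of t b] t x y by simp
  qed (use y in auto)
  have "\<forall>\<^sub>F y in at_left (1::real). x < y \<and> y < 1" by (rule eventually_at_left_1I[of x]) (use x in auto)
  then have "\<forall>\<^sub>F y in at_left 1. mom b y = mom b x" by eventually_elim (use const in auto)
  then have "(mom b \<longlongrightarrow> mom b x) (at_left 1)" by (rule tendsto_eventually)
  then have "mom b x = 0" using r tendsto_unique[of "at_left (1::real)"] by (auto simp: regular_def)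
  then show False using no_nonpos_critical_point[OF f_nonpos b x0 x(2)] n by simp
qed

lemma regular_mom_bound:
  assumes r: "regular b" and x: "0 \<le> x" "x < 1"
    and S: "\<And>t. x < t \<Longrightarrow> t < 1 \<Longrightarrow> \<bar>f (prof b t)\<bar> \<le> S"
  shows "\<bar>mom b x\<bar> \<le> lam * S * (1 - x)"
proof -
  have "\<bar>mom b y - mom b x\<bar> \<le> lam * S * (1 - x)" if y: "x < y" "y < 1" for y
  proof -
    have S0: "0 \<le> S" using S[OF y] by linarith
    have "\<bar>mom b y - mom b x\<bar> \<le> lam * S * (y - x)" using x y S by (intro mom_diff_le) auto
    also have "\<dots> \<le> lam * S * (1 - x)" using y S0 lam_pos by (intro mult_left_mono) auto
    finally show ?thesis .
  qed
  then have "\<forall>\<^sub>F y in at_left 1. \<bar>mom b y - mom b x\<bar> \<le> lam * S * (1 - x)"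
    using x by (intro eventually_at_left_1I[of x]) auto
  moreover have "((\<lambda>y. \<bar>mom b y - mom b x\<bar>) \<longlongrightarrow> \<bar>0 - mom b x\<bar>) (at_left 1)"
    using r unfolding regular_def by (intro tendsto_intros)
  ultimately have "\<bar>0 - mom b x\<bar> \<le> lam * S * (1 - x)"
    by (intro tendsto_upperbound[of _ _ "at_left (1::real)"]) auto
  then show ?thesis by simp
qed

text \<open>The momentum of a regular shot, integrated from 1, is of order \<open>1 - x\<close>, and
  this cancels the zero of the weight at 1. The factor 4 comes from
  \<open>1 / 4 \<le> x^2\<close>.\<close>

lemma regular_deriv_bound:
  assumes r: "regular b" and x: "1 / 2 \<le> x" "x < 1"
    and S: "\<And>t. x < t \<Longrightarrow> t < 1 \<Longrightarrow> \<bar>f (prof b t)\<bar> \<le> S"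
  shows "\<bar>- mom b x / (x^2 * (1 - x^2))\<bar> \<le> 4 * lam * S"
proof -
  have "1 / 4 \<le> x^2" using power_mono[of "1/2" x 2] x by (simp add: power2_eq_square)
  then have w: "(1 - x) / 4 \<le> x^2 * (1 - x^2)" using square_weight_lower[of "1/4" x] x by simp
  have p: "0 < x^2 * (1 - x^2)" using w x by (smt (verit) divide_pos_pos)
  have "0 \<le> S" using S[of "(1 + x) / 2"] x by (auto simp: field_simps)
  have "\<bar>- mom b x / (x^2 * (1 - x^2))\<bar> = \<bar>mom b x\<bar> / (x^2 * (1 - x^2))"
    using p by (simp only: abs_divide abs_minus_cancel abs_of_pos)
  also have "\<dots> \<le> (lam * S * (1 - x)) / ((1 - x) / 4)"
    using regular_mom_bound[OF r _ _ S] w x lam_pos \<open>0 \<le> S\<close> by (intro frac_le) auto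
  also have "\<dots> = 4 * lam * S" using x by simp
  finally show ?thesis .
qed

lemma regular_limit:
  assumes r: "regular b"
  obtains w1 where "(prof b \<longlongrightarrow> w1) (at_left 1)"
proof -
  have lip: "\<bar>prof b y - prof b x\<bar> \<le> 4 * lam * K * (y - x)" if xy: "1 / 2 \<le> x" "x \<le> y" "y < 1" for x y
  proof (rule abs_diff_le_of_deriv_bound[OF xy(2)])
    show "continuous_on {x..y} (prof b)" by (rule prof_continuous) (use xy in auto)
    fix t assume t: "x < t" "t < y"
    show "DERIV (prof b) t :> - mom b t / (t^2 * (1 - t^2))"
      by (rule prof_deriv) (use t xy in auto)
    show "\<bar>- mom b t / (t^2 * (1 - t^2))\<bar> \<le> 4 * lam * K"
      using t xy by (intro regular_deriv_bound[OF r _ _ f_bound]) auto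
  qed
  have "(4 * lam * K)-lipschitz_on {1/2..<1} (prof b)"
  proof (rule lipschitz_onI)
    show "0 \<le> 4 * lam * K" using lam_pos K_nonneg by simp
    fix x y :: real assume "x \<in> {1/2..<1}" "y \<in> {1/2..<1}"
    then show "dist (prof b x) (prof b y) \<le> 4 * lam * K * dist x y"
      using lip[of x y] lip[of y x] by (cases "x \<le> y") (auto simp: dist_real_def abs_minus_commute)
  qed
  then have "uniformly_continuous_on {1/2..<1} (prof b)" by (rule lipschitz_on_uniformly_continuous)
  then obtain g where g: "uniformly_continuous_on (closure {1/2..<1}) g" "\<And>x. x \<in> {1/2..<1} \<Longrightarrow> prof b x = g x"
    using uniformly_continuous_on_extension_on_closure by metis
  have "continuous_on {1/2..1} g" using uniformly_continuous_imp_continuous[OF g(1)] by simp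
  then have "(g \<longlongrightarrow> g 1) (at_left 1)"
    by (auto simp: continuous_on_Icc_at_leftD)
  moreover have "\<forall>\<^sub>F x in at_left 1. prof b x = g x"
    by (rule eventually_at_left_1I[of "1/2"]) (use g(2) in auto)
  ultimately have "(prof b \<longlongrightarrow> g 1) (at_left 1)" by (simp add: tendsto_cong)
  then show thesis by (rule that)
qed

text \<open>A boundary point argument at 1. If the limit were 0, then \<open>f\<close> would be
  negative along the shot near 1, so the momentum would decrease to 0 and the profile would
  decrease. Then \<open>L * prof b t\<close> bounds \<open>f\<close> on all of
  \<open>(t, 1)\<close>, the slope is at least \<open>- C * prof b t\<close>, and Gronwall keeps the
  profile away from 0.\<close>

lemma regular_limit_pos:
  assumes f_nonpos: "\<And>x. x \<le> 0 \<Longrightarrow> f x = 0" and f_neg: "\<And>x. 0 < x \<Longrightarrow> x < 1 \<Longrightarrow> f x < 0"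
    and b: "0 < b" and r: "regular b" and l: "(prof b \<longlongrightarrow> w1) (at_left 1)"
  shows "0 < w1"
proof -
  have pos: "0 < prof b x" if "0 \<le> x" "x < 1" for x using regular_pos[OF f_nonpos b r that] .
  have "\<forall>\<^sub>F x in at_left (1::real). 0 < x \<and> x < 1" by (rule eventually_at_left_1I[of 0]) auto
  then have "\<forall>\<^sub>F x in at_left 1. 0 \<le> prof b x" by eventually_elim (use pos in \<open>auto intro: less_imp_le\<close>)
  then have "0 \<le> w1" using l by (intro tendsto_lowerbound[of _ _ "at_left (1::real)"]) auto
  moreover have "w1 \<noteq> 0"
  proof
    assume "w1 = 0"
    then have "\<forall>\<^sub>F x in at_left 1. prof b x < 1" using l by (intro order_tendstoD(2)) auto
    then obtain a where a: "a < 1" "\<And>x. a < x \<Longrightarrow> x < 1 \<Longrightarrow> prof b x < 1"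
      by (auto simp: eventually_at_left[of 0])
    define x0 where "x0 = max (1/2) ((1 + a) / 2)"
    have x0: "1/2 \<le> x0" "x0 < 1" "a < x0" using a by (auto simp: x0_def less_max_iff_disj)
    have neg: "f (prof b x) < 0" if "x0 \<le> x" "x < 1" for x
      using a(2)[of x] pos[of x] x0 that by (intro f_neg) auto
    have mom_decr: "mom b y \<le> mom b x" if "x0 \<le> x" "x \<le> y" "y < 1" for x y
    proof (rule nonpos_deriv_le[OF that(2), of "mom b"])
      show "continuous_on {x..y} (mom b)" by (rule mom_continuous) (use that x0 in auto)
      fix t assume t: "x < t" "t < y"
      show "lam * t^2 * f (prof b t) \<le> 0" using neg[of t] lam_pos t that by (auto simp: mult_le_0_iff intro!: mult_nonneg_nonpos)
      show "DERIV (mom b) t :> lam * t^2 * f (prof b t)"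
        by (rule mom_deriv) (use t that x0 in auto)
    qed
    have mom_nonneg: "0 \<le> mom b x" if x: "x0 \<le> x" "x < 1" for x
    proof (rule tendsto_upperbound[of "mom b" 0 "at_left 1"])
      show "(mom b \<longlongrightarrow> 0) (at_left 1)" using r by (simp add: regular_def)
      show "\<forall>\<^sub>F y in at_left 1. mom b y \<le> mom b x"
        by (rule eventually_at_left_1I[of x]) (use mom_decr[OF x(1)] x in auto)
    qed auto
    have prof_decr: "prof b y \<le> prof b x" if "x0 \<le> x" "x \<le> y" "y < 1" for x y
    proof (rule nonpos_deriv_le[OF that(2), of "prof b"])
      show "continuous_on {x..y} (prof b)" by (rule prof_continuous) (use that x0 in auto)
      fix t assume t: "x < t" "t < y"
      show "- mom b t / (t^2 * (1 - t^2)) \<le> 0"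
        using mom_nonneg[of t] one_minus_square_pos[of t] t that x0 by (simp add: divide_nonneg_nonneg)
      show "DERIV (prof b) t :> - mom b t / (t^2 * (1 - t^2))"
        by (rule prof_deriv) (use t that x0 in auto)
    qed
    define C where "C = 4 * lam * L"
    have C: "0 \<le> C" using lam_pos L_nonneg by (simp add: C_def)
    have lower: "prof b x0 * exp (- C) \<le> prof b y" if y: "x0 \<le> y" "y < 1" for y
    proof -
      have "prof b x0 \<le> prof b y * exp (C * (y - x0))"
      proof (rule gronwall_backward[OF y(1), of "prof b" C])
        show "continuous_on {x0..y} (prof b)" by (rule prof_continuous) (use y x0 in auto)
        fix t assume t: "x0 < t" "t < y"
        have "\<bar>f (prof b u)\<bar> \<le> L * prof b t" if "t < u" "u < 1" for u
        proof -
          have "\<bar>f (prof b u)\<bar> \<le> L * \<bar>prof b u\<bar>" using f_lipschitz[of "prof b u" 0] by (simp add: f_0)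
          also have "\<dots> \<le> L * prof b t"
            using prof_decr[of t u] pos[of u] that t x0 L_nonneg by (intro mult_left_mono) auto
          finally show ?thesis .
        qed
        then have "\<bar>- mom b t / (t^2 * (1 - t^2))\<bar> \<le> 4 * lam * (L * prof b t)"
          by (intro regular_deriv_bound[OF r]) (use t x0 y in auto)
        then have "- C * prof b t \<le> - mom b t / (t^2 * (1 - t^2))"
          unfolding C_def by (simp only: mult.assoc mult_minus_left)
        moreover have "DERIV (prof b) t :> - mom b t / (t^2 * (1 - t^2))"
          by (rule prof_deriv) (use t y x0 in auto)
        ultimately show "\<exists>d. DERIV (prof b) t :> d \<and> - C * prof b t \<le> d" by blast
      qed
      also have "\<dots> \<le> prof b y * exp C"
      proof -
        have "C * (y - x0) \<le> C * 1" using C y x0 by (intro mult_left_mono) auto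
        then show ?thesis using pos[of y] y x0 by (intro mult_left_mono) auto
      qed
      finally have "prof b x0 * exp (- C) \<le> prof b y * exp C * exp (- C)" by (rule mult_right_mono) simp
      then show ?thesis by (simp add: mult.assoc flip: exp_add)
    qed
    have "prof b x0 * exp (- C) \<le> w1"
      by (rule tendsto_lowerbound[OF l]) (use lower x0 in \<open>auto intro!: eventually_at_left_1I[of x0]\<close>)
    then show False using pos[of x0] x0 \<open>w1 = 0\<close> by (simp add: mult_le_0_iff)
  qed
  ultimately show ?thesis by simp
qed

text \<open>
  The energy decreases up to \<open>x\<^sup>2 = 2/3\<close>, where the volume \<open>x\<^sup>2 sqrt (1 - x\<^sup>2)\<close> of the orbits is
  maximal; from there on it has to be weighted with \<open>x^4 (1 - x\<^sup>2)\<close> (lemma \<open>mom_bound\<close>).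
\<close>

lemma energy_decreasing:
  assumes F: "\<And>t. DERIV F t :> f t" and x: "0 \<le> x" "x < 1" "x^2 \<le> 2 / 3"
  shows "(flux b x)^2 / (2 * (1 - x^2)) + lam * F (prof b x) \<le> lam * F b"
proof -
  let ?E = "\<lambda>x. (flux b x)^2 / (2 * (1 - x^2)) + lam * F (prof b x)"
  have Fc: "continuous_on UNIV F" using F DERIV_isCont by (auto simp: continuous_on_eq_continuous_at)
  have "?E x \<le> ?E 0"
  proof (rule nonpos_deriv_le[OF x(1), of ?E])
    have sub: "{0..x} \<subseteq> {0..<1}" using x by auto
    have "1 - t^2 \<noteq> 0" if "t \<in> {0..x}" for t using one_minus_square_pos[of t] that x by auto
    then show "continuous_on {0..x} ?E"
      by (intro continuous_intros flux_continuous prof_continuous sub continuous_on_compose2[OF Fc]) auto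
    fix t assume t: "0 < t" "t < x"
    have t2: "t^2 \<le> 2 / 3" using power_mono[of t x 2] t x by linarith
    have p: "0 < 1 - t^2" using one_minus_square_pos[of t] t x by simp
    have dF: "DERIV (\<lambda>x. F (prof b x)) t :> f (prof b t) * (- flux b t / (1 - t^2))"
      by (rule DERIV_chain2[OF F prof_deriv_flux]) (use t x in auto)
    have dg: "DERIV (flux b) t :> lam * f (prof b t) - 2 * flux b t / t"
      by (rule flux_deriv) (use t x in auto)
    let ?d = "(2 * flux b t * (lam * f (prof b t) - 2 * flux b t / t) * (2 * (1 - t^2)) - (flux b t)^2 * (- 4 * t)) / (2 * (1 - t^2))^2
        + lam * (f (prof b t) * (- flux b t / (1 - t^2)))"
    have "DERIV ?E t :> ?d"
      using p by (auto intro!: derivative_eq_intros dg dF simp: power2_eq_square mult_ac)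
    also have "?d = (flux b t)^2 / (1 - t^2) * ((3 * t^2 - 2) / (t * (1 - t^2)))"
    proof -
      define P where "P = 1 - t^2"
      have P: "0 < P" "t^2 = 1 - P" using p by (auto simp: P_def)
      have "(2 * g * (a - 2 * g / t) * (2 * P) - g^2 * (- 4 * t)) / (2 * P)^2 + (- a * g / P) = g^2 / P * ((t^2 - 2 * P) / (t * P))" for a g
        using P(1) t(1) by (simp add: field_simps power2_eq_square)
      from this[of "flux b t" "lam * f (prof b t)"] show ?thesis
        unfolding P_def[symmetric] P(2) by (simp add: algebra_simps)
    qed
    finally show "DERIV ?E t :> (flux b t)^2 / (1 - t^2) * ((3 * t^2 - 2) / (t * (1 - t^2)))" .
    show "(flux b t)^2 / (1 - t^2) * ((3 * t^2 - 2) / (t * (1 - t^2))) \<le> 0"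
      using p t t2 by (intro mult_nonneg_nonpos divide_nonneg_pos divide_nonpos_pos) auto
  qed
  then show ?thesis by (simp add: prof_start flux_start)
qed

text \<open>The weight is the square of the orbit volume. It turns the kinetic part into
  \<open>(mom b x)^2 / 2\<close>, whose derivative cancels that of the potential; only the
  derivative of the weight remains, which is nonpositive for \<open>x^2 \<ge> 2/3\<close>. Shifting
  \<open>F\<close> by 1/2 makes its factor nonnegative.\<close>

lemma mom_bound:
  assumes F: "\<And>t. DERIV F t :> f t" and F_lower: "\<And>t. - 1 / 2 \<le> F t" and Fb: "F b \<le> 0"
    and x: "sqrt (2/3) \<le> x" "x < 1"
  shows "\<bar>mom b x\<bar> \<le> sqrt lam"
proof -
  define a where "a = sqrt (2/3 :: real)"
  have a: "0 < a" "a^2 = 2/3" "a < 1" "a \<le> x" using x by (auto simp: a_def)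
  let ?H = "\<lambda>x. (mom b x)^2 / 2 + lam * (x ^ 4 * (1 - x^2)) * (F (prof b x) + 1/2)"
  have Fc: "continuous_on UNIV F" using F DERIV_isCont by (auto simp: continuous_on_eq_continuous_at)
  have "?H x \<le> ?H a"
  proof (rule nonpos_deriv_le[OF a(4), of ?H])
    have sub: "{a..x} \<subseteq> {0..<1}" using x a by auto
    show "continuous_on {a..x} ?H"
      by (intro continuous_intros mom_continuous prof_continuous sub continuous_on_compose2[OF Fc]) auto
    fix t assume t: "a < t" "t < x"
    have t0: "0 < t" "t < 1" using t a x by auto
    have p: "0 < 1 - t^2" using one_minus_square_pos[of t] t0 by simp
    have dF: "DERIV (\<lambda>x. F (prof b x)) t :> f (prof b t) * (- mom b t / (t^2 * (1 - t^2)))"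
      by (rule DERIV_chain2[OF F prof_deriv[OF t0]])
    note dm = mom_deriv[OF t0, of b]
    have dw: "DERIV (\<lambda>x. lam * (x ^ 4 * (1 - x^2))) t :> lam * (4 * t ^ 3 - 6 * t ^ 5)"
      by (auto intro!: derivative_eq_intros simp: algebra_simps power2_eq_square power3_eq_cube eval_nat_numeral)
    let ?p = "f (prof b t) * (- mom b t / (t^2 * (1 - t^2)))"
    let ?d = "mom b t * (lam * t^2 * f (prof b t))
        + (lam * (4 * t ^ 3 - 6 * t ^ 5) * (F (prof b t) + 1/2) + ?p * (lam * (t ^ 4 * (1 - t^2))))"
    have "DERIV ?H t :> ?d"
    proof -
      have d1: "DERIV (\<lambda>x. (mom b x)^2 / 2) t :> mom b t * (lam * t^2 * f (prof b t))"
        using DERIV_cdivide[OF DERIV_power[OF dm, of 2], of 2] by (simp add: mult_ac)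
      have d2: "DERIV (\<lambda>x. F (prof b x) + 1/2) t :> ?p"
        using DERIV_add[OF dF DERIV_const, of "1/2"] by simp
      show ?thesis using DERIV_add[OF d1 DERIV_mult[OF dw d2]] .
    qed
    also have "?d = lam * (4 * t ^ 3 - 6 * t ^ 5) * (F (prof b t) + 1/2)"
      using p t0 by (simp add: field_simps eval_nat_numeral)
    finally show "DERIV ?H t :> lam * (4 * t ^ 3 - 6 * t ^ 5) * (F (prof b t) + 1/2)" .
    have "2 / 3 \<le> t^2" using power_mono[of a t 2] a t by simp
    then have "4 * t ^ 3 - 6 * t ^ 5 \<le> 0"
    proof -
      have "4 * t ^ 3 - 6 * t ^ 5 = t ^ 3 * (4 - 6 * t^2)" by (simp add: algebra_simps eval_nat_numeral)
      also have "\<dots> \<le> 0" using \<open>2 / 3 \<le> t^2\<close> t0 by (intro mult_nonneg_nonpos) auto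
      finally show ?thesis .
    qed
    then show "lam * (4 * t ^ 3 - 6 * t ^ 5) * (F (prof b t) + 1/2) \<le> 0"
      using lam_pos F_lower[of "prof b t"] by (intro mult_nonpos_nonneg mult_nonneg_nonpos) auto
  qed
  also have "?H a \<le> lam / 2"
  proof -
    have "a ^ 4 = (a^2)^2" by (simp flip: power_mult)
    then have a4: "a ^ 4 = 4/9" unfolding a(2) by (simp add: power2_eq_square)
    have "lam * F b \<le> 0" using lam_pos Fb by (simp add: mult_nonneg_nonpos)
    then have "(flux b a)^2 / (2 * (1 - a^2)) + lam * F (prof b a) \<le> 0"
      using a by (intro order_trans[OF energy_decreasing[OF F, of a b]]) auto
    moreover have "(flux b a)^2 / (2 * (1 - a^2)) = (flux b a)^2 * (3 / 2)" unfolding a(2) by simp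
    ultimately have E: "(flux b a)^2 * (3 / 2) + lam * F (prof b a) \<le> 0" by (simp only:)
    \<comment> \<open>The numbers 4/9 and 4/27 are \<open>a ^ 4\<close> and
      \<open>a ^ 4 * (1 - a^2)\<close>; the energy inequality at \<open>a\<close> leaves only
      \<open>2/27 * lam\<close>.\<close>
    have "?H a = 4/9 * ((flux b a)^2 / 2) + lam * (4/27) * (F (prof b a) + 1/2)"
      unfolding mom_def by (simp add: power_mult_distrib a4 a(2) power_divide)
    also have "\<dots> = 4/27 * ((flux b a)^2 * (3 / 2) + lam * F (prof b a)) + 2/27 * lam"
      by (simp add: field_simps)
    also have "\<dots> \<le> 4/27 * 0 + 2/27 * lam" using E by (intro add_mono mult_left_mono) auto
    also have "\<dots> \<le> lam / 2" using lam_pos by simp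
    finally show ?thesis .
  qed
  finally have "(mom b x)^2 / 2 + lam * (x ^ 4 * (1 - x^2)) * (F (prof b x) + 1/2) \<le> lam / 2" .
  moreover have "0 \<le> lam * (x ^ 4 * (1 - x^2)) * (F (prof b x) + 1/2)"
    using lam_pos one_minus_square_pos[of x] a x F_lower[of "prof b x"]
    by (intro mult_nonneg_nonneg) auto
  ultimately have "(mom b x)^2 \<le> lam" by linarith
  then show ?thesis using real_sqrt_le_mono[of "(mom b x)^2" lam] by simp
qed

text \<open>Up to \<open>a\<close> the energy confines the shot to \<open>F \<le> 0\<close>.
  Afterwards the bounded momentum allows logarithmic growth, so \<open>f\<close> is at most of order
  \<open>1 / sqrt (1 - x)\<close>. Regularity permits integration from 1, which bounds the negative
  of the momentum by order \<open>sqrt (1 - x)\<close> and the slope by order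
  \<open>1 / sqrt (1 - x)\<close>; this is integrable. The constants \<open>K\<close> and
  \<open>L\<close> do not enter the bound.\<close>

lemma regular_upper_bound:
  assumes F: "\<And>t. DERIV F t :> f t" and F_lower: "\<And>t. - 1 / 2 \<le> F t" and Fb: "F b \<le> 0"
    and F_well: "\<And>t. F t \<le> 0 \<Longrightarrow> t \<le> M0" and M0: "0 \<le> M0"
    and f_upper: "\<And>t. f t \<le> max 0 t powr q" and q: "1 < q" and r: "regular b" and x: "0 \<le> x" "x < 1"
  shows "prof b x \<le> M0 + 6 * lam * (M0 + 3 * q * sqrt lam) powr q"
proof -
  define a where "a = sqrt (2/3 :: real)"
  have a: "0 < a" "a^2 = 2/3" "a < 1" by (auto simp: a_def)
  have early: "prof b x \<le> M0" if x: "0 \<le> x" "x \<le> a" for x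
  proof -
    have x2: "x^2 \<le> 2/3" using power_mono[OF x(2,1), of 2] a by simp
    have "0 < 1 - x^2" using x2 by simp
    then have "0 \<le> (flux b x)^2 / (2 * (1 - x^2))" by simp
    moreover have "lam * F b \<le> 0" using lam_pos Fb by (simp add: mult_nonneg_nonpos)
    ultimately have "lam * F (prof b x) \<le> 0"
      using energy_decreasing[OF F, of x b] x x2 a by linarith
    then have "F (prof b x) \<le> 0" using lam_pos by (simp add: mult_le_0_iff)
    then show ?thesis by (rule F_well)
  qed
  have weight: "2/3 * (1 - t) \<le> t^2 * (1 - t^2)" if "a \<le> t" "t < 1" for t
    using power_mono[of a t 2] a that by (intro square_weight_lower) auto
  \<comment> \<open>The logarithm has the slope \<open>3/2 * sqrt lam\<close> and is at most
    \<open>2 * q\<close> times the power with exponent \<open>1 / (2 * q)\<close>; the product is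
    \<open>3 * q * sqrt lam\<close>.\<close>
  define C where "C = M0 + 3 * q * sqrt lam"
  have sl: "0 \<le> sqrt lam" using lam_pos by simp
  have C: "0 \<le> C" using M0 q sl by (simp add: C_def)
  \<comment> \<open>The exponent \<open>1 / (2 * q)\<close> is chosen so that the power
    \<open>q\<close> of the bound is of order \<open>1 / sqrt (1 - x)\<close>.\<close>
  have late: "prof b x \<le> C * (1 / (1 - x)) powr (1 / (2 * q))" if x: "a \<le> x" "x < 1" for x
  proof -
    let ?h = "\<lambda>x. prof b x + 3/2 * sqrt lam * ln (1 - x)"
    have "?h x \<le> ?h a"
    proof (rule nonpos_deriv_le[OF x(1), of ?h])
      show "continuous_on {a..x} ?h"
        by (intro continuous_intros prof_continuous) (use x a in auto)
      fix t assume t: "a < t" "t < x"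
      have t0: "0 < t" "t < 1" using t a x by auto
      have p: "0 < 1 - t^2" using one_minus_square_pos[of t] t0 by simp
      have "2/3 * (1 - t) \<le> t^2 * (1 - t^2)" using t t0 by (intro weight) auto
      moreover have "\<bar>mom b t\<bar> \<le> sqrt lam"
        using t t0 by (intro mom_bound[OF F F_lower Fb]) (auto simp: a_def)
      ultimately have "- mom b t / (t^2 * (1 - t^2)) \<le> sqrt lam / (2/3 * (1 - t))"
        using t0 sl by (intro frac_le) auto
      then show "- mom b t / (t^2 * (1 - t^2)) + - (3/2 * sqrt lam / (1 - t)) \<le> 0" by (simp add: mult.commute)
      show "DERIV ?h t :> - mom b t / (t^2 * (1 - t^2)) + - (3/2 * sqrt lam / (1 - t))"
        using t0 by (auto intro!: derivative_eq_intros prof_deriv simp: field_simps)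
    qed
    moreover have "3/2 * sqrt lam * ln (1 - a) \<le> 0" using sl a by (intro mult_nonneg_nonpos) auto
    ultimately have "prof b x \<le> M0 + 3/2 * sqrt lam * - ln (1 - x)" using early[of a] a by simp
    also have "- ln (1 - x) = ln (1 / (1 - x))" using x by (simp add: ln_div)
    also have "M0 + 3/2 * sqrt lam * ln (1 / (1 - x)) \<le> M0 * (1 / (1 - x)) powr (1 / (2 * q)) + 3/2 * sqrt lam * ((1 / (1 - x)) powr (1 / (2 * q)) / (1 / (2 * q)))"
    proof (intro add_mono mult_left_mono)
      have ge1: "1 \<le> 1 / (1 - x)" using x a by simp
      show "ln (1 / (1 - x)) \<le> (1 / (1 - x)) powr (1 / (2 * q)) / (1 / (2 * q))"
        using ln_powr_bound[OF ge1, of "1 / (2 * q)"] q by simp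
      have "1 \<le> (1 / (1 - x)) powr (1 / (2 * q))" using ge1 q by (intro ge_one_powr_ge_zero) auto
      then show "M0 \<le> M0 * (1 / (1 - x)) powr (1 / (2 * q))" using M0 mult_left_mono by fastforce
      show "0 \<le> 3/2 * sqrt lam" using sl by simp
    qed
    also have "\<dots> = C * (1 / (1 - x)) powr (1 / (2 * q))" by (simp add: C_def algebra_simps)
    finally show ?thesis .
  qed
  define S where "S = C powr q"
  have S: "0 \<le> S" by (simp add: S_def)
  have f_late: "f (prof b x) \<le> S / sqrt (1 - x)" if x: "a \<le> x" "x < 1" for x
  proof -
    have "f (prof b x) \<le> max 0 (prof b x) powr q" by (rule f_upper)
    also have "\<dots> \<le> (C * (1 / (1 - x)) powr (1 / (2 * q))) powr q"
      using late[OF x] C q by (intro powr_mono2) auto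
    also have "\<dots> = S * ((1 / (1 - x)) powr (1 / (2 * q))) powr q"
      using C x by (simp add: S_def powr_mult)
    also have "((1 / (1 - x)) powr (1 / (2 * q))) powr q = (1 / (1 - x)) powr (1 / 2)"
      using q by (simp add: powr_powr)
    also have "\<dots> = sqrt (1 / (1 - x))" using x by (subst powr_half_sqrt) auto
    finally show ?thesis by (simp add: real_sqrt_divide)
  qed
  have mom_late: "- (2 * lam * S * sqrt (1 - x)) \<le> mom b x" if x: "a \<le> x" "x < 1" for x
  proof -
    let ?h = "\<lambda>x. mom b x + 2 * lam * S * sqrt (1 - x)"
    have "?h y \<le> ?h x" if y: "x \<le> y" "y < 1" for y
    proof (rule nonpos_deriv_le[OF y(1), of ?h])
      show "continuous_on {x..y} ?h" by (intro continuous_intros mom_continuous) (use x y a in auto)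
      fix t assume t: "x < t" "t < y"
      have t0: "0 < t" "t < 1" "a \<le> t" using t a x y by auto
      have "lam * t^2 * f (prof b t) \<le> lam * 1 * (S / sqrt (1 - t))"
      proof (cases "0 \<le> f (prof b t)")
        case True
        then show ?thesis using f_late[OF t0(3,2)] lam_pos t0 by (intro mult_mono) (auto simp: power_le_one)
      next
        case False
        then have "lam * t^2 * f (prof b t) \<le> 0" using lam_pos by (intro mult_nonneg_nonpos) auto
        also have "0 \<le> lam * 1 * (S / sqrt (1 - t))" using lam_pos S t0 by simp
        finally show ?thesis .
      qed
      then show "lam * t^2 * f (prof b t) + - (lam * S / sqrt (1 - t)) \<le> 0" by simp
      show "DERIV ?h t :> lam * t^2 * f (prof b t) + - (lam * S / sqrt (1 - t))"
        using t0 by (auto intro!: derivative_eq_intros mom_deriv simp: field_simps)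
    qed
    then have "\<forall>\<^sub>F y in at_left 1. ?h y \<le> ?h x" using x by (intro eventually_at_left_1I[of x]) auto
    moreover have "(?h \<longlongrightarrow> 0 + 2 * lam * S * sqrt (1 - 1)) (at_left 1)"
      using r unfolding regular_def by (intro tendsto_intros)
    ultimately have "0 + 2 * lam * S * sqrt (1 - 1) \<le> ?h x"
      by (intro tendsto_upperbound[of ?h _ "at_left 1"]) auto
    then show ?thesis by simp
  qed
  show ?thesis
  proof (cases "x \<le> a")
    case True
    then show ?thesis using early[of x] x S lam_pos by (simp add: S_def C_def add_increasing2)
  next
    case False
    let ?h = "\<lambda>x. prof b x + 6 * lam * S * sqrt (1 - x)"
    have "?h x \<le> ?h a"
    proof (rule nonpos_deriv_le[of a x ?h])
      show "a \<le> x" using False by simp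
      show "continuous_on {a..x} ?h" by (intro continuous_intros prof_continuous) (use x a in auto)
      fix t assume t: "a < t" "t < x"
      have t0: "0 < t" "t < 1" "a \<le> t" using t a x by auto
      have p: "0 < 1 - t^2" using one_minus_square_pos[of t] t0 by simp
      have w: "2/3 * (1 - t) \<le> t^2 * (1 - t^2)" using t t0 by (intro weight) auto
      have "- mom b t / (t^2 * (1 - t^2)) \<le> 2 * lam * S * sqrt (1 - t) / (2/3 * (1 - t))"
      proof (rule frac_le)
        show "- mom b t \<le> 2 * lam * S * sqrt (1 - t)" using mom_late[OF t0(3,2)] by simp
      qed (use w t0 lam_pos S in auto)
      also have "\<dots> = 3 * lam * S / sqrt (1 - t)"
      proof -
        define u where "u = sqrt (1 - t)"
        have u: "0 < u" "1 - t = u * u" using t0 by (auto simp: u_def)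
        show ?thesis unfolding u_def[symmetric] u(2) using u(1) by (simp add: field_simps)
      qed
      finally show "- mom b t / (t^2 * (1 - t^2)) + - (3 * lam * S / sqrt (1 - t)) \<le> 0" by simp
      show "DERIV ?h t :> - mom b t / (t^2 * (1 - t^2)) + - (3 * lam * S / sqrt (1 - t))"
        using t0 by (auto intro!: derivative_eq_intros prof_deriv simp: field_simps)
    qed
    moreover have "6 * lam * S * sqrt (1 - a) \<le> 6 * lam * S * 1"
      using lam_pos S a by (intro mult_left_mono) auto
    moreover have "0 \<le> 6 * lam * S * sqrt (1 - x)" using lam_pos S x by simp
    ultimately have "prof b x \<le> prof b a + 6 * lam * S" by linarith
    then show ?thesis using early[of a] a by (simp add: S_def C_def)
  qed
qed

end

section \<open>Regularity at both focal submanifolds\<close>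

context shooting begin

text \<open>
  In the variable \<open>y = x\<^sup>2\<close> the derivative of the profile is an average of \<open>f \<circ> W\<close> over \<open>[0, y]\<close> and, for a
  regular shot, also over \<open>[y, 1]\<close>; the first form is smooth at \<open>0\<close>, the second one at \<open>1\<close>.
\<close>

lemma regular_profile_C2:
  fixes f' :: "real \<Rightarrow> real"
  assumes r: "regular b" and l: "(prof b \<longlongrightarrow> w1) (at_left 1)"
    and rng: "\<And>x. 0 \<le> x \<Longrightarrow> x < 1 \<Longrightarrow> prof b x \<in> J" "w1 \<in> J"
    and f': "\<And>t. t \<in> J \<Longrightarrow> DERIV f t :> f' t" "continuous_on J f'"
  obtains W W1 W2 where "\<And>x. 0 \<le> x \<Longrightarrow> x < 1 \<Longrightarrow> W (x^2) = prof b x"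
    "\<And>y. y \<in> {0..1} \<Longrightarrow> W y \<in> J"
    "\<And>y. y \<in> {0..1} \<Longrightarrow> (W has_real_derivative W1 y) (at y within {0..1})"
    "\<And>y. y \<in> {0..1} \<Longrightarrow> (W1 has_real_derivative W2 y) (at y within {0..1})"
    "continuous_on {0..1} W2"
    "\<And>y. y \<in> {0..1} \<Longrightarrow> 4 * y * (1 - y) * W2 y + (6 - 10 * y) * W1 y + lam * f (W y) = 0"
proof -
  define W where "W y = (if y < 1 then prof b (sqrt y) else w1)" for y
  define Mv where "Mv y = (if y < 1 then mom b (sqrt y) else 0)" for y
  define h where "h y = f (W y)" for y
  have Wc: "continuous_on {0..1} W"
    unfolding W_def by (rule continuous_on_sqrt_extend[OF prof_continuous[OF order_refl] l])
  have Mc: "continuous_on {0..1} Mv"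
    unfolding Mv_def by (rule continuous_on_sqrt_extend[OF mom_continuous[OF order_refl] r[unfolded regular_def]])
  have hc: "continuous_on {0..1} h"
    unfolding h_def by (rule continuous_on_compose2[OF f_continuous[of UNIV] Wc]) auto
  have WJ: "W y \<in> J" if "y \<in> {0..1}" for y using rng that by (auto simp: W_def)
  have dM: "DERIV Mv y :> lam / 2 * sqrt y * h y" if y: "0 < y" "y < 1" for y
  proof -
    have s: "0 < sqrt y" "sqrt y < 1" using y by auto
    have "DERIV (\<lambda>y. mom b (sqrt y)) y :> lam * (sqrt y)^2 * f (prof b (sqrt y)) * (inverse (sqrt y) / 2)"
      by (rule DERIV_chain2[OF mom_deriv[OF s] DERIV_real_sqrt]) (use y in auto)
    also have "lam * (sqrt y)^2 * f (prof b (sqrt y)) * (inverse (sqrt y) / 2) = lam / 2 * sqrt y * h y"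
      using s y by (simp add: h_def W_def field_simps power2_eq_square)
    finally show ?thesis
      by (rule has_field_derivative_transform_within_open[of _ _ _ "{0<..<1}"]) (use y in \<open>auto simp: Mv_def\<close>)
  qed
  have dW: "DERIV W y :> - Mv y / (2 * (y * sqrt y) * (1 - y))" if y: "0 < y" "y < 1" for y
  proof -
    have s: "0 < sqrt y" "sqrt y < 1" using y by auto
    have "DERIV (\<lambda>y. prof b (sqrt y)) y :> - mom b (sqrt y) / ((sqrt y)^2 * (1 - (sqrt y)^2)) * (inverse (sqrt y) / 2)"
      by (rule DERIV_chain2[OF prof_deriv[OF s] DERIV_real_sqrt]) (use y in auto)
    also have "- mom b (sqrt y) / ((sqrt y)^2 * (1 - (sqrt y)^2)) * (inverse (sqrt y) / 2) = - Mv y / (2 * (y * sqrt y) * (1 - y))"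
      using s y by (simp add: Mv_def field_simps)
    finally show ?thesis
      by (rule has_field_derivative_transform_within_open[of _ _ _ "{0<..<1}"]) (use y in \<open>auto simp: W_def\<close>)
  qed
  \<comment> \<open>The momentum is \<open>lam / 2\<close> times the integral of
    \<open>sqrt \<eta> * h \<eta>\<close>, taken from 0 or, by regularity, negatively from 1.
    Substituting \<open>\<eta> = s^2 * y\<close> splits off the factor \<open>y * sqrt y\<close>,
    substituting \<open>\<eta> = 1 - s + s * y\<close> the factor \<open>1 - y\<close>.\<close>
  define A where "A y = integral {0..1} (\<lambda>s. s^2 * h (0 + s^2 * y))" for y
  define B where "B y = integral {0..1} (\<lambda>s. 1 * (sqrt (1 - s + s * y) * h (1 - s + s * y)))" for y
  have A: "lam * A y = Mv y / (y * sqrt y)" if y: "0 < y" "y < 1" for y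
  proof -
    have "((\<lambda>s. lam * (s^2 * h (0 + s^2 * y))) has_integral Mv (y * 1^2) / (y * sqrt y) - Mv (y * 0^2) / (y * sqrt y)) {0..1}"
    proof (rule fundamental_theorem_of_calculus_interior)
      have "y * s^2 \<in> {0..1}" if "s \<in> {0..1}" for s
        using y that mult_mono[of y 1 "s^2" 1] by (auto simp: power_le_one)
      then show "continuous_on {0..1} (\<lambda>s. Mv (y * s^2) / (y * sqrt y))"
        using y by (intro continuous_intros continuous_on_compose2[OF Mc]) auto
      fix s :: real assume "s \<in> {0<..<1}"
      then have s: "0 < s" "s < 1" by auto
      have "s^2 < 1" using s by (simp add: power_less_one_iff)
      then have ys: "0 < y * s^2" "y * s^2 < 1" using s y mult_strict_mono[of y 1 "s^2" 1] by auto
      have "DERIV (\<lambda>s. Mv (y * s^2)) s :> lam / 2 * sqrt (y * s^2) * h (y * s^2) * (y * (2 * s))"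
        by (rule DERIV_chain2[where f = Mv and g = "\<lambda>s. y * s^2" and x = s, OF dM[OF ys]]) (auto intro!: derivative_eq_intros)
      moreover have "lam / 2 * sqrt (y * s^2) * h (y * s^2) * (y * (2 * s)) / (y * sqrt y) = lam * (s^2 * h (0 + s^2 * y))"
      proof -
        have "sqrt (y * s^2) = sqrt y * s" using s by (simp add: real_sqrt_mult)
        moreover have "lam / 2 * (t * s) * k * (y * (2 * s)) / (y * t) = lam * (s * s * k)" if "0 < t" for t k
          using that y by (simp add: field_simps)
        ultimately show ?thesis using y by (simp add: power2_eq_square mult.commute)
      qed
      ultimately have "DERIV (\<lambda>s. Mv (y * s^2) / (y * sqrt y)) s :> lam * (s^2 * h (0 + s^2 * y))"
        using DERIV_cdivide[of "\<lambda>s. Mv (y * s^2)" _ s UNIV "y * sqrt y"] by metis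
      then show "((\<lambda>s. Mv (y * s^2) / (y * sqrt y)) has_vector_derivative lam * (s^2 * h (0 + s^2 * y))) (at s)"
        by (simp add: has_real_derivative_iff_has_vector_derivative)
    qed simp
    moreover have "Mv 0 = 0" by (simp add: Mv_def mom_start)
    ultimately have "((\<lambda>s. lam * (s^2 * h (0 + s^2 * y))) has_integral Mv y / (y * sqrt y)) {0..1}"
      by simp
    then have "integral {0..1} (\<lambda>s. lam * (s^2 * h (0 + s^2 * y))) = Mv y / (y * sqrt y)"
      by (rule integral_unique)
    then show ?thesis by (simp add: A_def)
  qed
  have B: "lam / 2 * (1 - y) * B y = - Mv y" if y: "0 < y" "y < 1" for y
  proof -
    let ?k = "\<lambda>s. 1 * (sqrt (1 - s + s * y) * h (1 - s + s * y))"
    have "((\<lambda>s. lam / 2 * (1 - y) * - ?k s) has_integral Mv (1 - 1 + 1 * y) - Mv (1 - 0 + 0 * y)) {0..1}"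
    proof (rule fundamental_theorem_of_calculus_interior)
      have e: "1 - s + s * y = 1 - s * (1 - y)" for s by (simp add: algebra_simps)
      have "s * (1 - y) \<le> 1 * 1" if "s \<in> {0..1}" for s
        using y that by (intro mult_mono) auto
      then have "1 - s + s * y \<in> {0..1}" if "s \<in> {0..1}" for s
        unfolding e using y that by auto
      then show "continuous_on {0..1} (\<lambda>s. Mv (1 - s + s * y))"
        by (intro continuous_intros continuous_on_compose2[OF Mc]) auto
      fix s :: real assume "s \<in> {0<..<1}"
      then have s: "0 < s" "s < 1" by auto
      have "s * (1 - y) < 1 * 1" using s y by (intro mult_strict_mono) auto
      then have ys: "0 < 1 - s + s * y" "1 - s + s * y < 1" unfolding e using s y by auto
      have "DERIV (\<lambda>s. Mv (1 - s + s * y)) s :> lam / 2 * sqrt (1 - s + s * y) * h (1 - s + s * y) * (- 1 + y)"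
        by (rule DERIV_chain2[where f = Mv and g = "\<lambda>s. 1 - s + s * y" and x = s, OF dM[OF ys]]) (auto intro!: derivative_eq_intros)
      also have "lam / 2 * sqrt (1 - s + s * y) * h (1 - s + s * y) * (- 1 + y) = lam / 2 * (1 - y) * - ?k s"
      proof -
        have "lam / 2 * p * k * (- 1 + y) = lam / 2 * (1 - y) * - (1 * (p * k))" for p k
          by (simp add: field_simps)
        then show ?thesis .
      qed
      finally show "((\<lambda>s. Mv (1 - s + s * y)) has_vector_derivative lam / 2 * (1 - y) * - ?k s) (at s)"
        by (simp add: has_real_derivative_iff_has_vector_derivative)
    qed simp
    then have "integral {0..1} (\<lambda>s. lam / 2 * (1 - y) * - ?k s)
        = Mv (1 - 1 + 1 * y) - Mv (1 - 0 + 0 * y)"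
      by (rule integral_unique)
    also have "\<dots> = Mv y" by (simp add: Mv_def[of 1])
    finally have "lam / 2 * (1 - y) * integral {0..1} (\<lambda>s. - ?k s) = Mv y"
      by (subst (asm) integral_mult_right)
    then show ?thesis unfolding B_def integral_neg by simp
  qed
  \<comment> \<open>Both are the derivative of \<open>W\<close>: in \<open>U1\<close> the
    denominator vanishes only at 1, in \<open>U2\<close> only at 0.\<close>
  define U1 where "U1 y = - (lam * A y) / (2 * (1 - y))" for y
  define U2 where "U2 y = lam / 4 * B y / (y * sqrt y)" for y
  define W1 where "W1 y = (if y < 1 then U1 y else U2 1)" for y
  have U12: "U1 y = U2 y" if y: "0 < y" "y < 1" for y
  proof -
    have p: "0 < y * sqrt y" using y by simp
    have Mv: "Mv y = - (lam / 2 * (1 - y) * B y)" using B[OF y] by simp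
    show ?thesis unfolding U1_def U2_def A[OF y] Mv using p y by (simp add: field_simps)
  qed
  have W1_1: "W1 y = U1 y" if "y \<in> {0..<1}" for y using that by (simp add: W1_def)
  have W1_2: "W1 y = U2 y" if "y \<in> {1/2..1}" for y using that U12 by (auto simp: W1_def)
  have maps1: "0 + s^2 * y \<in> {0..1}" if "y \<in> {0..<1}" "s \<in> {0..1}" for s y :: real
    using that mult_mono[of "s^2" 1 y 1] by (auto simp: power_le_one)
  have maps2: "1 - s + s * y \<in> {1/2..1}" if "y \<in> {1/2..1}" "s \<in> {0..1}" for s y :: real
  proof -
    have "s * (1 - y) \<le> 1 * (1/2)" using that by (intro mult_mono) auto
    moreover have "0 \<le> s * (1 - y)" using that by auto
    ultimately show ?thesis by (auto simp: algebra_simps)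
  qed
  have half: "{1/2..1} \<subseteq> {0..1::real}" by auto
  have Ac: "continuous_on {0..<1} A"
    unfolding A_def by (rule param_integral_continuous[OF hc _ _ _ maps1]) (auto intro!: continuous_intros)
  have Bc: "continuous_on {1/2..1} B"
    unfolding B_def
    by (rule param_integral_continuous[of "{1/2..1}" "\<lambda>\<eta>. sqrt \<eta> * h \<eta>" "\<lambda>_. 1" "\<lambda>s. 1 - s" "\<lambda>s. s" "{1/2..1}", OF _ _ _ _ maps2])
      (auto intro!: continuous_intros continuous_on_subset[OF hc half])
  have U1c: "continuous_on {0..<1} U1" unfolding U1_def by (intro continuous_intros Ac) auto
  have U2c: "continuous_on {1/2..1} U2" unfolding U2_def by (intro continuous_intros Bc) auto
  have W1c: "continuous_on {0..1} W1"
  proof (rule continuous_on_glue)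
    show "continuous_on {0..<1} W1" by (rule continuous_on_eq[OF U1c]) (simp add: W1_1)
    show "continuous_on {1/2..1} W1" by (rule continuous_on_eq[OF U2c]) (simp add: W1_2)
  qed
  have dW1: "(W has_real_derivative W1 y) (at y within {0..1})" if "y \<in> {0..1}" for y
  proof (rule deriv_extends_to_Icc[OF Wc W1c _ that])
    fix x :: real assume x: "0 < x" "x < 1"
    have "W1 x = - Mv x / (2 * (x * sqrt x) * (1 - x))"
      using x unfolding W1_def U1_def A[OF x] by (simp add: field_simps)
    then show "DERIV W x :> W1 x" using dW[OF x] by simp
  qed
  \<comment> \<open>Bootstrap: now that \<open>W\<close> is known to be continuously differentiable,
    so are \<open>h\<close>, the averages \<open>A\<close> and \<open>B\<close>, and thereby
    \<open>W1\<close>.\<close>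
  define h' where "h' y = f' (W y) * W1 y" for y
  have dh: "(h has_real_derivative h' y) (at y within {0..1})" if y: "y \<in> {0..1}" for y
    unfolding h_def h'_def by (rule DERIV_chain2[where f = f and g = W and x = y, OF f'(1)[OF WJ[OF y]] dW1[OF y]])
  have h'c: "continuous_on {0..1} h'"
    unfolding h'_def by (intro continuous_intros W1c continuous_on_compose2[OF f'(2) Wc]) (use WJ in auto)
  define A' where "A' y = integral {0..1} (\<lambda>s. (s^2 * s^2) * h' (0 + s^2 * y))" for y
  have dA: "(A has_real_derivative A' y) (at y within {0..<1})" if y: "y \<in> {0..<1}" for y
    unfolding A_def A'_def
    by (rule param_integral_deriv[OF _ dh h'c _ _ _ maps1 y]) (auto intro!: continuous_intros)
  have A'c: "continuous_on {0..<1} A'"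
    unfolding A'_def by (rule param_integral_continuous[OF h'c _ _ _ maps1]) (auto intro!: continuous_intros)
  define m' where "m' \<eta> = inverse (sqrt \<eta>) / 2 * h \<eta> + h' \<eta> * sqrt \<eta>" for \<eta>
  have dm: "((\<lambda>\<eta>. sqrt \<eta> * h \<eta>) has_real_derivative m' \<eta>) (at \<eta> within {1/2..1})" if "\<eta> \<in> {1/2..1}" for \<eta>
  proof -
    have "(sqrt has_real_derivative inverse (sqrt \<eta>) / 2) (at \<eta> within {1/2..1})"
      by (rule has_field_derivative_at_within[OF DERIV_real_sqrt]) (use that in auto)
    moreover have "(h has_real_derivative h' \<eta>) (at \<eta> within {1/2..1})"
      by (rule DERIV_subset[OF dh half]) (use that in auto)
    ultimately show ?thesis unfolding m'_def by (rule DERIV_mult)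
  qed
  have m'c: "continuous_on {1/2..1} m'"
    unfolding m'_def
    by (intro continuous_intros continuous_on_subset[OF hc half] continuous_on_subset[OF h'c half]) auto
  define B' where "B' y = integral {0..1} (\<lambda>s. (1 * s) * m' (1 - s + s * y))" for y
  have dB: "(B has_real_derivative B' y) (at y within {1/2..1})" if y: "y \<in> {1/2..1}" for y
    unfolding B_def B'_def
    by (rule param_integral_deriv[of "{1/2..1}" "{1/2..1}" "\<lambda>\<eta>. sqrt \<eta> * h \<eta>" m' "\<lambda>_. 1" "\<lambda>s. 1 - s" "\<lambda>s. s", OF _ dm m'c _ _ _ maps2 y])
      (auto intro!: continuous_intros)
  have B'c: "continuous_on {1/2..1} B'"
    unfolding B'_def
    by (rule param_integral_continuous[of "{1/2..1}" m' "\<lambda>s. 1 * s" "\<lambda>s. 1 - s" "\<lambda>s. s" "{1/2..1}", OF m'c _ _ _ maps2])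
      (auto intro!: continuous_intros)
  define V1 where "V1 y = (- (lam * A' y) * (2 * (1 - y)) - - (lam * A y) * (- 2)) / (2 * (1 - y) * (2 * (1 - y)))" for y
  define V2 where "V2 y = (lam / 4 * B' y * (y * sqrt y) - lam / 4 * B y * (1 * sqrt y + inverse (sqrt y) / 2 * y)) / (y * sqrt y * (y * sqrt y))" for y
  obtain W2 where W2: "continuous_on {0..1} W2"
    "\<And>y. y \<in> {0..1} \<Longrightarrow> (W1 has_real_derivative W2 y) (at y within {0..1})"
  proof (rule deriv_glue[of W1 V1 V2])
    fix y :: real assume y: "y \<in> {0..<1}"
    have "((\<lambda>y. 2 * (1 - y)) has_real_derivative - 2) (at y within {0..<1})"
      by (auto intro!: derivative_eq_intros)
    then have "(U1 has_real_derivative V1 y) (at y within {0..<1})"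
      unfolding U1_def V1_def using y by (intro DERIV_divide DERIV_minus DERIV_cmult dA) auto
    then show "(W1 has_real_derivative V1 y) (at y within {0..<1})"
      by (rule has_field_derivative_transform_within[of _ _ _ _ 1]) (use y W1_1 in auto)
  next
    show "continuous_on {0..<1} V1" unfolding V1_def by (intro continuous_intros Ac A'c) auto
    show "continuous_on {1/2..1} V2" unfolding V2_def by (intro continuous_intros Bc B'c) auto
  next
    fix y :: real assume y: "y \<in> {1/2..1}"
    have "((\<lambda>y. y * sqrt y) has_real_derivative 1 * sqrt y + inverse (sqrt y) / 2 * y) (at y within {1/2..1})"
      using y by (intro DERIV_mult DERIV_ident has_field_derivative_at_within[OF DERIV_real_sqrt]) auto
    then have "(U2 has_real_derivative V2 y) (at y within {1/2..1})"
      unfolding U2_def V2_def using y by (intro DERIV_divide DERIV_cmult dB) auto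
    then show "(W1 has_real_derivative V2 y) (at y within {1/2..1})"
      by (rule has_field_derivative_transform_within[of _ _ _ _ 1]) (use y W1_2 in auto)
  qed blast
  let ?ode = "\<lambda>y. 4 * y * (1 - y) * W2 y + (6 - 10 * y) * W1 y + lam * f (W y)"
  \<comment> \<open>Both sides of \<open>y * sqrt y * (1 - y) * W1 y = - Mv y / 2\<close> are
    differentiated. At 0 and 1 the equation follows by continuity.\<close>
  have ode: "?ode y = 0" if y: "y \<in> {0<..<1}" for y
  proof -
    have y0: "0 < y" "y < 1" using y by auto
    define s where "s = sqrt y"
    have s: "0 < s" "y = s * s" using y0 by (auto simp: s_def)
    have at_y: "at y within {0..1} = at y" by (rule at_within_Icc_at) (use y0 in auto)
    have "DERIV (\<lambda>y. y * sqrt y * (1 - y)) y :> (1 * sqrt y + inverse (sqrt y) / 2 * y) * (1 - y) + (- 1) * (y * sqrt y)"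
      using y0 by (intro DERIV_mult DERIV_ident DERIV_real_sqrt) (auto intro!: derivative_eq_intros)
    moreover have "DERIV W1 y :> W2 y" using W2(2)[of y] y0 at_y by simp
    ultimately have "DERIV (\<lambda>y. y * sqrt y * (1 - y) * W1 y) y :> ((1 * sqrt y + inverse (sqrt y) / 2 * y) * (1 - y) + (- 1) * (y * sqrt y)) * W1 y + W2 y * (y * sqrt y * (1 - y))"
      by (rule DERIV_mult)
    moreover have "DERIV (\<lambda>y. y * sqrt y * (1 - y) * W1 y) y :> - (lam / 2 * sqrt y * h y) / 2"
    proof (rule has_field_derivative_transform_within_open[of _ _ _ "{0<..<1}"])
      show "DERIV (\<lambda>y. - Mv y / 2) y :> - (lam / 2 * sqrt y * h y) / 2"
        by (intro DERIV_cdivide DERIV_minus dM y0)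
      fix x :: real assume "x \<in> {0<..<1}"
      then have x: "0 < x" "x < 1" by auto
      have p: "0 < x * sqrt x" using x by simp
      show "- Mv x / 2 = x * sqrt x * (1 - x) * W1 x"
        using x p unfolding W1_def U1_def A[OF x] by (simp add: field_simps)
    qed (use y in auto)
    ultimately have "((1 * sqrt y + inverse (sqrt y) / 2 * y) * (1 - y) + (- 1) * (y * sqrt y)) * W1 y + W2 y * (y * sqrt y * (1 - y))
        = - (lam / 2 * sqrt y * h y) / 2"
      by (rule DERIV_unique)
    then have "s * ?ode y = 0"
      unfolding s_def[symmetric] h_def using s(1) by (simp add: s(2) field_simps)
    then show ?thesis using s by simp
  qed
  have odec: "continuous_on (closure {0<..<1}) ?ode"
    using hc unfolding h_def by (auto intro!: continuous_intros W2 W1c)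
  show thesis
  proof (rule that[of W W1 W2])
    show "W (x^2) = prof b x" if "0 \<le> x" "x < 1" for x
      using that by (simp add: W_def power_less_one_iff)
    show "?ode y = 0" if "y \<in> {0..1}" for y
      using continuous_constant_on_closure[OF odec ode] that by simp
  qed (use WJ dW1 W2 in auto)
qed

end

section \<open>Radial functions on the sphere\<close>

text \<open>Supplies the normalisation required by \<open>sphere_deriv\<close>: precomposition with
  a map that fixes the sphere changes the derivative on the normal line only.\<close>

lemma sphere_has_derivative_tangential:
  fixes \<phi> :: "'a::euclidean_space \<Rightarrow> 'b::real_normed_vector"
  assumes p: "p \<in> sphere 0 1" and D: "(\<phi> has_derivative D) (at p within sphere 0 1)"
  shows "(\<phi> has_derivative (\<lambda>v. D (sphere_tangent_proj p v))) (at p within sphere 0 1)"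
proof -
  let ?S = "sphere (0::'a) 1"
  \<comment> \<open>the identity on the sphere, with tangential derivative at \<open>p\<close>\<close>
  define R where "R q = q - ((q \<bullet> q - 1) / 2) *\<^sub>R p" for q
  have R: "R q = q" if "q \<in> ?S" for q using that by (simp add: R_def norm_eq_1)
  have "(R has_derivative sphere_tangent_proj p) (at p within ?S)"
    unfolding R_def sphere_tangent_proj_def[abs_def]
    by (auto intro!: derivative_eq_intros simp: inner_commute)
  moreover have "R ` ?S = ?S" using R by force
  ultimately have "((\<lambda>q. \<phi> (R q)) has_derivative (\<lambda>v. D (sphere_tangent_proj p v))) (at p within ?S)"
    using has_derivative_in_compose[of R "sphere_tangent_proj p" p ?S \<phi> D] D R[OF p] by simp
  then show ?thesis
    by (rule has_derivative_transform_within[of _ _ _ _ 1]) (use p R in auto)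
qed

lemma sphere_deriv_tangential:
  fixes \<phi> :: "'a::euclidean_space \<Rightarrow> 'b::real_normed_vector"
  assumes p: "p \<in> sphere 0 1" and D: "(\<phi> has_derivative D) (at p within sphere 0 1)"
  shows "sphere_deriv \<phi> p = (\<lambda>v. D (sphere_tangent_proj p v))"
proof (rule sphere_deriv_eqI[OF p sphere_has_derivative_tangential[OF p D]])
  have "sphere_tangent_proj p p = 0" using p by (simp add: sphere_tangent_proj_def norm_eq_1)
  then show "D (sphere_tangent_proj p p) = 0"
    using has_derivative_linear[OF D] by (simp add: linear_0)
qed

lemma sphere_grad_eqI:
  assumes w: "w \<in> sphere_tangent p" and d: "\<And>v. v \<in> sphere_tangent p \<Longrightarrow> sphere_deriv u p v = w \<bullet> v"
  shows "sphere_grad u p = w"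
  unfolding sphere_grad_def
proof (rule the_equality)
  show "w \<in> sphere_tangent p \<and> (\<forall>v\<in>sphere_tangent p. sphere_deriv u p v = w \<bullet> v)" using assms by blast
  fix w' assume w': "w' \<in> sphere_tangent p \<and> (\<forall>v\<in>sphere_tangent p. sphere_deriv u p v = w' \<bullet> v)"
  then have "w' - w \<in> sphere_tangent p" using w by (simp add: sphere_tangent_def inner_diff_right)
  then have "w' \<bullet> (w' - w) = w \<bullet> (w' - w)" using w' d by metis
  then have "(w' - w) \<bullet> (w' - w) = 0" by (simp add: inner_diff_left)
  then show "w' = w" by simp
qed

lemma sphere_tangent_proj_adjoint: "sphere_tangent_proj p a \<bullet> b = a \<bullet> sphere_tangent_proj p b"
  by (simp add: sphere_tangent_proj_def inner_diff_left inner_diff_right inner_commute)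

text \<open>The square of the radius is used because it is smooth across \<open>x = 0\<close>,
  unlike the radius itself.\<close>

definition radial_sq :: "R5 \<Rightarrow> real" where "radial_sq p = fst p \<bullet> fst p"

text \<open>Half of the spherical gradient of \<open>radial_sq\<close>, that is, the tangential part
  of \<open>(fst p, 0)\<close>.\<close>

definition radial_field :: "R5 \<Rightarrow> R5" where "radial_field p = (fst p, 0) - radial_sq p *\<^sub>R p"

lemma radial_sq_range: "p \<in> S4 \<Longrightarrow> radial_sq p \<in> {0..1}"
  by (auto simp: radial_sq_def norm_eq_1 inner_prod_def) (smt (verit) inner_ge_zero)

lemma radial_field_tangent: "p \<in> S4 \<Longrightarrow> p \<bullet> radial_field p = 0"
  by (simp add: radial_field_def inner_diff_right norm_eq_1) (simp add: radial_sq_def inner_prod_def)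

lemma radial_field_norm: "p \<in> S4 \<Longrightarrow> radial_field p \<bullet> radial_field p = radial_sq p * (1 - radial_sq p)"
proof -
  assume p: "p \<in> S4"
  have "radial_field p \<bullet> radial_field p = radial_field p \<bullet> (fst p, 0) - radial_sq p * (radial_field p \<bullet> p)"
    by (subst (2) radial_field_def) (simp add: inner_diff_right)
  also have "radial_field p \<bullet> p = 0" using radial_field_tangent[OF p] by (simp add: inner_commute)
  also have "radial_field p \<bullet> (fst p, 0) = radial_sq p - radial_sq p * radial_sq p"
    by (simp add: radial_field_def inner_diff_left) (simp add: radial_sq_def inner_prod_def)
  finally show ?thesis by (simp add: algebra_simps)
qed

lemma sum_Basis_inner_mult: "(\<Sum>b\<in>Basis. (a \<bullet> b) * (c \<bullet> b)) = a \<bullet> (c :: 'a::euclidean_space)"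
  by (rule euclidean_inner[symmetric])

text \<open>The trace of the projection onto the first factor, which enters the divergence of
  \<open>radial_field\<close>.\<close>

lemma sum_Basis_fst_sq: "(\<Sum>b\<in>Basis. fst (b :: R5) \<bullet> fst b) = 3"
proof -
  have "(\<Sum>b\<in>Basis. fst (b :: R5) \<bullet> fst b)
      = (\<Sum>b\<in>(\<lambda>u. (u, 0)) ` (Basis :: (real^3) set). fst (b :: R5) \<bullet> fst b)
        + (\<Sum>b\<in>(\<lambda>v. (0, v)) ` (Basis :: (real^2) set). fst (b :: R5) \<bullet> fst b)"
    unfolding Basis_prod_def by (rule sum.union_disjoint) auto
  also have "(\<Sum>b\<in>(\<lambda>u. (u, 0)) ` (Basis :: (real^3) set). fst (b :: R5) \<bullet> fst b) = (\<Sum>u\<in>(Basis :: (real^3) set). u \<bullet> u)"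
    by (subst sum.reindex) (auto simp: inj_on_def)
  also have "\<dots> = 3" by (simp add: inner_same_Basis)
  finally show ?thesis by (simp add: image_iff sum.neutral)
qed

lemma radial_sq_has_derivative:
  "(radial_sq has_derivative (\<lambda>v. 2 * (fst p \<bullet> fst v))) (at p within S)"
  unfolding radial_sq_def by (auto intro!: derivative_eq_intros simp: inner_commute)

lemma fst_inner_proj:
  "fst p \<bullet> fst (sphere_tangent_proj p v) = radial_field p \<bullet> v" for p v :: R5
  by (simp add: sphere_tangent_proj_def radial_field_def inner_diff_left inner_diff_right)
    (simp add: radial_sq_def inner_prod_def)

text \<open>One-sided derivatives at 0 and 1 suffice, because \<open>radial_sq\<close> maps the
  sphere into \<open>{0..1}\<close>.\<close>

locale C2_profile =
  fixes W W1 W2 :: "real \<Rightarrow> real"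
  assumes W_deriv: "\<And>y. y \<in> {0..1} \<Longrightarrow> (W has_real_derivative W1 y) (at y within {0..1})"
    and W1_deriv: "\<And>y. y \<in> {0..1} \<Longrightarrow> (W1 has_real_derivative W2 y) (at y within {0..1})"
    and W2_cont: "continuous_on {0..1} W2"
begin

definition lift :: "R5 \<Rightarrow> real" where "lift = restrict (\<lambda>p. W (radial_sq p)) S4"

lemma radial_compose_has_derivative:
  assumes p: "p \<in> S4" and h: "(h has_real_derivative d) (at (radial_sq p) within {0..1})"
  shows "((\<lambda>q. h (radial_sq q)) has_derivative (\<lambda>v. d * (2 * (fst p \<bullet> fst v)))) (at p within S4)"
proof -
  have "radial_sq ` S4 \<subseteq> {0..1}" using radial_sq_range by blast
  then have "(h has_derivative (*) d) (at (radial_sq p) within radial_sq ` S4)"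
    using h has_derivative_subset unfolding has_field_derivative_def by blast
  then show ?thesis by (rule has_derivative_in_compose[OF radial_sq_has_derivative])
qed

lemma lift_has_derivative:
  assumes p: "p \<in> S4"
  shows "(lift has_derivative (\<lambda>v. W1 (radial_sq p) * (2 * (fst p \<bullet> fst v)))) (at p within S4)"
  by (rule has_derivative_transform_within[of _ _ _ _ 1,
      OF radial_compose_has_derivative[OF p W_deriv[OF radial_sq_range[OF p]]]])
    (use p in \<open>auto simp: lift_def\<close>)

lemma lift_sphere_deriv:
  assumes p: "p \<in> S4"
  shows "sphere_deriv lift p v = 2 * W1 (radial_sq p) * (radial_field p \<bullet> v)"
  unfolding sphere_deriv_tangential[OF p lift_has_derivative[OF p]] fst_inner_proj by simp

lemma lift_grad:
  assumes p: "p \<in> S4"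
  shows "sphere_grad lift p = (2 * W1 (radial_sq p)) *\<^sub>R radial_field p"
  by (rule sphere_grad_eqI)
    (use p in \<open>simp_all add: sphere_tangent_def lift_sphere_deriv radial_field_tangent\<close>)

text \<open>The product rule applied to the gradient formula of \<open>lift_grad\<close>. Normal
  components are kept; the covariant derivative projects them away.\<close>

definition hess :: "R5 \<Rightarrow> R5 \<Rightarrow> R5" where
  "hess p v = (2 * W1 (radial_sq p)) *\<^sub>R ((fst v, 0) - (radial_sq p *\<^sub>R v + (2 * (fst p \<bullet> fst v)) *\<^sub>R p))
     + (2 * (W2 (radial_sq p) * (2 * (fst p \<bullet> fst v)))) *\<^sub>R radial_field p"

lemma grad_has_derivative:
  assumes p: "p \<in> S4"
  shows "(sphere_grad lift has_derivative hess p) (at p within S4)"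
proof -
  have dN: "(radial_field has_derivative (\<lambda>v. (fst v, 0) - (radial_sq p *\<^sub>R v + (2 * (fst p \<bullet> fst v)) *\<^sub>R p))) (at p within S4)"
    unfolding radial_field_def
    by (intro has_derivative_diff has_derivative_Pair has_derivative_fst has_derivative_ident has_derivative_const
        has_derivative_scaleR radial_sq_has_derivative)
  have "((\<lambda>q. (2 * W1 (radial_sq q)) *\<^sub>R radial_field q) has_derivative hess p) (at p within S4)"
    unfolding hess_def
    by (intro has_derivative_scaleR dN has_derivative_mult_right
        radial_compose_has_derivative[OF p W1_deriv[OF radial_sq_range[OF p]]])
  then show ?thesis
    by (rule has_derivative_transform_within[of _ _ _ _ 1]) (use p lift_grad in auto)
qed

lemma lift_C2: "sphere_C2 lift"
proof -
  have yc: "continuous_on S4 radial_sq" unfolding radial_sq_def by (intro continuous_intros)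
  have comp: "continuous_on S4 (\<lambda>p. h (radial_sq p))" if "continuous_on {0..1} h" for h :: "real \<Rightarrow> real"
    by (rule continuous_on_compose2[OF that yc]) (use radial_sq_range in blast)
  have W1c: "continuous_on {0..1} W1" using W1_deriv DERIV_continuous_on by blast
  have Nc: "continuous_on S4 radial_field" unfolding radial_field_def by (intro continuous_intros yc)
  have "sphere_C1 lift"
    unfolding sphere_C1_def
  proof (intro conjI ballI allI)
    show "lift differentiable at p within S4" if "p \<in> S4" for p
      using lift_has_derivative[OF that] by (auto simp: differentiable_def)
    fix v
    have "continuous_on S4 (\<lambda>p. 2 * W1 (radial_sq p) * (radial_field p \<bullet> v))"
      by (intro continuous_intros comp W1c Nc)
    then show "continuous_on S4 (\<lambda>p. sphere_deriv lift p v)"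
      by (rule continuous_on_eq) (simp add: lift_sphere_deriv)
  qed
  moreover have "sphere_C1 (sphere_grad lift)"
    unfolding sphere_C1_def
  proof (intro conjI ballI allI)
    show "sphere_grad lift differentiable at p within S4" if "p \<in> S4" for p
      using grad_has_derivative[OF that] by (auto simp: differentiable_def)
    fix v
    have "continuous_on S4 (\<lambda>p. hess p (sphere_tangent_proj p v))"
      unfolding hess_def sphere_tangent_proj_def
      by (intro continuous_intros comp W1c W2_cont Nc yc)
    then show "continuous_on S4 (\<lambda>p. sphere_deriv (sphere_grad lift) p v)"
      by (rule continuous_on_eq) (simp add: sphere_deriv_tangential[OF _ grad_has_derivative])
  qed
  ultimately show ?thesis by (simp add: sphere_C2_def)
qed

text \<open>The second derivative is multiplied by \<open>4\<close> times the squared length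
  \<open>y * (1 - y)\<close> of \<open>radial_field\<close>. The tangential trace of the derivative
  of \<open>radial_field\<close> is \<open>3 - 2 * y + y - 4 * y\<close>: the trace 3 of the
  projection, corrected for the normal line, minus \<open>y\<close> times the dimension 4.\<close>

lemma lift_laplacian:
  assumes p: "p \<in> S4"
  defines "y \<equiv> radial_sq p"
  shows "sphere_laplacian lift p = 4 * y * (1 - y) * W2 y + (6 - 10 * y) * W1 y"
proof -
  define N where "N = radial_field p"
  have pp: "p \<bullet> p = 1" using p by (simp add: norm_eq_1)
  have py: "p \<bullet> (fst p, 0) = y" by (simp add: y_def radial_sq_def inner_prod_def)
  \<comment> \<open>The projection is symmetric, so it can be moved to \<open>b\<close>; each
    summand becomes the quadratic form of \<open>hess p\<close> at the tangential part of
    \<open>b\<close>.\<close>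
  have summand: "sphere_cov_deriv (sphere_grad lift) p b \<bullet> b
      = 4 * W2 y * ((N \<bullet> b) * (N \<bullet> b)) + 2 * W1 y * (fst b \<bullet> fst b - 2 * ((p \<bullet> b) * ((fst p, 0) \<bullet> b))
        + y * ((p \<bullet> b) * (p \<bullet> b)) - y * (b \<bullet> b - (p \<bullet> b) * (p \<bullet> b)))" for b
  proof -
    define t where "t = sphere_tangent_proj p b"
    have pt: "p \<bullet> t = 0" by (simp add: t_def sphere_tangent_proj_def inner_diff_right pp)
    have Nt: "N \<bullet> t = N \<bullet> b"
      using radial_field_tangent[OF p] by (simp add: N_def t_def sphere_tangent_proj_def inner_diff_right inner_commute)
    have ft: "fst p \<bullet> fst t = N \<bullet> b" unfolding t_def N_def by (rule fst_inner_proj)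
    have t2: "t \<bullet> t = b \<bullet> b - (p \<bullet> b) * (p \<bullet> b)"
      by (simp add: t_def sphere_tangent_proj_def inner_diff_left inner_diff_right pp inner_commute)
    have ft2: "(fst t, 0) \<bullet> t = fst b \<bullet> fst b - 2 * ((p \<bullet> b) * ((fst p, 0) \<bullet> b)) + y * ((p \<bullet> b) * (p \<bullet> b))"
    proof -
      have ft': "fst t = fst b - (p \<bullet> b) *\<^sub>R fst p" by (simp add: t_def sphere_tangent_proj_def)
      have "(fst t, 0) \<bullet> t = fst t \<bullet> fst t" by (simp add: inner_prod_def)
      also have "\<dots> = (fst b - (p \<bullet> b) *\<^sub>R fst p) \<bullet> (fst b - (p \<bullet> b) *\<^sub>R fst p)" unfolding ft' ..
      also have "(fst b - (p \<bullet> b) *\<^sub>R fst p) \<bullet> (fst b - (p \<bullet> b) *\<^sub>R fst p)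
          = fst b \<bullet> fst b - 2 * ((p \<bullet> b) * (fst p \<bullet> fst b)) + y * ((p \<bullet> b) * (p \<bullet> b))"
        by (simp add: y_def radial_sq_def inner_diff_left inner_diff_right inner_commute algebra_simps)
      also have "fst p \<bullet> fst b = (fst p, 0) \<bullet> b" by (simp add: inner_prod_def)
      finally show ?thesis .
    qed
    have "sphere_cov_deriv (sphere_grad lift) p b \<bullet> b = hess p t \<bullet> t"
      unfolding sphere_cov_deriv_def sphere_deriv_tangential[OF p grad_has_derivative[OF p]]
        sphere_tangent_proj_adjoint t_def ..
    also have "\<dots> = 2 * W1 y * ((fst t, 0) \<bullet> t - y * (t \<bullet> t)) + 4 * W2 y * ((N \<bullet> b) * (N \<bullet> b))"
      unfolding hess_def ft y_def[symmetric] N_def[symmetric]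
      by (simp add: inner_diff_left inner_add_left pt Nt)
    finally show ?thesis unfolding t2 ft2 by (simp add: algebra_simps)
  qed
  have dim: "(\<Sum>b\<in>Basis. b \<bullet> (b :: R5)) = 5" by simp
  have "sphere_laplacian lift p = 4 * W2 y * (N \<bullet> N) + 2 * W1 y * (3 - 2 * y + y * 1 - y * (5 - 1))"
    unfolding sphere_laplacian_def sphere_div_def summand
    by (simp only: sum.distrib sum_subtractf sum_distrib_left[symmetric] sum_Basis_inner_mult sum_Basis_fst_sq
        pp py dim)
  also have "N \<bullet> N = y * (1 - y)" unfolding N_def y_def by (rule radial_field_norm[OF p])
  finally show ?thesis by (simp add: algebra_simps)
qed

lemma lift_invariant: "O3xO2_invariant lift"
  unfolding O3xO2_invariant_def
proof (intro allI impI)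
  fix A :: "real^3^3" and B :: "real^2^2" and x y
  assume A: "orthogonal_matrix A" and B: "orthogonal_matrix B" and p: "(x, y) \<in> S4"
  have nA: "norm (A *v x) = norm x"
    using A by (intro orthogonal_transformation_norm)
      (simp add: orthogonal_transformation_matrix matrix_vector_mul_linear matrix_of_matrix_vector_mul)
  have nB: "norm (B *v y) = norm y"
    using B by (intro orthogonal_transformation_norm)
      (simp add: orthogonal_transformation_matrix matrix_vector_mul_linear matrix_of_matrix_vector_mul)
  have "(A *v x, B *v y) \<in> S4" using p nA nB by (simp add: norm_Pair)
  then show "lift (A *v x, B *v y) = lift (x, y)"
    using p nA by (simp add: lift_def radial_sq_def dot_square_norm)
qed

lemma lift_solution:
  assumes pos: "\<And>y. y \<in> {0..1} \<Longrightarrow> 0 < W y"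
    and ode: "\<And>y. y \<in> {0..1} \<Longrightarrow> 4 * y * (1 - y) * W2 y + (6 - 10 * y) * W1 y + l * (W y powr q - W y) = 0"
  shows "lift \<in> invariant_solutions q l"
  unfolding invariant_solutions_def
proof (intro CollectI conjI ballI lift_C2 lift_invariant)
  show "lift \<in> extensional S4" by (simp add: lift_def)
  fix p assume p: "p \<in> S4"
  have v: "lift p = W (radial_sq p)" using p by (simp add: lift_def)
  show "0 < lift p" unfolding v by (rule pos[OF radial_sq_range[OF p]])
  show "- sphere_laplacian lift p + l * lift p = l * lift p powr q"
    unfolding v lift_laplacian[OF p] using ode[OF radial_sq_range[OF p]] by (simp add: algebra_simps)
qed

end

section \<open>The truncated nonlinearity\<close>

lemma powr_le_self: "0 \<le> t \<Longrightarrow> t \<le> 1 \<Longrightarrow> 1 \<le> q \<Longrightarrow> t powr q \<le> (t::real)"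
  using powr_mono'[of 1 q t] by simp

lemma self_le_powr: "1 \<le> t \<Longrightarrow> 1 \<le> q \<Longrightarrow> t \<le> t powr (q::real)"
  using powr_mono[of 1 q t] by simp

lemma abs_powr_diff_le:
  fixes q M x y :: real
  assumes q: "1 < q" and xy: "0 \<le> x" "x \<le> y" "y \<le> M"
  shows "\<bar>(y powr q - y) - (x powr q - x)\<bar> \<le> (q * M powr (q - 1) + 1) * (y - x)"
proof (rule abs_diff_le_of_deriv_bound[of x y "\<lambda>t. t powr q - t", OF xy(2)])
  show "continuous_on {x..y} (\<lambda>t. t powr q - t)"
    using xy q by (intro continuous_intros continuous_on_powr') auto
  fix t assume t: "x < t" "t < y"
  show "DERIV (\<lambda>t. t powr q - t) t :> q * t powr (q - 1) - 1"
    using t xy by (auto intro!: derivative_eq_intros)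
  have "q * t powr (q - 1) \<le> q * M powr (q - 1)"
    using t xy q by (intro mult_left_mono powr_mono2) auto
  moreover have "0 \<le> q * t powr (q - 1)" using q by simp
  ultimately show "\<bar>q * t powr (q - 1) - 1\<bar> \<le> q * M powr (q - 1) + 1" by linarith
qed

lemma antiderivative_exists:
  fixes f :: "real \<Rightarrow> real"
  assumes "\<And>x. isCont f x"
  obtains F where "F 0 = 0" "\<And>t. DERIV F t :> f t"
proof -
  obtain F where F: "\<And>t. (F has_vector_derivative f t) (at t)"
    using einterval_antiderivative[of "-\<infinity>" "\<infinity>" f] assms by auto
  show thesis
  proof (rule that[of "\<lambda>t. F t - F 0"])
    show "DERIV (\<lambda>t. F t - F 0) t :> f t" for t
      using F[of t] unfolding has_real_derivative_iff_has_vector_derivative[symmetric]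
      by (auto intro!: derivative_eq_intros)
  qed simp
qed

text \<open>Clamping the argument to \<open>{0..M}\<close> makes the function bounded and globally
  Lipschitz. For negative arguments it vanishes, as \<open>0 powr q = 0\<close>, so nonpositive
  constants become solutions.\<close>

definition trunc_nonlin :: "real \<Rightarrow> real \<Rightarrow> real \<Rightarrow> real" where
  "trunc_nonlin q M t = max 0 (min t M) powr q - max 0 (min t M)"

lemma trunc_nonlin_nonpos: "t \<le> 0 \<Longrightarrow> trunc_nonlin q M t = 0"
  by (simp add: trunc_nonlin_def max_def min_def)

lemma trunc_nonlin_inside: "0 \<le> t \<Longrightarrow> t \<le> M \<Longrightarrow> trunc_nonlin q M t = t powr q - t"
  by (simp add: trunc_nonlin_def)

lemma trunc_nonlin_lipschitz:
  assumes "1 < q" "0 \<le> M"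
  shows "\<bar>trunc_nonlin q M x - trunc_nonlin q M y\<bar> \<le> (q * M powr (q - 1) + 1) * \<bar>x - y\<bar>"
proof -
  have L: "0 \<le> q * M powr (q - 1) + 1" using assms by simp
  define c where "c t = max 0 (min t M)" for t
  have c: "0 \<le> c t" "c t \<le> M" for t using assms by (auto simp: c_def)
  have "\<bar>trunc_nonlin q M x - trunc_nonlin q M y\<bar> \<le> (q * M powr (q - 1) + 1) * \<bar>c x - c y\<bar>"
    using abs_powr_diff_le[OF assms(1), of "c x" "c y" M] abs_powr_diff_le[OF assms(1), of "c y" "c x" M] c
    by (cases "c x \<le> c y") (auto simp: trunc_nonlin_def c_def[symmetric] abs_minus_commute)
  also have "\<dots> \<le> (q * M powr (q - 1) + 1) * \<bar>x - y\<bar>"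
    using L by (intro mult_left_mono) (auto simp: c_def max_def min_def)
  finally show ?thesis .
qed

lemma trunc_nonlin_bound:
  assumes "0 \<le> M" "0 \<le> q"
  shows "\<bar>trunc_nonlin q M t\<bar> \<le> M powr q + M"
proof -
  define c where "c = max 0 (min t M)"
  have c: "0 \<le> c" "c \<le> M" using assms by (auto simp: c_def)
  then have "c powr q \<le> M powr q" using assms by (intro powr_mono2) auto
  then show ?thesis using c by (simp add: trunc_nonlin_def c_def[symmetric] abs_le_iff)
      (smt (verit) powr_ge_zero)
qed

lemma trunc_nonlin_upper: "0 \<le> q \<Longrightarrow> trunc_nonlin q M t \<le> max 0 t powr q"
proof -
  assume q: "0 \<le> q"
  have "max 0 (min t M) powr q \<le> max 0 t powr q" using q by (intro powr_mono2) auto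
  then show ?thesis by (simp add: trunc_nonlin_def)
qed

lemma trunc_nonlin_le_0: "1 < q \<Longrightarrow> 1 \<le> M \<Longrightarrow> t \<le> 1 \<Longrightarrow> trunc_nonlin q M t \<le> 0"
  using powr_le_self[of "max 0 (min t M)" q] by (simp add: trunc_nonlin_def)

lemma trunc_nonlin_ge_0: "1 < q \<Longrightarrow> 1 \<le> M \<Longrightarrow> 1 \<le> t \<Longrightarrow> 0 \<le> trunc_nonlin q M t"
  using self_le_powr[of "max 0 (min t M)" q] by (simp add: trunc_nonlin_def)

lemma trunc_nonlin_deriv:
  assumes "0 < t" "t < M"
  shows "DERIV (trunc_nonlin q M) t :> q * t powr (q - 1) - 1"
proof -
  have "DERIV (\<lambda>t. t powr q - t) t :> q * t powr (q - 1) - 1"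
    using assms by (auto intro!: derivative_eq_intros)
  then show ?thesis
    by (rule has_field_derivative_transform_within_open[of _ _ _ "{0<..<M}"])
      (use assms in \<open>auto simp: trunc_nonlin_inside\<close>)
qed

text \<open>
  The number \<open>(q + 1) powr (1 / (q - 1))\<close> lies beyond the second zero of
  \<open>t powr (q + 1) / (q + 1) - t^2 / 2\<close>, so the sublevel set \<open>F \<le> 0\<close> ends before it.
\<close>

lemma trunc_potential:
  fixes q M :: real
  defines "M0 \<equiv> (q + 1) powr (1 / (q - 1))"
  assumes q: "1 < q" and M: "M0 \<le> M"
  obtains F where "\<And>t. DERIV F t :> trunc_nonlin q M t" "\<And>t. - 1 / 2 \<le> F t"
    "\<And>t. F t \<le> 0 \<Longrightarrow> t \<le> M0" "\<And>t. 0 \<le> t \<Longrightarrow> t \<le> 1 \<Longrightarrow> F t \<le> 0"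
proof -
  have M0: "1 \<le> M0" unfolding M0_def using q by (intro ge_one_powr_ge_zero) auto
  then have M1: "1 \<le> M" using M by simp
  have "isCont (trunc_nonlin q M) x" for x
  proof -
    have "(q * M powr (q - 1) + 1)-lipschitz_on UNIV (trunc_nonlin q M)"
      using trunc_nonlin_lipschitz[OF q, of M] M1 q by (intro lipschitz_onI) (auto simp: dist_real_def)
    then show ?thesis using lipschitz_on_continuous_on continuous_on_eq_continuous_at by blast
  qed
  then obtain F where F: "F 0 = 0" "\<And>t. DERIV F t :> trunc_nonlin q M t"
    using antiderivative_exists by blast
  have Fc: "continuous_on A F" for A
    using F(2) DERIV_isCont by (meson continuous_at_imp_continuous_on)
  have decr: "F t \<le> F s" if "s \<le> t" "t \<le> 1" for s t
    by (rule nonpos_deriv_le[OF that(1) Fc F(2)]) (use trunc_nonlin_le_0[OF q M1] that in auto)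
  have incr: "F s \<le> F t" if "1 \<le> s" "s \<le> t" for s t
    by (rule nonneg_deriv_le[OF that(2) Fc F(2)]) (use trunc_nonlin_ge_0[OF q M1] that in auto)
  have formula: "F t = t powr (q + 1) / (q + 1) - t^2 / 2" if t: "0 \<le> t" "t \<le> M" for t
  proof -
    let ?d = "\<lambda>t. F t - (t powr (q + 1) / (q + 1) - t^2 / 2)"
    have "?d t = ?d 0"
    proof (rule DERIV_zero_const[of 0 t ?d, OF t(1)])
      show "continuous_on {0..t} ?d"
        using q by (intro continuous_intros continuous_on_powr' Fc) auto
      fix s assume s: "0 < s" "s < t"
      have "DERIV ?d s :> trunc_nonlin q M s - ((q + 1) * s powr q / (q + 1) - s)"
        using s q by (auto intro!: derivative_eq_intros F(2))
      then show "DERIV ?d s :> 0"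
        using s t q by (simp add: trunc_nonlin_inside)
    qed
    then show ?thesis using F(1) by simp
  qed
  have "F M0 = M0^2 / 2"
  proof -
    have "M0 powr (q - 1) = q + 1" using q by (simp add: M0_def powr_powr)
    moreover have "M0 powr (q + 1) = M0 powr (q - 1) * M0 powr 2" by (simp add: add.commute flip: powr_add)
    ultimately have "M0 powr (q + 1) = (q + 1) * M0^2" using M0 by simp
    then show ?thesis using formula[of M0] M0 M q by simp
  qed
  moreover have "0 < M0^2" using M0 by (intro zero_less_power) simp
  ultimately have FM0: "0 < F M0" by linarith
  \<comment> \<open>The minimum of \<open>F\<close> is attained at 1 and equals
    \<open>1 / (q + 1) - 1 / 2\<close>.\<close>
  have F1: "- 1 / 2 \<le> F 1" using formula[of 1] M1 q by simp
  show thesis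
  proof (rule that[of F, OF F(2)])
    show "- 1 / 2 \<le> F t" for t using F1 decr[of t 1] incr[of 1 t] by (cases "t \<le> 1") auto
    show "t \<le> M0" if "F t \<le> 0" for t
      using incr[OF M0, of t] FM0 that by linarith
    show "F t \<le> 0" if "0 \<le> t" "t \<le> 1" for t using decr[OF that] F(1) by simp
  qed
qed

theorem corollary1p5:
  fixes q l :: real and k :: nat
  assumes "1 < q" "q < 5"
    and "k > 0"
    and "l \<in> {2 * real k * (2 * real k + 3) / (q - 1) <..
               2 * (real k + 1) * (2 * real k + 5) / (q - 1)}"
  shows "\<exists>U. finite U \<and> card U = k \<and> U \<subseteq> invariant_solutions q l"
proof -
  have q: "1 < q" by fact
  have lq: "2 * real k * (2 * real k + 3) < l * (q - 1)"
    using assms by (simp add: pos_divide_less_eq)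
  have "0 \<le> 2 * real k * (2 * real k + 3) / (q - 1)" using q by simp
  then have l: "0 < l" using assms(4) by (simp only: greaterThanAtMost_iff) linarith
  define M0 where "M0 = (q + 1) powr (1 / (q - 1))"
  \<comment> \<open>The summand 1 puts \<open>M\<close> strictly above the bound of
    \<open>regular_upper_bound\<close>, which is free of \<open>M\<close>. Regular shots then stay
    in \<open>{0<..<M}\<close>, where the truncated nonlinearity is the original one and
    smooth.\<close>
  define M where "M = M0 + 6 * l * (M0 + 3 * q * sqrt l) powr q + 1"
  have M0: "1 \<le> M0" unfolding M0_def using q by (intro ge_one_powr_ge_zero) auto
  have M: "M0 + 6 * l * (M0 + 3 * q * sqrt l) powr q < M" "M0 \<le> M" "1 < M" using M0 l by (auto simp: M_def intro!: add_pos_nonneg)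
  let ?f = "trunc_nonlin q M"
  interpret shooting l "M powr q + M" "q * M powr (q - 1) + 1" ?f
  proof
    show "0 < l" by (fact l)
    show "\<bar>?f x\<bar> \<le> M powr q + M" for x using M q by (intro trunc_nonlin_bound) auto
    show "\<bar>?f x - ?f y\<bar> \<le> (q * M powr (q - 1) + 1) * \<bar>x - y\<bar>" for x y
      using M q by (intro trunc_nonlin_lipschitz) auto
    show "?f 0 = 0" by (simp add: trunc_nonlin_nonpos)
    show "?f 1 = 0" using M by (simp add: trunc_nonlin_inside)
  qed
  obtain F where F: "\<And>t. DERIV F t :> ?f t" "\<And>t. - 1 / 2 \<le> F t"
    "\<And>t. F t \<le> 0 \<Longrightarrow> t \<le> M0" "\<And>t. 0 \<le> t \<Longrightarrow> t \<le> 1 \<Longrightarrow> F t \<le> 0"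
    using trunc_potential[OF q M(2)[unfolded M0_def]] unfolding M0_def by metis
  have f_neg: "?f x < 0" if "0 < x" "x < 1" for x
    using that M q powr_less_mono'[of x 1 q] by (simp add: trunc_nonlin_inside)
  have solution: "\<exists>W W1 W2. C2_profile W W1 W2 \<and> W 0 = b \<and> C2_profile.lift W \<in> invariant_solutions q l"
    if b: "b \<in> {0<..<1}" "regular b" for b
  proof -
    have pos: "0 < prof b x" if "0 \<le> x" "x < 1" for x
      using regular_pos[OF trunc_nonlin_nonpos _ b(2) that] b by simp
    have upper: "prof b x \<le> M0 + 6 * l * (M0 + 3 * q * sqrt l) powr q" if "0 \<le> x" "x < 1" for x
      using F(4)[of b] b M0 q trunc_nonlin_upper[of q M] that
      by (intro regular_upper_bound[OF F(1,2) _ F(3)]) auto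
    obtain w1 where w1: "(prof b \<longlongrightarrow> w1) (at_left 1)" using regular_limit[OF b(2)] .
    have "0 < w1"
      using regular_limit_pos[OF trunc_nonlin_nonpos f_neg _ b(2) w1] b by simp
    moreover have "w1 \<le> M0 + 6 * l * (M0 + 3 * q * sqrt l) powr q"
      by (rule tendsto_upperbound[OF w1]) (use upper in \<open>auto intro!: eventually_at_left_1I[of 0]\<close>)
    ultimately have w1J: "w1 \<in> {0<..<M}" using M by simp
    have J: "prof b x \<in> {0<..<M}" if "0 \<le> x" "x < 1" for x using pos[OF that] upper[OF that] M by simp
    have f'c: "continuous_on {0<..<M} (\<lambda>t. q * t powr (q - 1) - 1)"
      by (intro continuous_intros) auto
    have f': "DERIV ?f t :> q * t powr (q - 1) - 1" if "t \<in> {0<..<M}" for t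
      using that by (intro trunc_nonlin_deriv) auto
    obtain W W1 W2 where W: "\<And>x. 0 \<le> x \<Longrightarrow> x < 1 \<Longrightarrow> W (x\<^sup>2) = prof b x"
      "\<And>y. y \<in> {0..1} \<Longrightarrow> W y \<in> {0<..<M}"
      "\<And>y. y \<in> {0..1} \<Longrightarrow> (W has_real_derivative W1 y) (at y within {0..1})"
      "\<And>y. y \<in> {0..1} \<Longrightarrow> (W1 has_real_derivative W2 y) (at y within {0..1})"
      "continuous_on {0..1} W2"
      "\<And>y. y \<in> {0..1} \<Longrightarrow> 4 * y * (1 - y) * W2 y + (6 - 10 * y) * W1 y + l * ?f (W y) = 0"
      by (rule regular_profile_C2[OF b(2) w1 J w1J f' f'c]) blast+
    interpret P: C2_profile W W1 W2 by unfold_locales (use W in auto)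
    have "P.lift \<in> invariant_solutions q l"
    proof (rule P.lift_solution)
      fix y :: real assume y: "y \<in> {0..1}"
      have Wy: "0 < W y" "W y < M" using W(2)[OF y] by auto
      then show "0 < W y" by simp
      show "4 * y * (1 - y) * W2 y + (6 - 10 * y) * W1 y + l * (W y powr q - W y) = 0"
        using W(6)[OF y] Wy by (simp add: trunc_nonlin_inside)
    qed
    moreover have "W 0 = b" using W(1)[of 0] by (simp add: prof_start)
    ultimately show ?thesis using P.C2_profile_axioms by blast
  qed
  have const: "\<exists>W W1 W2. C2_profile W W1 W2 \<and> W 0 = 1 \<and> C2_profile.lift W \<in> invariant_solutions q l"
  proof -
    interpret P: C2_profile "\<lambda>_. 1" "\<lambda>_. 0" "\<lambda>_. 0" by unfold_locales auto
    have "P.lift \<in> invariant_solutions q l" by (rule P.lift_solution) auto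
    then show ?thesis using P.C2_profile_axioms by blast
  qed
  \<comment> \<open>The \<open>k\<close> crossings give thresholds for 2 to \<open>k\<close> only,
    hence \<open>k - 1\<close> shots; the constant solution completes the number.\<close>
  obtain k' where k': "k = Suc k'" using assms(3) gr0_implies_Suc by blast
  \<comment> \<open>The slope of the nonlinearity at 1 turns \<open>lq\<close> into the hypothesis
    of \<open>oscillation_near_one\<close>.\<close>
  have "DERIV ?f 1 :> q - 1" using trunc_nonlin_deriv[of 1 M q] M by simp
  then obtain b y where "0 \<le> b" "b < 1" "y < 1" "osc b k y"
    using oscillation_near_one[of "q - 1" k] lq by blast
  then obtain B where B: "finite B" "card B = k'" "B \<subseteq> {0<..<1}" "\<And>b. b \<in> B \<Longrightarrow> regular b"
    using regular_family unfolding k' by blast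
  \<comment> \<open>A point of the circle \<open>x = 0\<close>, where \<open>radial_sq\<close>
    vanishes: evaluation there returns the initial value and tells the solutions apart.\<close>
  define p0 :: R5 where "p0 = (0, axis 1 1)"
  have p0: "p0 \<in> S4" by (simp add: p0_def norm_Pair norm_axis_1)
  have "\<exists>u\<in>invariant_solutions q l. u p0 = b" if "b \<in> insert 1 B" for b
  proof -
    obtain W W1 W2 where W: "C2_profile W W1 W2" "W 0 = b" "C2_profile.lift W \<in> invariant_solutions q l"
      using \<open>b \<in> insert 1 B\<close> const solution B by blast
    have "C2_profile.lift W p0 = b"
      using W(2) p0 by (simp add: C2_profile.lift_def[OF W(1)] radial_sq_def) (simp add: p0_def)
    then show ?thesis using W(3) by blast
  qed
  then obtain u where u: "\<And>b. b \<in> insert 1 B \<Longrightarrow> u b \<in> invariant_solutions q l"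
    "\<And>b. b \<in> insert 1 B \<Longrightarrow> u b p0 = b" by metis
  have "inj_on u (insert 1 B)" using u(2) by (intro inj_onI) metis
  then have "card (u ` insert 1 B) = card (insert 1 B)" by (rule card_image)
  moreover have "1 \<notin> B" using B(3) by auto
  ultimately have "card (u ` insert 1 B) = k" using B(1,2) k' by simp
  then show ?thesis using u(1) B(1) by (intro exI[of _ "u ` insert 1 B"]) auto
qed

end
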